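(* Assume that, for each $m\in\{1,2,\dots\}$, the independent-cluster model $Y_i=X_i\beta+Z_iU_i+E_i$, $i\in\{1,\dots,m\}$, holds with $\beta=\beta_m\in\mathbb{R}^{p_m}$. Suppose there are constants $c_1>1$ and $c_2\in(1,\infty)$ not depending on $m$ such that for every $m$: (i) $\bar n/q_1\geq c_1$; (ii) $c_2^{-1}\leq\gamma_{\min}(Z_i^{\mathsf T}Z_i)\leq\gamma_{\max}(Z_i^{\mathsf T}Z_i)\leq c_2$ for every $i\in\{1,\dots,m\}$; and that (iii') $p_m/m\to0$ as $m\to\infty$; and (iv) $X\in\mathbb{R}^{n\times p_m}$ has full column rank for every $m$. Then, if $r_m=r$ is fixed as $m\to\infty$, for any $\alpha\in(0,1)$ and every compact $\mathbb{A}\subseteq\mathbb{P}$, \[ \lim_{m\to\infty}\sup_{\psi\in\mathbb{A}}\left\vert\mathrm{P}_\psi\{\psi\in\tilde{\mathbb{C}}_n^S(\alpha)\}-(1-\alpha)\right\vert=0 . \]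
   Context: Model (quantities such as $n_i$, $p_m$, $X_i$, $Z_i$ may depend on $m$ in any way consistent with the model and assumptions; the index is often suppressed): independently for $i\in\{1,\dots,m\}$, $Y_i=X_i\beta+Z_iU_i+E_i$, where $X_i\in\mathbb{R}^{n_i\times p}$ and $Z_i\in\mathbb{R}^{n_i\times q_1}$ are non-stochastic, $E_i\sim\mathrm{N}(0,\psi_rI_{n_i})$ and $U_i\sim\mathrm{N}(0,\Psi_1)$ are independent. Let $n=\sum_{i=1}^mn_i=m\bar n$. Stack $Y=[Y_1^{\mathsf T},\dots,Y_m^{\mathsf T}]^{\mathsf T}$, $X=[X_1^{\mathsf T},\dots,X_m^{\mathsf T}]^{\mathsf T}$, and let $Z$ be block-diagonal with blocks $Z_1,\dots,Z_m$. Let $\psi\in\mathbb{R}^r$, $r=r_m=q_1(q_1+1)/2+1$ (so $r$ fixed means $q_1$ fixed), with first $r-1$ elements $\mathrm{vech}(\Psi_1)$ (half-vectorization, stacking the lower triangular part). $\Psi_1(\psi)$ is the symmetric $q_1\times q_1$ matrix with half-vectorization $[\psi_1,\dots,\psi_{r-1}]^{\mathsf T}$, $\Psi(\psi)=I_m\otimes\Psi_1(\psi)$, $\Sigma(\psi)=Z\Psi(\psi)Z^{\mathsf T}+\psi_rI_n$, so $Y\sim\mathrm{N}(X\beta,\Sigma(\psi))$. Let $H_j=\partial\Psi/\partial\psi_j$. The parameter set for $\psi$ is $\mathbb{P}=\{\psi\in\mathbb{R}^{r}:\Psi_1(\psi)\geq0,\ \psi_r>0\}$ ($\geq0$: positive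 semi-definite). $\mathrm{P}_\psi$ is probability when $\psi$ is the true covariance parameter (the restricted score below does not depend on $\beta$ in distribution). Restricted score confidence region: with $X$ of full column rank $p<n$, let $V\in\mathbb{R}^{n\times(n-p)}$ be semi-orthogonal ($V^{\mathsf T}V=I_{n-p}$) with $V^{\mathsf T}X=0$; $\tilde Y=V^{\mathsf T}Y$, $\tilde Z=V^{\mathsf T}Z$, $\tilde\Sigma=V^{\mathsf T}\Sigma V$, $\tilde R=\tilde\Sigma^{-1/2}\tilde Y$, $\tilde A_j=\tilde\Sigma^{-1/2}\tilde ZH_j\tilde Z^{\mathsf T}\tilde\Sigma^{-1/2}$ for $j<r$, $\tilde A_r=\tilde\Sigma^{-1}$ (all functions of $\psi$). $\tilde S(\psi)$ has elements $\frac12\{\tilde R^{\mathsf T}\tilde A_j\tilde R-\mathrm{tr}(\tilde A_j)\}$, $\tilde{\mathcal{I}}(\psi)=[\mathrm{tr}(\tilde A_i\tilde A_j)/2]_{i,j=1}^r$, $\tilde W^S(\psi)=\tilde{\mathcal{I}}(\psi)^{-1/2}\tilde S(\psi)$ (when $\tilde{\mathcal I}(\psi)$ is invertible), and $\tilde T_n^S(\psi)=\|\tilde W^S(\psi)\|^2$ with $\|\cdot\|$ the Euclidean norm. Then $\tilde{\mathbb{C}}_n^S(\alpha)=\{\psi\in\mathbb{P}:\tilde T_n^S(\psi)\leq c_{r,1-\alpha}\}$, where $c_{r,1-\alpha}$ is the $(1-\alpha)$th quantile of the $\chi^2_r$ distribution. $\gamma_{\min},\gamma_{\max}$ are smallest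 and largest eigenvalues. *)

theory Defs
  imports
    "HOL-Probability.Probability"
    "Jordan_Normal_Form.DL_Rank"
    "Jordan_Normal_Form.Gauss_Jordan_Elimination"
    "Jordan_Normal_Form.Spectral_Radius"
begin

unbundle no vec_syntax
unbundle no inner_syntax

text \<open>
  All indices start from 0: the clusters are \<open>i < m\<close>, and the component \<open>\<psi>\<^sub>j\<close> of
  \<open>\<psi> = (\<psi>\<^sub>1, \<dots>, \<psi>\<^sub>r)\<close> is \<open>\<psi> (j - 1)\<close>. The space of covariance parameters, whose
  dimension \<open>r\<close> does not change with \<open>m\<close>, is \<open>Euclidean_space r\<close>, so a parameter is a function
  \<open>nat \<Rightarrow> real\<close> that vanishes from \<open>r\<close> on.
\<close>

section \<open>Linear algebra\<close>

definition gamma_min :: "real mat \<Rightarrow> real" where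
  "gamma_min A = Min (spectrum A)"

definition gamma_max :: "real mat \<Rightarrow> real" where
  "gamma_max A = Max (spectrum A)"

definition psd :: "real mat \<Rightarrow> bool" where
  "psd A \<longleftrightarrow> square_mat A \<and> A\<^sup>T = A \<and> (\<forall>v\<in>carrier_vec (dim_row A). 0 \<le> v \<bullet> (A *\<^sub>v v))"

definition trace :: "real mat \<Rightarrow> real" where
  "trace A = (\<Sum>i<dim_row A. A $$ (i, i))"

definition mat_inv :: "real mat \<Rightarrow> real mat" where
  "mat_inv A = the (mat_inverse A)"

text \<open>The principal square root, only meaningful for positive semi-definite matrices.\<close>

definition mat_sqrt :: "real mat \<Rightarrow> real mat" where
  "mat_sqrt A = (THE B. psd B \<and> B * B = A)"

definition mat_inv_sqrt :: "real mat \<Rightarrow> real mat" where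
  "mat_inv_sqrt A = mat_inv (mat_sqrt A)"

definition kron :: "real mat \<Rightarrow> real mat \<Rightarrow> real mat" where
  "kron A B = mat (dim_row A * dim_row B) (dim_col A * dim_col B)
     (\<lambda>(i, j). A $$ (i div dim_row B, j div dim_col B) * B $$ (i mod dim_row B, j mod dim_col B))"

definition stack_vecs :: "nat \<Rightarrow> (nat \<Rightarrow> real vec) \<Rightarrow> real vec" where
  "stack_vecs m v = vec_of_list (concat (map (\<lambda>i. list_of_vec (v i)) [0..<m]))"

definition stack_mats :: "nat \<Rightarrow> nat \<Rightarrow> (nat \<Rightarrow> real mat) \<Rightarrow> real mat" where
  "stack_mats m p A = mat_of_rows p (concat (map (\<lambda>i. rows (A i)) [0..<m]))"

definition block_diag :: "nat \<Rightarrow> (nat \<Rightarrow> real mat) \<Rightarrow> real mat" where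
  "block_diag m A = diag_block_mat (map A [0..<m])"

text \<open>Half-vectorization: the columns of the lower triangular part, one after the other.\<close>

definition vech :: "real mat \<Rightarrow> real vec" where
  "vech A = vec_of_list (concat (map (\<lambda>j. map (\<lambda>i. A $$ (i, j)) [j..<dim_row A]) [0..<dim_col A]))"

section \<open>Probability distributions\<close>

definition borel_vec :: "nat \<Rightarrow> real vec measure" where
  "borel_vec d =
     vimage_algebra (carrier_vec d) (\<lambda>v. \<lambda>k\<in>{..<d}. v $ k) (\<Pi>\<^sub>M k\<in>{..<d}. (borel :: real measure))"

text \<open>The second argument is the variance; variance 0 gives a point mass.\<close>

definition normal_dist :: "real \<Rightarrow> real \<Rightarrow> real measure" where
  "normal_dist \<mu> v =
     (if v = 0 then return borel \<mu> else density lborel (\<lambda>x. ennreal (normal_density \<mu> (sqrt v) x)))"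

text \<open>
  \<open>W \<sim> N(\<mu>, \<Sigma>)\<close> in dimension \<open>d\<close>, where \<open>\<Sigma>\<close> may be singular:
  every linear combination of the components is univariate normal.
\<close>

definition mv_normal :: "'a measure \<Rightarrow> nat \<Rightarrow> ('a \<Rightarrow> real vec) \<Rightarrow> real vec \<Rightarrow> real mat \<Rightarrow> bool" where
  "mv_normal M d W \<mu> \<Sigma> \<longleftrightarrow>
     W \<in> measurable M (borel_vec d) \<and>
     (\<forall>t\<in>carrier_vec d. distr M borel (\<lambda>\<omega>. t \<bullet> W \<omega>) = normal_dist (t \<bullet> \<mu>) (t \<bullet> (\<Sigma> *\<^sub>v t)))"

definition chi_square :: "nat \<Rightarrow> real measure" where
  "chi_square r = distr (\<Pi>\<^sub>M i\<in>{..<r}. normal_dist 0 1) borel (\<lambda>x. \<Sum>i<r. (x i)\<^sup>2)"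

definition quantile :: "real measure \<Rightarrow> real \<Rightarrow> real" where
  "quantile D p = Inf {x. p \<le> cdf D x}"

section \<open>The independent-cluster model\<close>

definition npar :: "nat \<Rightarrow> nat" where
  "npar q = q * (q + 1) div 2 + 1"

text \<open>
  The entry in row \<open>a\<close> and column \<open>b \<le> a\<close> of a \<open>q \<times> q\<close> matrix is at position
  \<open>b * q + a - b * (b + 1) div 2\<close> of its half-vectorization, see \<open>vech_Psi1\<close> below.
\<close>

definition Psi1 :: "nat \<Rightarrow> (nat \<Rightarrow> real) \<Rightarrow> real mat" where
  "Psi1 q \<psi> = mat q q (\<lambda>(i, j). let a = max i j; b = min i j in \<psi> (b * q + a - b * (b + 1) div 2))"

lemma Psi1_sym: "(Psi1 q \<psi>)\<^sup>T = Psi1 q \<psi>"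
  by (rule eq_matI) (auto simp: Psi1_def max.commute min.commute)

lemma vech_Psi1: "vech (Psi1 q \<psi>) = vec (npar q - 1) \<psi>"
proof -
  define t where "t k = k * (k + 1) div 2" for k :: nat
  have t0: "t 0 = 0"
    by (simp add: t_def)
  have tSuc: "t (Suc k) = t k + Suc k" for k
    by (simp add: t_def)
  have le: "t k \<le> k * q" if "k < q" for k
  proof -
    have "k * (k + 1) \<le> k * q"
      using that by (intro mult_le_mono) auto
    then show ?thesis
      unfolding t_def by linarith
  qed
  have key: "concat (map (\<lambda>j. map (\<lambda>i. \<psi> (j * q + i - t j)) [j..<q]) [0..<k]) = map \<psi> [0..<k * q + k - t k]"
    if "k \<le> q" for k
    using that
  proof (induction k)
    case 0
    then show ?case by (simp add: t0)
  next
    case (Suc k)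
    define s where "s = k * q + k - t k"
    have lk: "t k \<le> k * q"
      using le Suc.prems by simp
    have "[s..<s + (q - k)] = map (\<lambda>i. i + (k * q - t k)) [k..<q]"
      by (rule nth_equalityI) (use Suc.prems lk in \<open>auto simp: s_def\<close>)
    moreover have "k * q + i - t k = i + (k * q - t k)" for i
      using lk by simp
    ultimately have "map (\<lambda>i. \<psi> (k * q + i - t k)) [k..<q] = map \<psi> [s..<s + (q - k)]"
      by simp
    moreover have "Suc k * q + Suc k - t (Suc k) = s + (q - k)"
      using lk Suc.prems by (simp add: s_def tSuc)
    moreover have "[0..<s + (q - k)] = [0..<s] @ [s..<s + (q - k)]"
      by (rule upt_add_eq_append) simp
    moreover have "concat (map (\<lambda>j. map (\<lambda>i. \<psi> (j * q + i - t j)) [j..<q]) [0..<k]) = map \<psi> [0..<s]"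
      using Suc.IH Suc.prems unfolding s_def by simp
    ultimately show ?case
      by (simp del: mult_Suc)
  qed
  have "map (\<lambda>i. Psi1 q \<psi> $$ (i, j)) [j..<q] = map (\<lambda>i. \<psi> (j * q + i - t j)) [j..<q]" for j
    by (auto simp: Psi1_def t_def Let_def max_def min_def)
  then have "concat (map (\<lambda>j. map (\<lambda>i. Psi1 q \<psi> $$ (i, j)) [j..<q]) [0..<q])
      = map \<psi> [0..<q * q + q - t q]"
    using key[of q] by (simp only: order_refl)
  moreover have "q * q + q - t q = npar q - 1"
  proof -
    have "even (q * (q + 1))"
      by simp
    then have "2 * t q = q * q + q"
      unfolding t_def by (metis dvd_mult_div_cancel distrib_left mult.right_neutral)
    then have "q * q + q - t q = t q"
      by linarith
    moreover have "npar q - 1 = t q"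
      by (simp add: npar_def t_def)
    ultimately show ?thesis
      by simp
  qed
  ultimately have "vech (Psi1 q \<psi>) = vec_of_list (map \<psi> [0..<npar q - 1])"
    by (simp add: vech_def Psi1_def)
  then show ?thesis
    by (auto intro!: eq_vecI simp: vec_of_list_index)
qed

definition Psi :: "nat \<Rightarrow> nat \<Rightarrow> (nat \<Rightarrow> real) \<Rightarrow> real mat" where
  "Psi m q \<psi> = kron (1\<^sub>m m) (Psi1 q \<psi>)"

definition psi_last :: "nat \<Rightarrow> (nat \<Rightarrow> real) \<Rightarrow> real" where
  "psi_last q \<psi> = \<psi> (npar q - 1)"

definition param_set :: "nat \<Rightarrow> (nat \<Rightarrow> real) set" where
  "param_set q = {\<psi> \<in> topspace (Euclidean_space (npar q)). psd (Psi1 q \<psi>) \<and> psi_last q \<psi> > 0}"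

text \<open>
  On the probability space \<open>M\<close>, the vectors \<open>Y 0, \<dots>, Y (m - 1)\<close> follow the model with parameters
  \<open>\<beta>\<close> and \<open>\<psi>\<close>; \<open>n i\<close> is the size of cluster \<open>i\<close>. Independence between clusters, together with
  that of random effects and errors within a cluster, is joint independence of all the \<open>U i\<close> and
  all the \<open>E i\<close>.
\<close>

definition cluster_model ::
  "'a measure \<Rightarrow> nat \<Rightarrow> nat \<Rightarrow> (nat \<Rightarrow> nat) \<Rightarrow> (nat \<Rightarrow> real mat) \<Rightarrow> (nat \<Rightarrow> real mat) \<Rightarrow> real vec \<Rightarrow>
   (nat \<Rightarrow> real) \<Rightarrow> (nat \<Rightarrow> 'a \<Rightarrow> real vec) \<Rightarrow> (nat \<Rightarrow> 'a \<Rightarrow> real vec) \<Rightarrow> (nat \<Rightarrow> 'a \<Rightarrow> real vec) \<Rightarrow> bool"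
where
  "cluster_model M m q n X Z \<beta> \<psi> U E Y \<longleftrightarrow>
     prob_space M \<and>
     (\<forall>i<m. mv_normal M q (U i) (0\<^sub>v q) (Psi1 q \<psi>)) \<and>
     (\<forall>i<m. mv_normal M (n i) (E i) (0\<^sub>v (n i)) (psi_last q \<psi> \<cdot>\<^sub>m 1\<^sub>m (n i))) \<and>
     prob_space.indep_vars M (case_sum (\<lambda>i. borel_vec q) (\<lambda>i. borel_vec (n i)))
       (case_sum U E) ({..<m} <+> {..<m}) \<and>
     (\<forall>i<m. \<forall>\<omega>\<in>space M. Y i \<omega> = X i *\<^sub>v \<beta> + Z i *\<^sub>v U i \<omega> + E i \<omega>)"

section \<open>The restricted score confidence region\<close>

text \<open>
  From here on, \<open>Z\<close> is the full block-diagonal \<open>n \<times> m q\<close> matrix, \<open>V\<close> is the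
  \<open>n \<times> (n - p)\<close> semi-orthogonal matrix and \<open>y\<close> is the stacked response vector.
\<close>

definition Sigma_mat :: "nat \<Rightarrow> nat \<Rightarrow> real mat \<Rightarrow> (nat \<Rightarrow> real) \<Rightarrow> real mat" where
  "Sigma_mat m q Z \<psi> = Z * Psi m q \<psi> * Z\<^sup>T + psi_last q \<psi> \<cdot>\<^sub>m 1\<^sub>m (dim_row Z)"

definition H_mat :: "nat \<Rightarrow> nat \<Rightarrow> nat \<Rightarrow> (nat \<Rightarrow> real) \<Rightarrow> real mat" where
  "H_mat m q j \<psi> = mat (m * q) (m * q)
     (\<lambda>(a, b). deriv (\<lambda>t. Psi m q (\<psi>(j := t)) $$ (a, b)) (\<psi> j))"

definition Sigma_res :: "nat \<Rightarrow> nat \<Rightarrow> real mat \<Rightarrow> real mat \<Rightarrow> (nat \<Rightarrow> real) \<Rightarrow> real mat" where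
  "Sigma_res m q Z V \<psi> = V\<^sup>T * Sigma_mat m q Z \<psi> * V"

definition R_res :: "nat \<Rightarrow> nat \<Rightarrow> real mat \<Rightarrow> real mat \<Rightarrow> real vec \<Rightarrow> (nat \<Rightarrow> real) \<Rightarrow> real vec" where
  "R_res m q Z V y \<psi> = mat_inv_sqrt (Sigma_res m q Z V \<psi>) *\<^sub>v (V\<^sup>T *\<^sub>v y)"

definition A_res :: "nat \<Rightarrow> nat \<Rightarrow> real mat \<Rightarrow> real mat \<Rightarrow> nat \<Rightarrow> (nat \<Rightarrow> real) \<Rightarrow> real mat" where
  "A_res m q Z V j \<psi> =
     (let S = Sigma_res m q Z V \<psi>; Zt = V\<^sup>T * Z in
      if j < npar q - 1 then mat_inv_sqrt S * Zt * H_mat m q j \<psi> * Zt\<^sup>T * mat_inv_sqrt S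
      else mat_inv S)"

definition score_res :: "nat \<Rightarrow> nat \<Rightarrow> real mat \<Rightarrow> real mat \<Rightarrow> real vec \<Rightarrow> (nat \<Rightarrow> real) \<Rightarrow> real vec" where
  "score_res m q Z V y \<psi> = vec (npar q)
     (\<lambda>j. 1 / 2 * (R_res m q Z V y \<psi> \<bullet> (A_res m q Z V j \<psi> *\<^sub>v R_res m q Z V y \<psi>)
                   - trace (A_res m q Z V j \<psi>)))"

definition info_res :: "nat \<Rightarrow> nat \<Rightarrow> real mat \<Rightarrow> real mat \<Rightarrow> (nat \<Rightarrow> real) \<Rightarrow> real mat" where
  "info_res m q Z V \<psi> = mat (npar q) (npar q)
     (\<lambda>(i, j). trace (A_res m q Z V i \<psi> * A_res m q Z V j \<psi>) / 2)"

definition W_res :: "nat \<Rightarrow> nat \<Rightarrow> real mat \<Rightarrow> real mat \<Rightarrow> real vec \<Rightarrow> (nat \<Rightarrow> real) \<Rightarrow> real vec" where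
  "W_res m q Z V y \<psi> = mat_inv_sqrt (info_res m q Z V \<psi>) *\<^sub>v score_res m q Z V y \<psi>"

definition T_res :: "nat \<Rightarrow> nat \<Rightarrow> real mat \<Rightarrow> real mat \<Rightarrow> real vec \<Rightarrow> (nat \<Rightarrow> real) \<Rightarrow> real" where
  "T_res m q Z V y \<psi> = W_res m q Z V y \<psi> \<bullet> W_res m q Z V y \<psi>"

text \<open>The statistic is undefined, and \<open>\<psi>\<close> left out of the region, where the information is singular.\<close>

definition conf_region ::
  "nat \<Rightarrow> nat \<Rightarrow> real mat \<Rightarrow> real mat \<Rightarrow> real vec \<Rightarrow> real \<Rightarrow> (nat \<Rightarrow> real) set" where
  "conf_region m q Z V y \<alpha> =
     {\<psi> \<in> param_set q. invertible_mat (info_res m q Z V \<psi>) \<and>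
        T_res m q Z V y \<psi> \<le> quantile (chi_square (npar q)) (1 - \<alpha>)}"

end

theory Submission
  imports Defs
begin

text \<open>
  Uniformity over a compact set follows from convergence along every sequence \<open>\<psi>\<^sub>m\<close> in it.
  Under \<open>\<psi>\<close> the vector \<open>R\<close> is standard Gaussian and \<open>\<Sigma>\<close> is linear in the parameter, so for
  every \<open>\<theta>\<close> the product \<open>\<theta> \<bullet> W\<close> is a centred quadratic form
  \<open>(R \<bullet> B R - tr B) / 2\<close> with \<open>tr B\<^sup>2 = 2 |\<theta>|\<^sup>2\<close>. The information is half a squared Frobenius
  norm. It grows at least linearly in \<open>m\<close>, because the squared Frobenius norm of
  \<open>\<Sigma>(u)\<close> is at least a multiple of \<open>m |u|\<^sup>2\<close>, while projecting out the fixed effects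
  loses only \<open>O(p\<^sub>m |u|\<^sup>2)\<close>. Hence the eigenvalues of \<open>B\<close> are \<open>O(1 / \<surd>m)\<close>, and a
  third-order expansion shows that the characteristic function of \<open>W\<close> at \<open>\<theta>\<close> tends to
  \<open>exp (- |\<theta>|\<^sup>2 / 2)\<close>. Averaging over a Gaussian \<open>\<theta>\<close> gives the Laplace transform of
  \<open>|W|\<^sup>2\<close>, which by the Weierstrass theorem determines the limit law \<open>\<chi>\<^sup>2\<^sub>r\<close>.
\<close>


section \<open>Spectral decomposition and square roots\<close>

text \<open>No limit of the information matrix is ever computed. Standardization makes
  \<open>fro B\<close> equal to 2 |\<theta>|^2 exactly, so m enters only through the operator norm
  of B, for which a lower bound on the information is enough. Cluster sizes may therefore grow
  without bound, and different entries of the information may grow at different rates. The condition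
  c1 > 1 separates the random effects from the error. If N = m q and every Z_i is the identity, then
  Psi_1 = I together with error variance -1 is a direction u with \<Sigma>(u) = 0. In general the
  random-effects part has rank at most m q, so its trace can cancel only that many of the N
  dimensions of the error part; the excess c1 - 1 is the margin. The boundary of the parameter set
  needs no special care: \<Sigma> is linear in \<psi> and bounded below by the error variance,
  whether or not Psi_1 is singular. All constants depend only on q, c1, c2 and on the bounds a, b of
  the compact set.\<close>

lemma mult_assoc_dim:
  fixes A B C :: "'a :: semiring_0 mat"
  assumes "dim_col A = dim_row B" "dim_col B = dim_row C"
  shows "(A * B) * C = A * (B * C)"
  using assms by (intro assoc_mult_mat[of _ "dim_row A" "dim_row B" _ "dim_row C" _ "dim_col C"]) auto

lemma transpose_mult_dim:
  fixes A B :: "'a :: comm_semiring_0 mat"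
  assumes "dim_col A = dim_row B"
  shows "(A * B)\<^sup>T = B\<^sup>T * A\<^sup>T"
  using assms by (intro transpose_mult[of _ "dim_row A" "dim_row B" _ "dim_col B"]) auto

lemma mult_mat_vec_assoc_dim:
  fixes A B :: "'a :: semiring_0 mat"
  assumes "dim_col A = dim_row B" "dim_col B = dim_vec v"
  shows "(A * B) *\<^sub>v v = A *\<^sub>v (B *\<^sub>v v)"
  using assms by (intro assoc_mult_mat_vec[of _ "dim_row A" "dim_row B" _ "dim_vec v"]) auto

lemma dim_mat_diag [simp]: "dim_row (mat_diag n d) = n" "dim_col (mat_diag n d) = n"
  by (simp_all add: mat_diag_def)

text \<open>Side conditions on \<open>dim_row\<close> and \<open>dim_col\<close> can be discharged
  by simplification, because no intermediate dimension has to be guessed. Together the rules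
  associate products to the right and push transposes inward.\<close>

lemmas mat_assoc = mult_assoc_dim transpose_mult_dim mult_mat_vec_assoc_dim

lemma scalar_prod_mult_mat_vec:
  fixes A :: "'a :: comm_semiring_1 mat"
  assumes "A \<in> carrier_mat n k" "v \<in> carrier_vec n" "w \<in> carrier_vec k"
  shows "v \<bullet> (A *\<^sub>v w) = (A\<^sup>T *\<^sub>v v) \<bullet> w"
  using assms by (metis transpose_vec_mult_scalar)

text \<open>For a complex eigenvector v, moving the symmetric matrix across the product of the
  conjugate of v with A v gives a |v|^2 = cnj a |v|^2, and |v|^2 is nonzero.\<close>

lemma symmetric_eigenvalue_real:
  fixes A :: "real mat"
  assumes A: "A \<in> carrier_mat n n" "A\<^sup>T = A"
    and a: "eigenvalue (map_mat complex_of_real A) a"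
  shows "a \<in> \<real>"
proof -
  let ?C = "map_mat complex_of_real A"
  have C: "?C \<in> carrier_mat n n" using A by auto
  have CT: "?C\<^sup>T = ?C" using A by (metis map_mat_transpose)
  from a obtain v where v: "v \<in> carrier_vec n" "v \<noteq> 0\<^sub>v n" "?C *\<^sub>v v = a \<cdot>\<^sub>v v"
    using C unfolding eigenvalue_def eigenvector_def by auto
  have conj: "?C *\<^sub>v conjugate v = conjugate (?C *\<^sub>v v)"
    using A(1) v(1) by (intro eq_vecI) (auto simp: scalar_prod_def)
  have "conjugate v \<bullet> (?C *\<^sub>v v) = (?C *\<^sub>v conjugate v) \<bullet> v"
    using scalar_prod_mult_mat_vec[OF C, of "conjugate v" v] CT v by simp
  then have "a * (conjugate v \<bullet> v) = cnj a * (conjugate v \<bullet> v)"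
    unfolding conj v using v(1) by (simp add: conjugate_smult_vec)
  moreover have "conjugate v \<bullet> v = v \<bullet>c v"
    using v by (intro comm_scalar_prod) auto
  moreover have "v \<bullet>c v \<noteq> 0"
    using v conjugate_square_eq_0_vec[OF v(1)] by blast
  ultimately show ?thesis by (simp add: Reals_cnj_iff)
qed

text \<open>Over the complex numbers the polynomial splits with real roots only, so its
  factorization is the image of a real one, and the embedding of real polynomials is
  injective.\<close>

lemma symmetric_char_poly_splits:
  fixes A :: "real mat"
  assumes A: "A \<in> carrier_mat n n" "A\<^sup>T = A"
  obtains es where "char_poly A = (\<Prod>e\<leftarrow>es. [:- e, 1:])"
proof -
  let ?C = "map_mat complex_of_real A"
  have C: "?C \<in> carrier_mat n n" using A by auto
  interpret P: map_poly_inj_comm_ring_hom complex_of_real ..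
  obtain as where as: "char_poly ?C = (\<Prod>a\<leftarrow>as. [:- a, 1:])"
    using char_poly_factorized[OF C] by auto
  have real: "a \<in> \<real>" if "a \<in> set as" for a
  proof -
    have "poly (char_poly ?C) a = 0"
      unfolding as using that by (simp add: poly_prod_list prod_list_zero_iff image_iff)
    then show ?thesis
      using symmetric_eigenvalue_real[OF A] eigenvalue_root_char_poly[OF C] by blast
  qed
  have "map_poly complex_of_real (char_poly A) = (\<Prod>a\<leftarrow>as. [:- a, 1:])"
    using of_real_hom.char_poly_hom[OF A(1), where ?'a = complex] as by simp
  also have "\<dots> = map_poly complex_of_real (\<Prod>a\<leftarrow>as. [:- Re a, 1:])"
    unfolding P.hom_prod_list
    using real by (auto intro!: arg_cong[of _ _ prod_list] simp: o_def)
  finally have "char_poly A = (\<Prod>e\<leftarrow>map Re as. [:- e, 1:])"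
    by (simp add: o_def)
  then show thesis by (rule that)
qed


text \<open>The reflection in the hyperplane orthogonal to a - b carries a to b because both have
  the same length. It supplies the orthogonal change of basis for deflation without completing a
  vector to an orthonormal basis.\<close>

lemma householder_reflection:
  fixes a b :: "real vec"
  assumes a: "a \<in> carrier_vec n" "a \<bullet> a = 1" and b: "b \<in> carrier_vec n" "b \<bullet> b = 1"
  obtains H where "H \<in> carrier_mat n n" "H\<^sup>T = H" "H * H = 1\<^sub>m n" "H *\<^sub>v a = b"
proof (cases "a = b")
  case True
  then show ?thesis using a by (intro that[of "1\<^sub>m n"]) auto
next
  case False
  define u where "u = a - b"
  have u: "u \<in> carrier_vec n" using a b by (auto simp: u_def)
  have "u \<noteq> 0\<^sub>v n"
  proof
    assume "u = 0\<^sub>v n"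
    then have "\<And>i. i < n \<Longrightarrow> a $ i - b $ i = 0"
      using a b unfolding u_def by (metis carrier_vecD index_minus_vec(1) index_zero_vec(1))
    then have "a = b" using a b by (intro eq_vecI) auto
    then show False using False by simp
  qed
  then have uu: "u \<bullet> u \<noteq> 0"
    using conjugate_square_eq_0_vec[OF u] by simp
  define c where "c = 2 / (u \<bullet> u)"
  define H where "H = mat n n (\<lambda>(i, j). (if i = j then 1 else 0) - c * u $ i * u $ j)"
  have uu_sum: "(\<Sum>k<n. u $ k * u $ k) = u \<bullet> u"
    using u by (simp add: scalar_prod_def lessThan_atLeast0)
  have HH: "H * H = 1\<^sub>m n"
  proof (rule eq_matI)
    fix i j assume "i < dim_row (1\<^sub>m n :: real mat)" "j < dim_col (1\<^sub>m n :: real mat)"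
    then have ij: "i < n" "j < n" by auto
    have "(H * H) $$ (i, j) = (\<Sum>k<n. ((if i = k then 1 else 0) - c * u $ i * u $ k)
        * ((if k = j then 1 else 0) - c * u $ k * u $ j))"
      using ij by (simp add: H_def scalar_prod_def lessThan_atLeast0)
    also have "\<dots> = (\<Sum>k<n. (if k = i then (if k = j then 1 else 0) - c * u $ k * u $ j else 0)
        - (if k = j then c * u $ i * u $ k else 0) + c * c * u $ i * u $ j * (u $ k * u $ k))"
      by (intro sum.cong) (auto simp: algebra_simps)
    also have "\<dots> = (if i = j then 1 else 0) - c * u $ i * u $ j - c * u $ i * u $ j
        + c * c * u $ i * u $ j * (u \<bullet> u)"
      using ij unfolding sum.distrib sum_subtractf sum_distrib_left[symmetric] uu_sum
      by (simp add: sum.delta)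
    also have "\<dots> = (if i = j then 1 else 0)"
      using uu by (simp add: c_def field_simps)
    finally show "(H * H) $$ (i, j) = 1\<^sub>m n $$ (i, j)" using ij by simp
  qed (auto simp: H_def)
  have Ha: "H *\<^sub>v a = b"
  proof (rule eq_vecI)
    fix i assume "i < dim_vec b"
    then have i: "i < n" using b by simp
    have ab: "b \<bullet> a = a \<bullet> b" using a b by (intro comm_scalar_prod) auto
    \<comment> \<open>Unit lengths make u.u twice u.a, so the reflection subtracts exactly u from
      a.\<close>
    have "u \<bullet> u = 2 * (1 - a \<bullet> b)" "u \<bullet> a = 1 - a \<bullet> b"
      using a b ab unfolding u_def
      by (simp_all add: minus_scalar_prod_distrib[of _ n] scalar_prod_minus_distrib[of _ n])
    then have "c * (u \<bullet> a) = 1" using uu by (simp add: c_def field_simps)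
    moreover have "(\<Sum>k<n. u $ k * a $ k) = u \<bullet> a"
      using a by (simp add: scalar_prod_def lessThan_atLeast0)
    moreover have "(H *\<^sub>v a) $ i = (\<Sum>k<n. (if k = i then a $ k else 0) - u $ i * (c * (u $ k * a $ k)))"
      using i a by (auto simp: H_def scalar_prod_def lessThan_atLeast0 algebra_simps intro!: sum.cong)
    ultimately have "(H *\<^sub>v a) $ i = a $ i - u $ i"
      using i by (simp add: sum_subtractf sum_distrib_left[symmetric] sum.delta)
    then show "(H *\<^sub>v a) $ i = b $ i" using i a b by (simp add: u_def)
  qed (use b in \<open>auto simp: H_def\<close>)
  show ?thesis
    by (rule that[of H]) (use HH Ha in \<open>auto simp: H_def intro!: eq_matI\<close>)
qed

lemma symmetric_eigenvector_exists:
  fixes A :: "real mat"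
  assumes A: "A \<in> carrier_mat n n" "A\<^sup>T = A" and n: "0 < n"
  obtains e v where "v \<in> carrier_vec n" "v \<bullet> v = 1" "A *\<^sub>v v = e \<cdot>\<^sub>v v"
proof -
  obtain es where es: "char_poly A = (\<Prod>e\<leftarrow>es. [:- e, 1:])"
    using symmetric_char_poly_splits[OF A] by blast
  have "es \<noteq> []" using degree_monic_char_poly[OF A(1)] n es by auto
  then obtain e where "e \<in> set es" by (cases es) auto
  then have "poly (char_poly A) e = 0"
    unfolding es by (simp add: poly_prod_list prod_list_zero_iff image_iff)
  then have "eigenvalue A e" using eigenvalue_root_char_poly[OF A(1)] by simp
  then obtain w where w: "w \<in> carrier_vec n" "w \<noteq> 0\<^sub>v n" "A *\<^sub>v w = e \<cdot>\<^sub>v w"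
    using A unfolding eigenvalue_def eigenvector_def by auto
  have ww: "0 < w \<bullet> w" using conjugate_square_greater_0_vec[OF w(1)] w(2) by simp
  define v where "v = (1 / sqrt (w \<bullet> w)) \<cdot>\<^sub>v w"
  show ?thesis
  proof (rule that)
    show "v \<in> carrier_vec n" using w by (simp add: v_def)
    show "v \<bullet> v = 1" using w ww by (simp add: v_def)
    show "A *\<^sub>v v = e \<cdot>\<^sub>v v"
      using w A unfolding v_def by (simp add: mult_mat_vec smult_smult_assoc mult.commute)
  qed
qed

text \<open>Deflation: a reflection H sends a unit eigenvector to the first unit vector, so H A H
  has first column e times that vector and, by symmetry, the matching first row. The remaining block
  is symmetric and one size smaller.\<close>

theorem spectral_decomposition:
  fixes A :: "real mat"
  assumes "A \<in> carrier_mat n n" "A\<^sup>T = A"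
  obtains Q d where "Q \<in> carrier_mat n n" "Q\<^sup>T * Q = 1\<^sub>m n" "Q * Q\<^sup>T = 1\<^sub>m n"
    "A = Q * mat_diag n d * Q\<^sup>T"
  using assms
proof (induction n arbitrary: A thesis)
  case 0
  show ?case by (rule "0.prems"(1)[of "1\<^sub>m 0"]) (use "0.prems" in auto)
next
  case (Suc n)
  let ?e = "unit_vec (Suc n) 0 :: real vec"
  note A = Suc.prems(2,3)
  obtain e v where v: "v \<in> carrier_vec (Suc n)" "v \<bullet> v = 1" "A *\<^sub>v v = e \<cdot>\<^sub>v v"
    using symmetric_eigenvector_exists[OF A] by blast
  obtain H where H: "H \<in> carrier_mat (Suc n) (Suc n)" "H\<^sup>T = H" "H * H = 1\<^sub>m (Suc n)" "H *\<^sub>v v = ?e"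
    using householder_reflection[OF v(1,2), of ?e] by auto
  have He: "H *\<^sub>v ?e = v"
    using H v by (metis assoc_mult_mat_vec one_mult_mat_vec)
  define B where "B = H * A * H"
  have B: "B \<in> carrier_mat (Suc n) (Suc n)" using H A by (simp add: B_def)
  have BT: "B\<^sup>T = B"
  proof -
    have "B\<^sup>T = H\<^sup>T * (H * A)\<^sup>T"
      unfolding B_def by (rule transpose_mult) (use H A in auto)
    also have "(H * A)\<^sup>T = A\<^sup>T * H\<^sup>T" by (rule transpose_mult) (use H A in auto)
    finally show ?thesis unfolding B_def H(2) A(2) using H A by (simp add: assoc_mult_mat)
  qed
  have AB: "A = H * B * H"
  proof -
    have "H * B * H = (H * H) * A * (H * H)"
      unfolding B_def using H(1) A(1) by (simp add: assoc_mult_mat[of _ "Suc n" "Suc n" _ "Suc n" _ "Suc n"])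
    then show ?thesis using H A by simp
  qed
  have "B *\<^sub>v ?e = H *\<^sub>v (A *\<^sub>v (H *\<^sub>v ?e))"
    unfolding B_def using H A by (simp add: assoc_mult_mat_vec[of _ "Suc n" "Suc n" _ "Suc n"])
  then have Be: "B *\<^sub>v ?e = e \<cdot>\<^sub>v ?e"
    using He v H by (simp add: mult_mat_vec)
  have B0: "B $$ (i, 0) = (if i = 0 then e else 0)" if "i < Suc n" for i
  proof -
    have "B $$ (i, 0) = (B *\<^sub>v ?e) $ i" using that B by simp
    then show ?thesis unfolding Be using that by auto
  qed
  define C where "C = mat n n (\<lambda>(i, j). B $$ (Suc i, Suc j))"
  have C: "C \<in> carrier_mat n n" by (simp add: C_def)
  have BS: "B $$ (i, j) = B $$ (j, i)" if "i < Suc n" "j < Suc n" for i j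
    using that B BT by (metis carrier_matD index_transpose_mat(1))
  have CT: "C\<^sup>T = C" using BS by (intro eq_matI) (auto simp: C_def)
  obtain Q d where Q: "Q \<in> carrier_mat n n" "Q\<^sup>T * Q = 1\<^sub>m n" "Q * Q\<^sup>T = 1\<^sub>m n"
    "C = Q * mat_diag n d * Q\<^sup>T"
    using Suc.IH[OF _ C CT] by blast
  let ?F = "\<lambda>X Y. four_block_mat X (0\<^sub>m 1 n) (0\<^sub>m n 1) Y"
  define E where "E = mat 1 1 (\<lambda>_. e)"
  define d' where "d' = (\<lambda>i. case i of 0 \<Rightarrow> e | Suc i \<Rightarrow> d i)"
  have mult: "?F X Y * ?F X' Y' = ?F (X * X') (Y * Y')"
    if "X \<in> carrier_mat 1 1" "X' \<in> carrier_mat 1 1" "Y \<in> carrier_mat n n" "Y' \<in> carrier_mat n n"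
    for X X' Y Y' :: "real mat"
    using that by (subst mult_four_block_mat) auto
  have BF: "B = ?F E C"
  proof (rule eq_matI)
    fix i j assume "i < dim_row (?F E C)" "j < dim_col (?F E C)"
    then have ij: "i < Suc n" "j < Suc n" by (auto simp: E_def C_def)
    then show "B $$ (i, j) = ?F E C $$ (i, j)"
      using B0[of i] B0[of j] BS[of 0 j] by (cases i; cases j) (auto simp: E_def C_def)
  qed (use B in \<open>auto simp: E_def C_def\<close>)
  have D: "mat_diag (Suc n) d' = ?F E (mat_diag n d)"
    by (rule eq_matI) (auto simp: E_def mat_diag_def d'_def split: nat.split)
  define G where "G = ?F (1\<^sub>m 1) Q"
  have G: "G \<in> carrier_mat (Suc n) (Suc n)"
    using four_block_carrier_mat[of "1\<^sub>m 1" 1 1 Q n n] Q(1) by (simp add: G_def)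
  have GT: "G\<^sup>T = ?F (1\<^sub>m 1) (Q\<^sup>T)"
    unfolding G_def using Q by (subst transpose_four_block_mat) auto
  have one: "?F (1\<^sub>m 1) (1\<^sub>m n) = 1\<^sub>m (Suc n)" by (rule eq_matI) auto
  have E: "E \<in> carrier_mat 1 1" by (simp add: E_def)
  have G1: "G\<^sup>T * G = 1\<^sub>m (Suc n)" "G * G\<^sup>T = 1\<^sub>m (Suc n)"
    unfolding GT unfolding G_def using Q one by (simp_all add: mult del: One_nat_def)
  have GB: "B = G * mat_diag (Suc n) d' * G\<^sup>T"
    unfolding GT D unfolding G_def using Q E BF by (simp add: mult del: One_nat_def)
  have HGT: "(H * G)\<^sup>T = G\<^sup>T * H" using H G by (metis transpose_mult)
  show ?case
  proof (rule Suc.prems(1)[of "H * G" d'])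
    show "H * G \<in> carrier_mat (Suc n) (Suc n)" using H G by simp
    have "(H * G)\<^sup>T * (H * G) = G\<^sup>T * ((H * H) * G)"
      unfolding HGT using H(1) G by (simp add: mat_assoc)
    then show "(H * G)\<^sup>T * (H * G) = 1\<^sub>m (Suc n)" using H G G1 by simp
    have "(H * G) * (H * G)\<^sup>T = H * ((G * G\<^sup>T) * H)"
      unfolding HGT using H(1) G by (simp add: mat_assoc)
    then show "(H * G) * (H * G)\<^sup>T = 1\<^sub>m (Suc n)" using H G G1 by simp
    show "A = H * G * mat_diag (Suc n) d' * (H * G)\<^sup>T"
      unfolding HGT AB GB using H(1) G by (simp add: mat_assoc)
  qed
qed


lemma col_mult_dim: "j < dim_col B \<Longrightarrow> dim_col A = dim_row B \<Longrightarrow> col (A * B) j = A *\<^sub>v col B j"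
  by (intro eq_vecI) auto

lemma spectral_decomposition_eigenvalue:
  fixes A :: "real mat"
  assumes Q: "Q \<in> carrier_mat n n" "Q\<^sup>T * Q = 1\<^sub>m n" and A: "A = Q * mat_diag n d * Q\<^sup>T" and k: "k < n"
  shows "col Q k \<in> carrier_vec n" "col Q k \<bullet> col Q k = 1" "A *\<^sub>v col Q k = d k \<cdot>\<^sub>v col Q k"
proof -
  show "col Q k \<in> carrier_vec n" using Q k by simp
  have "col Q k \<bullet> col Q k = (Q\<^sup>T * Q) $$ (k, k)" using Q(1) k by simp
  then show "col Q k \<bullet> col Q k = 1" using Q(2) k by simp
  have AQ: "A * Q = Q * mat_diag n d"
    unfolding A using Q by (simp add: mat_assoc)
  have "A *\<^sub>v col Q k = col (A * Q) k"
    using Q(1) k by (intro col_mult_dim[symmetric]) (simp_all add: A)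
  also have "\<dots> = d k \<cdot>\<^sub>v col Q k"
    unfolding AQ mat_diag_mult_right[OF Q(1)] using Q(1) k by (intro eq_vecI) auto
  finally show "A *\<^sub>v col Q k = d k \<cdot>\<^sub>v col Q k" .
qed

lemma mat_diag_mult_vec:
  assumes "w \<in> carrier_vec n"
  shows "mat_diag n d *\<^sub>v w = vec n (\<lambda>k. d k * w $ k :: real)"
  using assms
  by (intro eq_vecI) (auto simp: mat_diag_def scalar_prod_def if_distrib[of "\<lambda>x. x * _"] cong: if_cong)

lemma diagonal_quadratic_form:
  fixes A :: "real mat"
  assumes Q: "Q \<in> carrier_mat n n" and A: "A = Q * mat_diag n d * Q\<^sup>T" and x: "x \<in> carrier_vec n"
  shows "x \<bullet> (A *\<^sub>v x) = (\<Sum>k<n. d k * ((Q\<^sup>T *\<^sub>v x) $ k)\<^sup>2)"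
proof -
  let ?w = "Q\<^sup>T *\<^sub>v x"
  have w: "?w \<in> carrier_vec n" using Q x by (intro carrier_vecI) simp
  have D: "mat_diag n d *\<^sub>v ?w = vec n (\<lambda>k. d k * ?w $ k)"
    by (rule mat_diag_mult_vec[OF w])
  have "A *\<^sub>v x = Q *\<^sub>v (mat_diag n d *\<^sub>v ?w)"
    unfolding A using Q x by (simp add: mat_assoc)
  then have "x \<bullet> (A *\<^sub>v x) = ?w \<bullet> (mat_diag n d *\<^sub>v ?w)"
    using scalar_prod_mult_mat_vec[OF Q x, of "mat_diag n d *\<^sub>v ?w"] D by simp
  also have "\<dots> = (\<Sum>k<n. d k * (?w $ k)\<^sup>2)"
    unfolding D by (simp add: scalar_prod_def power2_eq_square lessThan_atLeast0 algebra_simps)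
  finally show ?thesis .
qed

lemma zero_mult_vec: "v \<in> carrier_vec n \<Longrightarrow> 0\<^sub>m k n *\<^sub>v v = (0\<^sub>v k :: real vec)"
  by (intro eq_vecI) auto

lemma symmetric_eq_zeroI:
  fixes A :: "real mat"
  assumes A: "A \<in> carrier_mat n n" "A\<^sup>T = A"
    and ev: "\<And>e v. v \<in> carrier_vec n \<Longrightarrow> v \<bullet> v = 1 \<Longrightarrow> A *\<^sub>v v = e \<cdot>\<^sub>v v \<Longrightarrow> e = 0"
  shows "A = 0\<^sub>m n n"
proof -
  obtain Q d where Q: "Q \<in> carrier_mat n n" "Q\<^sup>T * Q = 1\<^sub>m n" "Q * Q\<^sup>T = 1\<^sub>m n"
    "A = Q * mat_diag n d * Q\<^sup>T"
    using spectral_decomposition[OF A] by blast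
  have "d k = 0" if "k < n" for k
    using ev spectral_decomposition_eigenvalue[OF Q(1,2,4) that] .
  then have "mat_diag n d = 0\<^sub>m n n" by (intro eq_matI) (auto simp: mat_diag_def)
  then show ?thesis unfolding Q(4) using Q(1) by simp
qed

text \<open>For D = B - C the equality of squares gives B D + D C = 0. At a unit eigenvector v of D
  with value e this reads e (v.Bv + v.Cv) = 0, while e = v.Bv - v.Cv. Both forms are nonnegative, so
  e = 0, and a symmetric matrix with only zero eigenvalues vanishes.\<close>

lemma psd_sqrt_unique:
  assumes B: "psd B" "B * B = A" and C: "psd C" "C * C = A"
  shows "B = C"
proof -
  define n where "n = dim_row A"
  have dB: "dim_row B = n" "dim_col B = n" using B by (auto simp: psd_def n_def)
  have dC: "dim_row C = n" "dim_col C = n" using C by (auto simp: psd_def n_def)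
  have cB: "B \<in> carrier_mat n n" and cC: "C \<in> carrier_mat n n" using dB dC by auto
  have sB: "B\<^sup>T = B" and sC: "C\<^sup>T = C" using B C by (auto simp: psd_def)
  define D where "D = B - C"
  have D: "D \<in> carrier_mat n n" "D\<^sup>T = D"
    using cB cC sB sC by (auto simp: D_def transpose_minus)
  have "D = 0\<^sub>m n n"
  proof (rule symmetric_eq_zeroI[OF D])
    fix e v assume v: "v \<in> carrier_vec n" "v \<bullet> v = 1" "D *\<^sub>v v = e \<cdot>\<^sub>v v"
    have sum0: "B * D + D * C = 0\<^sub>m n n"
      unfolding D_def using cB cC B(2) C(2)
      by (simp add: mult_minus_distrib_mat minus_mult_distrib_mat) (auto intro!: eq_matI)
    have "v \<bullet> ((B * D + D * C) *\<^sub>v v) = v \<bullet> (B *\<^sub>v (D *\<^sub>v v)) + v \<bullet> (D *\<^sub>v (C *\<^sub>v v))"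
      using cB cC D v
      by (simp add: add_mult_distrib_mat_vec[of _ n n] mat_assoc scalar_prod_add_distrib[of _ n])
    also have "v \<bullet> (D *\<^sub>v (C *\<^sub>v v)) = e * (v \<bullet> (C *\<^sub>v v))"
      using scalar_prod_mult_mat_vec[OF D(1) v(1), of "C *\<^sub>v v"] D(2) v cC by simp
    also have "v \<bullet> (B *\<^sub>v (D *\<^sub>v v)) = e * (v \<bullet> (B *\<^sub>v v))"
      using v cB by (simp add: mult_mat_vec)
    finally have *: "e * (v \<bullet> (B *\<^sub>v v) + v \<bullet> (C *\<^sub>v v)) = 0"
      unfolding sum0 using v by (simp add: distrib_left zero_mult_vec)
    have nn: "0 \<le> v \<bullet> (B *\<^sub>v v)" "0 \<le> v \<bullet> (C *\<^sub>v v)"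
      using B(1) C(1) v(1) dB dC by (auto simp: psd_def)
    have "v \<bullet> (D *\<^sub>v v) = v \<bullet> (B *\<^sub>v v) - v \<bullet> (C *\<^sub>v v)"
      unfolding D_def using cB cC v
      by (simp add: minus_mult_distrib_mat_vec[of _ n n] scalar_prod_minus_distrib[of _ n])
    moreover have "v \<bullet> (D *\<^sub>v v) = e" using v by simp
    ultimately have e: "e = v \<bullet> (B *\<^sub>v v) - v \<bullet> (C *\<^sub>v v)" by simp
    show "e = 0"
    proof (rule ccontr)
      assume "e \<noteq> 0"
      then have "v \<bullet> (B *\<^sub>v v) = 0" "v \<bullet> (C *\<^sub>v v) = 0" using * nn by auto
      then show False using e \<open>e \<noteq> 0\<close> by simp
    qed
  qed
  then have "(B - C) $$ (i, j) = 0" if "i < n" "j < n" for i j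
    using that by (simp add: D_def)
  then show ?thesis using cB cC by (intro eq_matI) auto
qed

lemma mat_inv_eqI:
  assumes A: "A \<in> carrier_mat n n" and B: "B \<in> carrier_mat n n" and AB: "A * B = 1\<^sub>m n" "B * A = 1\<^sub>m n"
  shows "mat_inv A = B"
proof (cases "mat_inverse A")
  case None
  have "A \<in> Units (ring_mat TYPE(real) n ())"
    unfolding Units_def ring_mat_simps using A B AB by auto
  then show ?thesis using mat_inverse(1)[OF A None, of "()"] by blast
next
  case (Some C)
  then have C: "C * A = 1\<^sub>m n" "C \<in> carrier_mat n n" using mat_inverse(2)[OF A] by auto
  have "C = C * (A * B)" using C AB by simp
  also have "\<dots> = (C * A) * B" using A B C(2) by (simp add: mat_assoc)
  finally show ?thesis using C B Some by (simp add: mat_inv_def)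
qed

text \<open>This gives meaning to the description in \<open>mat_sqrt\<close> and to the option in
  \<open>mat_inv\<close>. Later arguments use only the listed identities for the root L and its
  inverse K.\<close>

lemma pos_def_sqrt:
  fixes S :: "real mat"
  assumes S: "S \<in> carrier_mat n n" "S\<^sup>T = S"
    and pos: "\<And>v. v \<in> carrier_vec n \<Longrightarrow> v \<noteq> 0\<^sub>v n \<Longrightarrow> 0 < v \<bullet> (S *\<^sub>v v)"
  obtains L K where "L \<in> carrier_mat n n" "K \<in> carrier_mat n n" "L\<^sup>T = L" "K\<^sup>T = K"
    "L * L = S" "L * K = 1\<^sub>m n" "K * L = 1\<^sub>m n" "K = mat_inv_sqrt S" "mat_inv S = K * K"
proof -
  obtain Q d where Q: "Q \<in> carrier_mat n n" "Q\<^sup>T * Q = 1\<^sub>m n" "Q * Q\<^sup>T = 1\<^sub>m n"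
    "S = Q * mat_diag n d * Q\<^sup>T"
    using spectral_decomposition[OF S] by blast
  have d: "0 < d k" if k: "k < n" for k
  proof -
    note ev = spectral_decomposition_eigenvalue[OF Q(1,2,4) k]
    have "col Q k \<noteq> 0\<^sub>v n"
    proof
      assume "col Q k = 0\<^sub>v n"
      then show False using ev(2) by simp
    qed
    then have "0 < col Q k \<bullet> (S *\<^sub>v col Q k)" using pos ev(1) by blast
    also have "\<dots> = d k" unfolding ev(3) using ev(1,2) by simp
    finally show ?thesis .
  qed
  have d0: "d k \<noteq> 0" if "k < n" for k using d[OF that] by simp
  define L where "L = Q * mat_diag n (\<lambda>k. sqrt (d k)) * Q\<^sup>T"
  define K where "K = Q * mat_diag n (\<lambda>k. 1 / sqrt (d k)) * Q\<^sup>T"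
  have diag_cong: "mat_diag n f = mat_diag n g" if "\<And>k. k < n \<Longrightarrow> f k = g k" for f g :: "nat \<Rightarrow> real"
    using that by (auto simp: mat_diag_def intro!: eq_matI)
  have diagT: "(mat_diag n f)\<^sup>T = mat_diag n f" for f :: "nat \<Rightarrow> real"
    by (auto simp: mat_diag_def intro!: eq_matI)
  have prod: "(Q * mat_diag n f * Q\<^sup>T) * (Q * mat_diag n g * Q\<^sup>T) = Q * mat_diag n (\<lambda>k. f k * g k) * Q\<^sup>T"
    for f g
  proof -
    have "(Q * mat_diag n f * Q\<^sup>T) * (Q * mat_diag n g * Q\<^sup>T) =
        Q * (mat_diag n f * ((Q\<^sup>T * Q) * (mat_diag n g * Q\<^sup>T)))"
      using Q(1) by (simp add: mat_assoc)
    also have "\<dots> = Q * ((mat_diag n f * mat_diag n g) * Q\<^sup>T)"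
      unfolding Q(2) using Q(1) by (simp add: mat_assoc del: mat_diag_diag)
    finally show ?thesis using Q(1) by (simp add: mat_assoc)
  qed
  have L: "L \<in> carrier_mat n n" "L\<^sup>T = L" and K: "K \<in> carrier_mat n n" "K\<^sup>T = K"
    using Q(1) by (auto simp: L_def K_def mat_assoc diagT)
  have LL: "L * L = S"
  proof -
    have "mat_diag n (\<lambda>k. sqrt (d k) * sqrt (d k)) = mat_diag n d"
      by (rule diag_cong) (use d in \<open>simp add: abs_of_pos\<close>)
    then show ?thesis unfolding L_def prod Q(4) by simp
  qed
  have LK: "L * K = 1\<^sub>m n" "K * L = 1\<^sub>m n"
  proof -
    have "mat_diag n (\<lambda>k. sqrt (d k) * (1 / sqrt (d k))) = 1\<^sub>m n"
      unfolding mat_diag_one[symmetric] by (rule diag_cong) (simp add: d0)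
    moreover have "mat_diag n (\<lambda>k. 1 / sqrt (d k) * sqrt (d k)) = 1\<^sub>m n"
      unfolding mat_diag_one[symmetric] by (rule diag_cong) (simp add: d0)
    ultimately show "L * K = 1\<^sub>m n" "K * L = 1\<^sub>m n"
      unfolding L_def K_def prod using Q(1,3) by simp_all
  qed
  have psdL: "psd L"
  proof -
    have "0 \<le> v \<bullet> (L *\<^sub>v v)" if v: "v \<in> carrier_vec n" for v
      unfolding diagonal_quadratic_form[OF Q(1) L_def v] using d by (intro sum_nonneg mult_nonneg_nonneg) (simp_all add: less_imp_le)
    then show ?thesis using L by (auto simp: psd_def)
  qed
  have "mat_sqrt S = L"
    unfolding mat_sqrt_def using psdL LL psd_sqrt_unique by (intro the_equality) auto
  then have "mat_inv_sqrt S = K"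
    unfolding mat_inv_sqrt_def using mat_inv_eqI[OF L(1) K(1) LK] by simp
  moreover have "mat_inv S = K * K"
  proof (rule mat_inv_eqI[OF S(1)])
    have "S * (K * K) = L * ((L * K) * K)" unfolding LL[symmetric] using L(1) K(1) by (simp add: mat_assoc)
    then show "S * (K * K) = 1\<^sub>m n" using LK L(1) K(1) by simp
    have "(K * K) * S = K * ((K * L) * L)" unfolding LL[symmetric] using L(1) K(1) by (simp add: mat_assoc)
    then show "(K * K) * S = 1\<^sub>m n" using LK L(1) K(1) by simp
  qed (use K in auto)
  ultimately show thesis
    by (intro that[OF L(1) K(1) L(2) K(2) LL LK]) simp_all
qed


section \<open>Frobenius and operator norms\<close>

lemma scalar_prod_self_nonneg: "0 \<le> (v :: real vec) \<bullet> v"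
  by (auto simp: scalar_prod_def intro!: sum_nonneg)

lemma scalar_prod_Cauchy_Schwarz:
  fixes v w :: "real vec"
  assumes "dim_vec v = dim_vec w"
  shows "(v \<bullet> w)\<^sup>2 \<le> (v \<bullet> v) * (w \<bullet> w)"
  using Cauchy_Schwarz_ineq_sum[of "\<lambda>i. v $ i" "\<lambda>i. w $ i" "{0..<dim_vec w}"] assms
  by (simp add: scalar_prod_def power2_eq_square)

lemma trace_mult:
  assumes "A \<in> carrier_mat n k" "B \<in> carrier_mat k n"
  shows "trace (A * B) = (\<Sum>i<n. \<Sum>j<k. A $$ (i, j) * B $$ (j, i))"
  using assms by (auto simp: trace_def scalar_prod_def lessThan_atLeast0 intro!: sum.cong)

lemma trace_comm:
  assumes "dim_col A = dim_row B" "dim_row A = dim_col B"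
  shows "trace (A * B) = trace (B * A)"
proof -
  have A: "A \<in> carrier_mat (dim_row A) (dim_col A)" and B: "B \<in> carrier_mat (dim_col A) (dim_row A)"
    using assms by auto
  have "trace (A * B) = (\<Sum>j<dim_col A. \<Sum>i<dim_row A. A $$ (i, j) * B $$ (j, i))"
    unfolding trace_mult[OF A B] by (rule sum.swap)
  then show ?thesis unfolding trace_mult[OF B A] by (simp only: mult.commute)
qed

lemma trace_add:
  assumes "A \<in> carrier_mat n n" "B \<in> carrier_mat n n"
  shows "trace (A + B) = trace A + trace B"
  using assms by (auto simp: trace_def sum.distrib)

lemma trace_one: "trace (1\<^sub>m n) = real n"
  by (simp add: trace_def)

text \<open>The Frobenius norm is kept squared: in this form it is a trace, adds up over blocks and
  obeys Pythagoras for complementary projections.\<close>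

definition fro :: "real mat \<Rightarrow> real" where
  "fro A = (\<Sum>i<dim_row A. \<Sum>j<dim_col A. (A $$ (i, j))\<^sup>2)"

lemma fro_nonneg: "0 \<le> fro A"
  by (auto simp: fro_def intro!: sum_nonneg)

lemma fro_entry_le:
  assumes "i < dim_row A" "j < dim_col A"
  shows "(A $$ (i, j))\<^sup>2 \<le> fro A"
proof -
  have "(A $$ (i, j))\<^sup>2 \<le> (\<Sum>j<dim_col A. (A $$ (i, j))\<^sup>2)"
    using assms by (intro member_le_sum) auto
  also have "\<dots> \<le> fro A"
    unfolding fro_def using assms
    by (intro member_le_sum[of i _ "\<lambda>i. \<Sum>j<dim_col A. (A $$ (i, j))\<^sup>2"]) (auto intro!: sum_nonneg)
  finally show ?thesis .
qed

lemma fro_transpose: "fro (A\<^sup>T) = fro A"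
  unfolding fro_def by (subst sum.swap) simp

lemma fro_eq_trace: "fro A = trace (A\<^sup>T * A)"
proof -
  have "trace (A\<^sup>T * A) = (\<Sum>j<dim_col A. \<Sum>i<dim_row A. (A $$ (i, j))\<^sup>2)"
    by (subst trace_mult[of _ "dim_col A" "dim_row A"]) (auto simp: power2_eq_square intro!: sum.cong)
  also have "\<dots> = fro A" unfolding fro_def by (rule sum.swap)
  finally show ?thesis by simp
qed

lemma fro_symmetric: "A\<^sup>T = A \<Longrightarrow> fro A = trace (A * A)"
  by (simp add: fro_eq_trace)

lemma fro_cols: "fro A = (\<Sum>j<dim_col A. col A j \<bullet> col A j)"
  unfolding fro_def
  by (subst sum.swap) (auto simp: scalar_prod_def power2_eq_square lessThan_atLeast0 intro!: sum.cong)

text \<open>Cauchy-Schwarz for the entrywise inner product of A with the transpose of B.\<close>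

lemma trace_mult_le:
  assumes "A \<in> carrier_mat n k" "B \<in> carrier_mat k n"
  shows "(trace (A * B))\<^sup>2 \<le> fro A * fro B"
proof -
  have "trace (A * B) = (\<Sum>p\<in>{..<n} \<times> {..<k}. A $$ p * B\<^sup>T $$ p)"
    unfolding trace_mult[OF assms] sum.cartesian_product using assms by (intro sum.cong) auto
  then have "(trace (A * B))\<^sup>2 \<le> (\<Sum>p\<in>{..<n} \<times> {..<k}. (A $$ p)\<^sup>2) * (\<Sum>p\<in>{..<n} \<times> {..<k}. (B\<^sup>T $$ p)\<^sup>2)"
    using Cauchy_Schwarz_ineq_sum by metis
  also have "(\<Sum>p\<in>{..<n} \<times> {..<k}. (A $$ p)\<^sup>2) = fro A"
    unfolding fro_def sum.cartesian_product using assms by (intro sum.cong) auto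
  also have "(\<Sum>p\<in>{..<n} \<times> {..<k}. (B\<^sup>T $$ p)\<^sup>2) = fro (B\<^sup>T)"
    unfolding fro_def sum.cartesian_product using assms by (intro sum.cong) auto
  finally show ?thesis by (simp add: fro_transpose)
qed

text \<open>The operator norm of \<open>A\<close> is at most \<open>\<surd>c\<close>.\<close>

definition op_bounded :: "real mat \<Rightarrow> real \<Rightarrow> bool" where
  "op_bounded A c \<longleftrightarrow> 0 \<le> c \<and> (\<forall>x\<in>carrier_vec (dim_col A). (A *\<^sub>v x) \<bullet> (A *\<^sub>v x) \<le> c * (x \<bullet> x))"

lemma op_boundedD:
  "op_bounded A c \<Longrightarrow> dim_vec x = dim_col A \<Longrightarrow> (A *\<^sub>v x) \<bullet> (A *\<^sub>v x) \<le> c * (x \<bullet> x)"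
  unfolding op_bounded_def carrier_vec_def by auto

lemma op_bounded_nonneg: "op_bounded A c \<Longrightarrow> 0 \<le> c"
  by (simp add: op_bounded_def)

lemma op_boundedI:
  "0 \<le> c \<Longrightarrow> (\<And>x. x \<in> carrier_vec (dim_col A) \<Longrightarrow> (A *\<^sub>v x) \<bullet> (A *\<^sub>v x) \<le> c * (x \<bullet> x)) \<Longrightarrow> op_bounded A c"
  by (simp add: op_bounded_def)

lemma op_bounded_mono: "op_bounded A c \<Longrightarrow> c \<le> c' \<Longrightarrow> op_bounded A c'"
  unfolding op_bounded_def by (meson mult_right_mono order_trans scalar_prod_self_nonneg)

lemma op_bounded_mult:
  assumes A: "op_bounded A a" and B: "op_bounded B b" and d: "dim_col A = dim_row B"
  shows "op_bounded (A * B) (a * b)"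
proof (rule op_boundedI)
  show "0 \<le> a * b" using A B by (simp add: op_bounded_def)
  fix x :: "real vec" assume "x \<in> carrier_vec (dim_col (A * B))"
  then have x: "dim_vec x = dim_col B" by simp
  have "((A * B) *\<^sub>v x) \<bullet> ((A * B) *\<^sub>v x) = (A *\<^sub>v (B *\<^sub>v x)) \<bullet> (A *\<^sub>v (B *\<^sub>v x))"
    using d x by (simp add: mat_assoc)
  also have "\<dots> \<le> a * ((B *\<^sub>v x) \<bullet> (B *\<^sub>v x))" using op_boundedD[OF A] d by simp
  also have "\<dots> \<le> a * (b * (x \<bullet> x))"
    using op_boundedD[OF B x] op_bounded_nonneg[OF A] by (intro mult_left_mono)
  finally show "((A * B) *\<^sub>v x) \<bullet> ((A * B) *\<^sub>v x) \<le> a * b * (x \<bullet> x)" by simp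
qed

text \<open>For x = \<open>A\<^sup>T\<close> y one has |x|^2 = y.Ax <= |y| |Ax|, and |Ax|^2 is at
  most a |x|^2. After squaring, one factor |x|^2 cancels.\<close>

lemma op_bounded_transpose:
  assumes A: "op_bounded A a"
  shows "op_bounded (A\<^sup>T) a"
proof (rule op_boundedI)
  show "0 \<le> a" using A by (rule op_bounded_nonneg)
  fix y :: "real vec" assume "y \<in> carrier_vec (dim_col A\<^sup>T)"
  then have y: "y \<in> carrier_vec (dim_row A)" by simp
  define x where "x = A\<^sup>T *\<^sub>v y"
  have x: "x \<in> carrier_vec (dim_col A)" by (simp add: x_def carrier_vecI)
  have xx: "x \<bullet> x = y \<bullet> (A *\<^sub>v x)"
    using scalar_prod_mult_mat_vec[of A "dim_row A" "dim_col A" y x] y x by (simp add: x_def)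
  have "(x \<bullet> x)\<^sup>2 \<le> (y \<bullet> y) * ((A *\<^sub>v x) \<bullet> (A *\<^sub>v x))"
    unfolding xx by (rule scalar_prod_Cauchy_Schwarz) (use y in simp)
  also have "\<dots> \<le> (y \<bullet> y) * (a * (x \<bullet> x))"
    using op_boundedD[OF A, of x] x by (intro mult_left_mono scalar_prod_self_nonneg) simp
  finally have *: "(x \<bullet> x) * (x \<bullet> x) \<le> (a * (y \<bullet> y)) * (x \<bullet> x)"
    by (simp only: power2_eq_square mult_ac)
  have "x \<bullet> x \<le> a * (y \<bullet> y)"
  proof (cases "0 < x \<bullet> x")
    case True
    then show ?thesis using * by (rule mult_right_le_imp_le[rotated])
  next
    case False
    then have "x \<bullet> x \<le> 0" by simp
    also have "0 \<le> a * (y \<bullet> y)"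
      using \<open>0 \<le> a\<close> scalar_prod_self_nonneg by (rule mult_nonneg_nonneg)
    finally show ?thesis .
  qed
  then show "(A\<^sup>T *\<^sub>v y) \<bullet> (A\<^sup>T *\<^sub>v y) \<le> a * (y \<bullet> y)" unfolding x_def .
qed

lemma scalar_prod_add_self_le:
  fixes x y :: "real vec"
  assumes "dim_vec x = dim_vec y"
  shows "(x + y) \<bullet> (x + y) \<le> 2 * (x \<bullet> x) + 2 * (y \<bullet> y)"
proof -
  have "(a + b) * (a + b) \<le> 2 * (a * a) + 2 * (b * b)" for a b :: real
    using zero_le_square[of "a - b"] by (simp add: algebra_simps)
  note * = this
  have "(x + y) \<bullet> (x + y) = (\<Sum>i<dim_vec y. (x $ i + y $ i) * (x $ i + y $ i))"
    using assms by (auto simp: scalar_prod_def lessThan_atLeast0)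
  also have "\<dots> \<le> (\<Sum>i<dim_vec y. 2 * (x $ i * x $ i) + 2 * (y $ i * y $ i))"
    by (intro sum_mono *)
  also have "\<dots> = 2 * (x \<bullet> x) + 2 * (y \<bullet> y)"
    using assms by (simp add: scalar_prod_def lessThan_atLeast0 sum.distrib sum_distrib_left)
  finally show ?thesis .
qed

text \<open>The constants bound squared norms, and |x + y|^2 <= 2 |x|^2 + 2 |y|^2; the factors 2
  reappear in \<open>\<kappa>\<close>.\<close>

lemma op_bounded_add:
  assumes A: "op_bounded A a" and B: "op_bounded B b"
    and d: "A \<in> carrier_mat n k" "B \<in> carrier_mat n k"
  shows "op_bounded (A + B) (2 * a + 2 * b)"
proof (rule op_boundedI)
  show "0 \<le> 2 * a + 2 * b" using A B by (simp add: op_bounded_def)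
  fix x :: "real vec" assume "x \<in> carrier_vec (dim_col (A + B))"
  then have x: "x \<in> carrier_vec k" using d by simp
  have "((A + B) *\<^sub>v x) \<bullet> ((A + B) *\<^sub>v x) \<le> 2 * ((A *\<^sub>v x) \<bullet> (A *\<^sub>v x)) + 2 * ((B *\<^sub>v x) \<bullet> (B *\<^sub>v x))"
    using d x by (simp add: add_mult_distrib_mat_vec[OF d x] scalar_prod_add_self_le)
  then show "((A + B) *\<^sub>v x) \<bullet> ((A + B) *\<^sub>v x) \<le> (2 * a + 2 * b) * (x \<bullet> x)"
    using op_boundedD[OF A, of x] op_boundedD[OF B, of x] d x by (simp add: algebra_simps)
qed

lemma smult_one_mat_vec: "x \<in> carrier_vec n \<Longrightarrow> (t \<cdot>\<^sub>m 1\<^sub>m n) *\<^sub>v x = t \<cdot>\<^sub>v (x :: real vec)"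
  by (intro eq_vecI) (auto simp: scalar_prod_def if_distrib[of "\<lambda>a. a * _"] if_distrib[of "\<lambda>a. t * a"] cong: if_cong)

lemma op_bounded_smult_one: "op_bounded (t \<cdot>\<^sub>m 1\<^sub>m n) (t\<^sup>2)"
  by (rule op_boundedI) (auto simp: smult_one_mat_vec power2_eq_square)

lemma op_bounded_fro: "op_bounded A (fro A)"
proof (rule op_boundedI[OF fro_nonneg])
  fix x :: "real vec" assume "x \<in> carrier_vec (dim_col A)"
  then have x: "dim_vec x = dim_col A" by simp
  have "(A *\<^sub>v x) \<bullet> (A *\<^sub>v x) = (\<Sum>i<dim_row A. (row A i \<bullet> x)\<^sup>2)"
    by (auto simp: scalar_prod_def[of "A *\<^sub>v x"] power2_eq_square lessThan_atLeast0)
  also have "\<dots> \<le> (\<Sum>i<dim_row A. (row A i \<bullet> row A i) * (x \<bullet> x))"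
    using x by (intro sum_mono scalar_prod_Cauchy_Schwarz) simp
  also have "\<dots> = (\<Sum>i<dim_row A. row A i \<bullet> row A i) * (x \<bullet> x)"
    by (simp add: sum_distrib_right)
  also have "(\<Sum>i<dim_row A. row A i \<bullet> row A i) = fro A"
    by (simp add: fro_def scalar_prod_def power2_eq_square lessThan_atLeast0)
  finally show "(A *\<^sub>v x) \<bullet> (A *\<^sub>v x) \<le> fro A * (x \<bullet> x)" .
qed

lemma fro_mult_le:
  assumes M: "op_bounded M c" and d: "dim_col M = dim_row A"
  shows "fro (M * A) \<le> c * fro A"
  unfolding fro_cols using op_boundedD[OF M] d
  by (auto simp: col_mult_dim sum_distrib_left intro!: sum_mono)

lemma fro_mult_ge:
  assumes M: "\<And>x. x \<in> carrier_vec (dim_col M) \<Longrightarrow> c * (x \<bullet> x) \<le> (M *\<^sub>v x) \<bullet> (M *\<^sub>v x)" and d: "dim_col M = dim_row A"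
  shows "c * fro A \<le> fro (M * A)"
proof -
  have "c * (col A j \<bullet> col A j) \<le> col (M * A) j \<bullet> col (M * A) j" if "j < dim_col A" for j
    using M[of "col A j"] d that by (simp add: col_mult_dim)
  then show ?thesis
    unfolding fro_cols by (auto simp: sum_distrib_left intro!: sum_mono)
qed

lemma fro_mult_right_le:
  assumes M: "op_bounded M c" and d: "dim_col A = dim_row M"
  shows "fro (A * M) \<le> c * fro A"
proof -
  have "fro (A * M) = fro (M\<^sup>T * A\<^sup>T)" using fro_transpose[of "A * M"] d by (simp add: mat_assoc)
  also have "\<dots> \<le> c * fro (A\<^sup>T)" by (rule fro_mult_le) (use M d op_bounded_transpose in auto)
  finally show ?thesis by (simp add: fro_transpose)
qed

lemma op_bounded_eigenvalue:
  assumes A: "op_bounded A c" "A \<in> carrier_mat n n" and v: "v \<in> carrier_vec n" "v \<bullet> v = 1" "A *\<^sub>v v = e \<cdot>\<^sub>v v"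
  shows "e\<^sup>2 \<le> c"
  using op_boundedD[OF A(1), of v] A(2) v by (simp add: power2_eq_square)

section \<open>Compression to the range of a semi-orthogonal matrix\<close>

context
  fixes V Q :: "real mat" and n d :: nat
  assumes V: "V \<in> carrier_mat n d" "V\<^sup>T * V = 1\<^sub>m d"
    and Q: "Q = 1\<^sub>m n - V * V\<^sup>T"
begin

lemma semi_orthogonal_norm:
  assumes x: "x \<in> carrier_vec d"
  shows "(V *\<^sub>v x) \<bullet> (V *\<^sub>v x) = x \<bullet> x"
proof -
  have Vx: "V *\<^sub>v x \<in> carrier_vec n" using V(1) x by (rule mult_mat_vec_carrier)
  have "V\<^sup>T *\<^sub>v (V *\<^sub>v x) = (V\<^sup>T * V) *\<^sub>v x"
    by (rule mult_mat_vec_assoc_dim[symmetric]) (use V(1) x in auto)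
  also have "\<dots> = x" unfolding V(2) using x by (rule one_mult_mat_vec)
  finally have "V\<^sup>T *\<^sub>v (V *\<^sub>v x) = x" .
  then show ?thesis
    using scalar_prod_mult_mat_vec[OF V(1) Vx x] by (simp only:)
qed

lemma op_bounded_semi_orthogonal: "op_bounded V 1" "op_bounded (V\<^sup>T) 1"
  using V(1) by (auto intro!: op_bounded_transpose op_boundedI simp: semi_orthogonal_norm)

lemma complement_carrier: "Q \<in> carrier_mat n n"
  using V(1) by (auto simp: Q)

lemma complement_symmetric: "Q\<^sup>T = Q"
  unfolding Q using V(1) by (subst transpose_minus[of _ n n]) (auto simp: mat_assoc)

lemma complement_idem: "Q * Q = Q"
proof -
  have "(V * V\<^sup>T) * (V * V\<^sup>T) = V * ((V\<^sup>T * V) * V\<^sup>T)" using V(1) by (simp add: mat_assoc)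
  then have P: "(V * V\<^sup>T) * (V * V\<^sup>T) = V * V\<^sup>T" using V by simp
  have "Q * Q = (1\<^sub>m n - V * V\<^sup>T) - (1\<^sub>m n - V * V\<^sup>T) * (V * V\<^sup>T)"
    unfolding Q using V(1) by (subst mult_minus_distrib_mat[of _ n n _ n]) auto
  also have "(1\<^sub>m n - V * V\<^sup>T) * (V * V\<^sup>T) = V * V\<^sup>T - (V * V\<^sup>T) * (V * V\<^sup>T)"
    using V(1) by (subst minus_mult_distrib_mat[of _ n n _ _ n]) auto
  finally show ?thesis unfolding P Q using V(1) by (auto intro!: eq_matI)
qed

text \<open>Pythagoras for the columns of H: V \<open>V\<^sup>T\<close> and Q are complementary
  orthogonal projections, and since V is an isometry, \<open>V\<^sup>T * H\<close> has the norm of V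
  \<open>V\<^sup>T\<close> H.\<close>

lemma fro_split:
  assumes H: "H \<in> carrier_mat n k"
  shows "fro H = fro (V\<^sup>T * H) + fro (Q * H)"
proof -
  have "fro (V\<^sup>T * H) + fro (Q * H) = trace ((V\<^sup>T * H)\<^sup>T * (V\<^sup>T * H) + (Q * H)\<^sup>T * (Q * H))"
    unfolding fro_eq_trace using V(1) H complement_carrier by (subst trace_add[of _ k]) auto
  also have "(V\<^sup>T * H)\<^sup>T * (V\<^sup>T * H) = H\<^sup>T * ((V * V\<^sup>T) * H)"
    using V(1) H by (simp add: mat_assoc)
  also have "(Q * H)\<^sup>T * (Q * H) = H\<^sup>T * ((Q * Q) * H)"
    using V(1) H complement_carrier by (simp add: mat_assoc complement_symmetric)
  also have "H\<^sup>T * ((V * V\<^sup>T) * H) + H\<^sup>T * ((Q * Q) * H) = H\<^sup>T * ((V * V\<^sup>T + Q) * H)"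
    unfolding complement_idem using V(1) H complement_carrier
    by (simp add: mult_add_distrib_mat[of _ k n _ k] add_mult_distrib_mat[of _ n n _ _ k])
  also have "V * V\<^sup>T + Q = 1\<^sub>m n" unfolding Q using V(1) by (auto intro!: eq_matI)
  finally show ?thesis using H by (simp add: fro_eq_trace)
qed

text \<open>The squared norm of an orthogonal projection is its rank, here the number of directions
  that are removed.\<close>

lemma fro_complement: "fro Q = real n - real d"
proof -
  have "real n = fro (1\<^sub>m n :: real mat)" by (simp add: fro_symmetric trace_one)
  also have "\<dots> = fro (V\<^sup>T) + fro Q"
    using fro_split[of "1\<^sub>m n" n] V(1) complement_carrier by simp
  also have "fro (V\<^sup>T) = real d" using V fro_transpose[of V] fro_eq_trace[of V] by (simp add: trace_one)
  finally show ?thesis by simp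
qed

text \<open>Bounds the information lost when the fixed effects are projected out.\<close>

lemma fro_compression:
  assumes G: "G \<in> carrier_mat n n" "G\<^sup>T = G" "op_bounded G c"
  shows "fro G \<le> fro (V\<^sup>T * G * V) + 2 * c * (real n - real d)"
proof -
  have GQ: "fro (Q * G) = fro (G * Q)"
    using fro_transpose[of "Q * G"] G complement_carrier by (simp add: mat_assoc complement_symmetric)
  have GQ_le: "fro (G * Q) \<le> c * (real n - real d)"
    using fro_mult_le[OF G(3), of Q] G complement_carrier by (simp add: fro_complement)
  have GV: "fro (V\<^sup>T * G) = fro (G * V)"
    using fro_transpose[of "V\<^sup>T * G"] G V by (simp add: mat_assoc)
  have "fro (Q * (G * V)) = fro (V\<^sup>T * (G * Q))"
    using fro_transpose[of "Q * (G * V)"] G V complement_carrier by (simp add: mat_assoc complement_symmetric)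
  also have "\<dots> \<le> 1 * fro (G * Q)"
    by (rule fro_mult_le[OF op_bounded_semi_orthogonal(2)]) (use G V in auto)
  finally have QGV: "fro (Q * (G * V)) \<le> fro (G * Q)" by simp
  \<comment> \<open>G is split by rows first and by columns second. Both remainders are at most
    \<open>fro (G * Q)\<close>, hence at most c (n - d) each; this is the factor 2 in the
    loss.\<close>
  have "fro G = fro (V\<^sup>T * (G * V)) + fro (Q * (G * V)) + fro (G * Q)"
    using fro_split[OF G(1)] fro_split[of "G * V" d] G V GV GQ by simp
  then show ?thesis using GQ_le QGV G V by (simp add: mat_assoc)
qed

end


section \<open>Independence from characteristic functions\<close>

text \<open>Extends uniqueness of characteristic functions to measures that are not normalized,
  which arise below by weighting and restricting. Setting s = 0 shows that c is the total mass; a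
  positive mass is divided out, and mass zero is trivial.\<close>

lemma measure_eq_scaled_if_char:
  fixes \<eta> \<mu> :: "real measure" and c :: complex
  assumes \<eta>: "finite_measure \<eta>" "sets \<eta> = sets borel" and \<mu>: "real_distribution \<mu>"
    and char: "\<And>s. (CLINT x|\<eta>. iexp (s * x)) = c * char \<mu> s"
    and B: "B \<in> sets borel"
  shows "complex_of_real (measure \<eta> B) = c * measure \<mu> B"
proof -
  interpret \<eta>: finite_measure \<eta> by fact
  interpret \<mu>: real_distribution \<mu> by fact
  have space: "space \<eta> = UNIV" using \<eta>(2) sets_eq_imp_space_eq by fastforce
  define m where "m = measure \<eta> UNIV"
  have c: "c = of_real m"
    using char[of 0] by (simp add: \<mu>.char_zero m_def space scaleR_conv_of_real)
  show ?thesis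
  proof (cases "m = 0")
    case True
    then have "measure \<eta> B = 0"
      using \<eta>.bounded_measure[of B] by (simp add: m_def space measure_le_0_iff)
    then show ?thesis using True c by simp
  next
    case False
    then have m: "0 < m" by (simp add: m_def zero_less_measure_iff)
    define \<nu> where "\<nu> = density \<eta> (\<lambda>_. ennreal (1 / m))"
    have em: "emeasure \<nu> A = ennreal (1 / m) * ennreal (measure \<eta> A)" if "A \<in> sets borel" for A
      unfolding \<nu>_def using that \<eta> by (simp add: emeasure_density_const \<eta>.emeasure_eq_measure)
    have "emeasure \<nu> (space \<nu>) = 1"
      using em[of UNIV] m space by (simp add: \<nu>_def m_def ennreal_mult'[symmetric])
    then interpret \<nu>: prob_space \<nu> by (rule prob_spaceI)
    have rd: "real_distribution \<nu>"
      using \<eta>(2) by unfold_locales (simp_all add: \<nu>_def)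
    have "char \<nu> = char \<mu>"
    proof
      fix s
      have "char \<nu> s = (CLINT x|\<eta>. (1 / m) *\<^sub>R iexp (s * x))"
        unfolding char_def \<nu>_def using \<eta>(2) m
        by (subst integral_density) (auto cong: measurable_cong_sets)
      also have "\<dots> = (1 / m) *\<^sub>R (c * char \<mu> s)" by (simp only: integral_scaleR_right char)
      finally show "char \<nu> s = char \<mu> s" using m by (simp add: c scaleR_conv_of_real)
    qed
    then have "\<nu> = \<mu>" using Levy_uniqueness[OF rd \<mu>] by simp
    then have "ennreal (measure \<mu> B) = ennreal (measure \<eta> B / m)"
      using em[OF B] \<mu>.emeasure_eq_measure[of B] m by (simp add: ennreal_mult'[symmetric])
    then have "measure \<mu> B = measure \<eta> B / m" using m by simp
    then show ?thesis using m by (simp add: c)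
  qed
qed

text \<open>Reweighting by w and pushing forward along X turns the hypothesis into proportionality
  of characteristic functions. Only a nonnegative weight defines a measure, hence the restriction on
  w.\<close>

lemma (in finite_measure) char_factor_imp_weighted_factor:
  fixes X w :: "'a \<Rightarrow> real" and c :: complex
  assumes [measurable]: "X \<in> borel_measurable M" "w \<in> borel_measurable M"
    and w: "\<And>\<omega>. 0 \<le> w \<omega>" "\<And>\<omega>. w \<omega> \<le> K"
    and \<mu>: "real_distribution \<mu>"
    and char: "\<And>s. (CLINT \<omega>|M. w \<omega> * iexp (s * X \<omega>)) = c * char \<mu> s"
    and B[measurable]: "B \<in> sets borel"
  shows "(CLINT \<omega>|M. complex_of_real (w \<omega> * indicator B (X \<omega>))) = c * measure \<mu> B"
proof -
  define N where "N = density M (\<lambda>\<omega>. ennreal (w \<omega>))"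
  have intw: "integrable M w"
    by (rule integrable_const_bound[of _ K]) (use w in auto)
  interpret N: finite_measure N
  proof
    have "emeasure N (space N) = ennreal (LINT \<omega>|M. w \<omega>)"
      using w intw by (simp add: N_def emeasure_density nn_integral_eq_integral cong: nn_integral_cong_simp)
    then show "emeasure N (space N) \<noteq> \<infinity>" by simp
  qed
  define \<eta> where "\<eta> = distr N borel X"
  have [measurable]: "X \<in> borel_measurable N" by (simp add: N_def)
  have "complex_of_real (measure \<eta> B) = c * measure \<mu> B"
  proof (rule measure_eq_scaled_if_char[OF _ _ \<mu> _ B])
    show "finite_measure \<eta>" unfolding \<eta>_def by (rule N.finite_measure_distr) simp
    show "sets \<eta> = sets borel" by (simp add: \<eta>_def)
    fix s
    have "(CLINT x|\<eta>. iexp (s * x)) = (CLINT \<omega>|N. iexp (s * X \<omega>))"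
      unfolding \<eta>_def by (rule integral_distr) simp_all
    also have "\<dots> = (CLINT \<omega>|M. w \<omega> *\<^sub>R iexp (s * X \<omega>))"
      unfolding N_def by (rule integral_density) (simp_all add: w)
    finally show "(CLINT x|\<eta>. iexp (s * x)) = c * char \<mu> s"
      by (simp only: scaleR_conv_of_real char)
  qed
  moreover have "measure \<eta> B = (LINT \<omega>|M. w \<omega> * indicator B (X \<omega>))"
  proof -
    have "measure \<eta> B = (LINT x|\<eta>. indicator B x)" unfolding \<eta>_def by simp
    also have "\<dots> = (LINT \<omega>|N. indicator B (X \<omega>))"
      unfolding \<eta>_def by (rule integral_distr) simp_all
    also have "\<dots> = (LINT \<omega>|M. w \<omega> *\<^sub>R indicator B (X \<omega>))"
      unfolding N_def by (rule integral_density) (simp_all add: w)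
    finally show ?thesis by (simp only: real_scaleR_def)
  qed
  ultimately show ?thesis by (simp only: integral_complex_of_real)
qed

text \<open>The complex weight exp (i Y) cannot serve as a density. It is a linear combination of
  the nonnegative weights 1, 1 + cos Y and 1 + sin Y, each a trigonometric polynomial in Y whose
  terms satisfy the factorization.\<close>

lemma (in finite_measure) char_factor_imp_indicator_factor:
  fixes X Y :: "'a \<Rightarrow> real"
  assumes [measurable]: "X \<in> borel_measurable M" "Y \<in> borel_measurable M"
    and \<mu>: "real_distribution \<mu>"
    and char: "\<And>a s. (CLINT \<omega>|M. iexp (a * Y \<omega>) * iexp (s * X \<omega>)) = (CLINT \<omega>|M. iexp (a * Y \<omega>)) * char \<mu> s"
    and B[measurable]: "B \<in> sets borel"
  shows "(CLINT \<omega>|M. iexp (Y \<omega>) * indicator B (X \<omega>)) = (CLINT \<omega>|M. iexp (Y \<omega>)) * measure \<mu> B"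
proof -
  have bint: "complex_integrable M f"
    if [measurable]: "f \<in> borel_measurable M" and "\<And>\<omega>. norm (f \<omega>) \<le> 1" for f :: "'a \<Rightarrow> complex"
    using that by (intro integrable_const_bound[of _ 1]) auto
  have ei: "complex_integrable M (\<lambda>\<omega>. iexp (a * Y \<omega>))" for a by (rule bint) auto
  have ei': "complex_integrable M (\<lambda>\<omega>. iexp (a * Y \<omega>) * iexp (s * X \<omega>))" for a s
    by (rule bint) (auto simp: norm_mult)
  have ei0: "complex_integrable M (\<lambda>\<omega>. iexp (s * X \<omega>))" for s by (rule bint) auto
  have cos: "complex_of_real (cos y) = (iexp (1 * y) + iexp ((- 1) * y)) / 2"
    and sin: "complex_of_real (sin y) = (iexp (1 * y) - iexp ((- 1) * y)) / (2 * \<i>)" for y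
    by (simp_all add: complex_eq_iff Re_exp Im_exp)
  have one: "(CLINT \<omega>|M. iexp (s * X \<omega>)) = (CLINT \<omega>|M. 1) * char \<mu> s" for s
    using char[of 0 s] by simp
  \<comment> \<open>The factorization passes from exp (i a Y) with a in {0, 1, -1} to linear
    combinations, which cover all three weights.\<close>
  have fac: "(CLINT \<omega>|M. (p + q * iexp (1 * Y \<omega>) + r * iexp ((-1) * Y \<omega>)) * iexp (s * X \<omega>))
      = (CLINT \<omega>|M. p + q * iexp (1 * Y \<omega>) + r * iexp ((-1) * Y \<omega>)) * char \<mu> s" for p q r :: complex and s
  proof -
    have "(CLINT \<omega>|M. (p + q * iexp (1 * Y \<omega>) + r * iexp ((-1) * Y \<omega>)) * iexp (s * X \<omega>)) =
        (CLINT \<omega>|M. p * iexp (s * X \<omega>) + q * (iexp (1 * Y \<omega>) * iexp (s * X \<omega>)) + r * (iexp ((-1) * Y \<omega>) * iexp (s * X \<omega>)))"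
      by (simp only: distrib_right mult.assoc)
    also have "\<dots> = p * (CLINT \<omega>|M. iexp (s * X \<omega>)) + q * (CLINT \<omega>|M. iexp (1 * Y \<omega>) * iexp (s * X \<omega>))
        + r * (CLINT \<omega>|M. iexp ((-1) * Y \<omega>) * iexp (s * X \<omega>))"
      using ei0 ei' by (simp only: Bochner_Integration.integral_add Bochner_Integration.integrable_add
          integrable_mult_right integral_mult_right_zero)
    also have "\<dots> = (p * (CLINT \<omega>|M. 1) + q * (CLINT \<omega>|M. iexp (1 * Y \<omega>)) + r * (CLINT \<omega>|M. iexp ((-1) * Y \<omega>))) * char \<mu> s"
      unfolding one char by (simp only: distrib_right mult.assoc)
    also have "p * (CLINT \<omega>|M. 1) + q * (CLINT \<omega>|M. iexp (1 * Y \<omega>)) + r * (CLINT \<omega>|M. iexp ((-1) * Y \<omega>))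
        = (CLINT \<omega>|M. p * 1 + q * iexp (1 * Y \<omega>) + r * iexp ((-1) * Y \<omega>))"
      using ei integrable_const[of "1 :: complex"]
      by (simp only: Bochner_Integration.integral_add Bochner_Integration.integrable_add
          integrable_mult_right integral_mult_right_zero)
    finally show ?thesis by (simp only: mult_1_right)
  qed
  have wf: "(CLINT \<omega>|M. complex_of_real (w \<omega> * indicator B (X \<omega>))) = (CLINT \<omega>|M. complex_of_real (w \<omega>)) * measure \<mu> B"
    if [measurable]: "w \<in> borel_measurable M" and "\<And>\<omega>. 0 \<le> w \<omega>" "\<And>\<omega>. w \<omega> \<le> 2"
      and eq: "\<And>\<omega>. complex_of_real (w \<omega>) = p + q * iexp (1 * Y \<omega>) + r * iexp ((-1) * Y \<omega>)"
    for w and p q r :: complex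
    by (rule char_factor_imp_weighted_factor[of _ _ 2]) (use that \<mu> fac in \<open>simp_all only: eq, simp_all\<close>)
  have one_le: "- 1 \<le> cos y" "cos y \<le> 1" "- 1 \<le> sin y" "sin y \<le> 1" for y :: real by simp_all
  have w1: "(CLINT \<omega>|M. complex_of_real (1 * indicator B (X \<omega>))) = (CLINT \<omega>|M. complex_of_real 1) * measure \<mu> B"
    by (rule wf[of _ 1 0 0]) auto
  have wc: "(CLINT \<omega>|M. complex_of_real ((1 + cos (Y \<omega>)) * indicator B (X \<omega>))) = (CLINT \<omega>|M. complex_of_real (1 + cos (Y \<omega>))) * measure \<mu> B"
  proof (rule wf[of _ 1 "1 / 2" "1 / 2"])
    show "0 \<le> 1 + cos (Y \<omega>)" "1 + cos (Y \<omega>) \<le> 2" for \<omega> using one_le[of "Y \<omega>"] by linarith+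
  qed (simp_all only: of_real_add cos, simp_all add: field_simps)
  have ws: "(CLINT \<omega>|M. complex_of_real ((1 + sin (Y \<omega>)) * indicator B (X \<omega>))) = (CLINT \<omega>|M. complex_of_real (1 + sin (Y \<omega>))) * measure \<mu> B"
  proof (rule wf[of _ 1 "1 / (2 * \<i>)" "- (1 / (2 * \<i>))"])
    show "0 \<le> 1 + sin (Y \<omega>)" "1 + sin (Y \<omega>) \<le> 2" for \<omega> using one_le[of "Y \<omega>"] by linarith+
  qed (simp_all only: of_real_add sin, simp_all add: field_simps)
  have exp: "iexp y = complex_of_real (1 + cos y) - complex_of_real 1 + \<i> * (complex_of_real (1 + sin y) - complex_of_real 1)" for y
    by (simp add: complex_eq_iff Re_exp Im_exp)
  have abs_le: "\<bar>1 + cos y\<bar> \<le> 2" "\<bar>1 + sin y\<bar> \<le> 2" for y :: real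
    using one_le[of y] by linarith+
  let ?c = "\<lambda>\<omega>. 1 + cos (Y \<omega>)" and ?s = "\<lambda>\<omega>. 1 + sin (Y \<omega>)" and ?i = "\<lambda>\<omega>. indicator B (X \<omega>) :: real"
  have int: "complex_integrable M (\<lambda>\<omega>. complex_of_real (?c \<omega> * ?i \<omega>))" "complex_integrable M (\<lambda>\<omega>. complex_of_real (?s \<omega> * ?i \<omega>))"
    "complex_integrable M (\<lambda>\<omega>. complex_of_real (1 * ?i \<omega>))" "complex_integrable M (\<lambda>\<omega>. complex_of_real (?c \<omega>))"
    "complex_integrable M (\<lambda>\<omega>. complex_of_real (?s \<omega>))" "complex_integrable M (\<lambda>\<omega>. complex_of_real 1)"
    using abs_le
    by (auto intro!: integrable_const_bound[of _ 2] AE_I2 simp: norm_mult indicator_def simp del: of_real_add)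
  have "(CLINT \<omega>|M. iexp (Y \<omega>) * indicator B (X \<omega>)) = (CLINT \<omega>|M. complex_of_real (?c \<omega> * ?i \<omega>) - complex_of_real (1 * ?i \<omega>)
      + \<i> * (complex_of_real (?s \<omega> * ?i \<omega>) - complex_of_real (1 * ?i \<omega>)))"
    unfolding exp by (intro Bochner_Integration.integral_cong) (auto simp: indicator_def)
  also have "\<dots> = (CLINT \<omega>|M. complex_of_real (?c \<omega> * ?i \<omega>)) - (CLINT \<omega>|M. complex_of_real (1 * ?i \<omega>))
      + \<i> * ((CLINT \<omega>|M. complex_of_real (?s \<omega> * ?i \<omega>)) - (CLINT \<omega>|M. complex_of_real (1 * ?i \<omega>)))"
    using int by (simp only: Bochner_Integration.integral_add Bochner_Integration.integral_diff
        Bochner_Integration.integrable_diff integrable_mult_right integral_mult_right_zero)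
  also have "\<dots> = ((CLINT \<omega>|M. complex_of_real (?c \<omega>)) - (CLINT \<omega>|M. complex_of_real 1)
      + \<i> * ((CLINT \<omega>|M. complex_of_real (?s \<omega>)) - (CLINT \<omega>|M. complex_of_real 1))) * measure \<mu> B"
    unfolding w1 wc ws by (simp only: algebra_simps)
  also have "(CLINT \<omega>|M. complex_of_real (?c \<omega>)) - (CLINT \<omega>|M. complex_of_real 1)
      + \<i> * ((CLINT \<omega>|M. complex_of_real (?s \<omega>)) - (CLINT \<omega>|M. complex_of_real 1)) = (CLINT \<omega>|M. iexp (Y \<omega>))"
    unfolding exp using int by (simp only: Bochner_Integration.integral_add Bochner_Integration.integral_diff
        Bochner_Integration.integrable_diff integrable_mult_right integral_mult_right_zero)
  finally show ?thesis .
qed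


text \<open>Induction on the number of coordinates: the last one is replaced by the event that it
  lies in its set, and N is restricted to this event. The restricted measure is not normalized and
  its mass moves into the constant; this is why N is an arbitrary finite measure and c a free
  complex number.\<close>

lemma char_product_imp_measure_product:
  fixes X :: "nat \<Rightarrow> 'a \<Rightarrow> real" and c :: complex
  assumes "finite_measure N" "\<And>k. k < d \<Longrightarrow> X k \<in> borel_measurable N" "\<And>k. k < d \<Longrightarrow> real_distribution (\<mu> k)"
    and "\<And>t. (CLINT \<omega>|N. iexp (\<Sum>k<d. t k * X k \<omega>)) = c * (\<Prod>k<d. char (\<mu> k) (t k))"
    and "\<And>k. k < d \<Longrightarrow> A k \<in> sets borel"
  shows "complex_of_real (measure N {\<omega> \<in> space N. \<forall>k<d. X k \<omega> \<in> A k}) = c * (\<Prod>k<d. complex_of_real (measure (\<mu> k) (A k)))"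
  using assms
proof (induction d arbitrary: N c)
  case 0
  then interpret finite_measure N by simp
  show ?case using "0.prems"(4)[of "\<lambda>_. 0"] by (simp add: scaleR_conv_of_real)
next
  case (Suc d)
  interpret N: finite_measure N by fact
  interpret \<mu>: real_distribution "\<mu> d" using Suc.prems(3) by simp
  have [measurable]: "X k \<in> borel_measurable N" if "k \<le> d" for k using Suc.prems(2) that by simp
  have [measurable]: "A d \<in> sets borel" using Suc.prems(5) by simp
  define S where "S = {\<omega> \<in> space N. X d \<omega> \<in> A d}"
  have S[measurable]: "S \<in> sets N" unfolding S_def by measurable
  define N' where "N' = restrict_space N S"
  have sp: "space N' = S" using S by (simp add: N'_def space_restrict_space)
  have "complex_of_real (measure N' {\<omega> \<in> space N'. \<forall>k<d. X k \<omega> \<in> A k}) =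
      (c * measure (\<mu> d) (A d)) * (\<Prod>k<d. complex_of_real (measure (\<mu> k) (A k)))"
  proof (rule Suc.IH)
    show "finite_measure N'" unfolding N'_def
      by (intro finite_measureI) (simp add: emeasure_restrict_space space_restrict_space)
    show "X k \<in> borel_measurable N'" if "k < d" for k
      unfolding N'_def using that by (intro measurable_restrict_space1) simp
    show "real_distribution (\<mu> k)" "A k \<in> sets borel" if "k < d" for k using that Suc.prems by auto
    fix t :: "nat \<Rightarrow> real"
    define Y where "Y \<omega> = (\<Sum>k<d. t k * X k \<omega>)" for \<omega>
    have [measurable]: "Y \<in> borel_measurable N" unfolding Y_def by measurable
    have joint: "(CLINT \<omega>|N. iexp (a * Y \<omega>) * iexp (s * X d \<omega>)) = c * (\<Prod>k<d. char (\<mu> k) (a * t k)) * char (\<mu> d) s" for a s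
    proof -
      have "iexp (a * Y \<omega>) * iexp (s * X d \<omega>) = iexp (\<Sum>k<Suc d. (if k = d then s else a * t k) * X k \<omega>)" for \<omega>
        unfolding exp_add[symmetric] distrib_left[symmetric] of_real_add[symmetric]
        by (intro arg_cong[of _ _ iexp]) (auto simp: Y_def sum_distrib_left mult.assoc intro!: sum.cong)
      then have "(CLINT \<omega>|N. iexp (a * Y \<omega>) * iexp (s * X d \<omega>)) =
          c * (\<Prod>k<Suc d. char (\<mu> k) (if k = d then s else a * t k))"
        by (simp only: Suc.prems(4))
      also have "(\<Prod>k<Suc d. char (\<mu> k) (if k = d then s else a * t k)) = (\<Prod>k<d. char (\<mu> k) (a * t k)) * char (\<mu> d) s"
        by (auto simp: prod.lessThan_Suc intro!: prod.cong)
      finally show ?thesis by (simp only: mult.assoc)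
    qed
    \<comment> \<open>Taking s = 0 removes the last coordinate and leaves the marginal with the same
      constant.\<close>
    have marg: "(CLINT \<omega>|N. iexp (a * Y \<omega>)) = c * (\<Prod>k<d. char (\<mu> k) (a * t k))" for a
      using joint[of a 0] by (simp add: \<mu>.char_zero)
    have "(CLINT \<omega>|N'. iexp (Y \<omega>)) = (CLINT \<omega>|N. indicator S \<omega> *\<^sub>R iexp (Y \<omega>))"
      unfolding N'_def by (rule integral_restrict_space) simp
    also have "\<dots> = (CLINT \<omega>|N. iexp (Y \<omega>) * indicator (A d) (X d \<omega>))"
      by (intro Bochner_Integration.integral_cong) (auto simp: S_def indicator_def)
    also have "\<dots> = (CLINT \<omega>|N. iexp (Y \<omega>)) * measure (\<mu> d) (A d)"
    proof (rule N.char_factor_imp_indicator_factor[OF _ _ \<mu>.real_distribution_axioms])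
      show "(CLINT \<omega>|N. iexp (a * Y \<omega>) * iexp (s * X d \<omega>)) = (CLINT \<omega>|N. iexp (a * Y \<omega>)) * char (\<mu> d) s" for a s
        unfolding joint marg ..
    qed simp_all
    finally show "(CLINT \<omega>|N'. iexp (\<Sum>k<d. t k * X k \<omega>)) = c * measure (\<mu> d) (A d) * (\<Prod>k<d. char (\<mu> k) (t k))"
      using marg[of 1] by (simp add: Y_def)
  qed
  moreover have "measure N' {\<omega> \<in> space N'. \<forall>k<d. X k \<omega> \<in> A k} = measure N {\<omega> \<in> space N. \<forall>k<Suc d. X k \<omega> \<in> A k}"
  proof -
    have "{\<omega> \<in> space N'. \<forall>k<d. X k \<omega> \<in> A k} = {\<omega> \<in> space N. \<forall>k<Suc d. X k \<omega> \<in> A k}"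
      unfolding sp by (auto simp: S_def less_Suc_eq)
    moreover have "measure N' {\<omega> \<in> space N'. \<forall>k<d. X k \<omega> \<in> A k} = measure N {\<omega> \<in> space N'. \<forall>k<d. X k \<omega> \<in> A k}"
      unfolding N'_def by (rule measure_restrict_space) (use sp in \<open>auto simp: N'_def\<close>)
    ultimately show ?thesis by simp
  qed
  ultimately show ?case by (simp add: mult_ac)
qed

text \<open>A finite product measure is determined by rectangles, and for these the one-dimensional
  uniqueness theorem suffices, one coordinate at a time. So independence is obtained without a
  multivariate uniqueness theorem.\<close>

theorem distr_PiM_if_char_product:
  fixes X :: "nat \<Rightarrow> 'a \<Rightarrow> real"
  assumes N: "prob_space N" and X: "\<And>k. k < d \<Longrightarrow> X k \<in> borel_measurable N" and \<mu>: "\<And>k. real_distribution (\<mu> k)"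
    and char: "\<And>t. (CLINT \<omega>|N. iexp (\<Sum>k<d. t k * X k \<omega>)) = (\<Prod>k<d. char (\<mu> k) (t k))"
  shows "distr N (\<Pi>\<^sub>M k\<in>{..<d}. \<mu> k) (\<lambda>\<omega>. \<lambda>k\<in>{..<d}. X k \<omega>) = (\<Pi>\<^sub>M k\<in>{..<d}. \<mu> k)"
proof -
  interpret N: prob_space N by fact
  have sets: "sets (\<mu> k) = sets borel" for k using \<mu> real_distribution.events_eq_borel by blast
  interpret product_sigma_finite \<mu>
    by (simp add: product_sigma_finite_def prob_space_imp_sigma_finite real_distribution.axioms(1)[OF \<mu>])
  have XP: "(\<lambda>\<omega>. \<lambda>k\<in>{..<d}. X k \<omega>) \<in> measurable N (\<Pi>\<^sub>M k\<in>{..<d}. \<mu> k)"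
    by (rule measurable_restrict) (use X in \<open>simp add: measurable_cong_sets[OF refl sets]\<close>)
  show ?thesis
  proof (rule PiM_eqI)
    fix A assume A: "\<And>i. i \<in> {..<d} \<Longrightarrow> A i \<in> sets (\<mu> i)"
    have fin: "emeasure (\<mu> k) B = ennreal (measure (\<mu> k) B)" for k B
      using \<mu> by (intro finite_measure.emeasure_eq_measure prob_space.finite_measure real_distribution.axioms(1))
    have "complex_of_real (measure N {\<omega> \<in> space N. \<forall>k<d. X k \<omega> \<in> A k}) = 1 * (\<Prod>k<d. complex_of_real (measure (\<mu> k) (A k)))"
    proof (rule char_product_imp_measure_product[OF N.finite_measure_axioms X \<mu>])
      show "A k \<in> sets borel" if "k < d" for k using A that sets by auto
    qed (simp_all only: char mult_1)
    then have "measure N {\<omega> \<in> space N. \<forall>k<d. X k \<omega> \<in> A k} = (\<Prod>k<d. measure (\<mu> k) (A k))"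
      by (simp only: mult_1 of_real_prod[symmetric] of_real_eq_iff)
    note meas = this
    have vim: "(\<lambda>\<omega>. \<lambda>k\<in>{..<d}. X k \<omega>) -` Pi\<^sub>E {..<d} A \<inter> space N = {\<omega> \<in> space N. \<forall>k<d. X k \<omega> \<in> A k}"
    proof (rule Set.set_eqI)
      fix \<omega>
      have "(\<lambda>k\<in>{..<d}. X k \<omega>) \<in> Pi\<^sub>E {..<d} A \<longleftrightarrow> (\<forall>k<d. X k \<omega> \<in> A k)"
        by (simp add: PiE_iff Ball_def)
      then show "\<omega> \<in> (\<lambda>\<omega>. \<lambda>k\<in>{..<d}. X k \<omega>) -` Pi\<^sub>E {..<d} A \<inter> space N \<longleftrightarrow> \<omega> \<in> {\<omega> \<in> space N. \<forall>k<d. X k \<omega> \<in> A k}"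
        by blast
    qed
    have "Pi\<^sub>E {..<d} A \<in> sets (\<Pi>\<^sub>M k\<in>{..<d}. \<mu> k)" using A by (intro sets_PiM_I_finite) auto
    then have "emeasure (distr N (Pi\<^sub>M {..<d} \<mu>) (\<lambda>\<omega>. \<lambda>k\<in>{..<d}. X k \<omega>)) (Pi\<^sub>E {..<d} A)
        = ennreal (\<Prod>k<d. measure (\<mu> k) (A k))"
      by (simp only: emeasure_distr[OF XP] vim N.emeasure_eq_measure meas)
    also have "\<dots> = (\<Prod>i<d. emeasure (\<mu> i) (A i))"
      unfolding fin by (rule prod_ennreal[symmetric]) simp
    finally show "emeasure (distr N (Pi\<^sub>M {..<d} \<mu>) (\<lambda>\<omega>. \<lambda>k\<in>{..<d}. X k \<omega>)) (Pi\<^sub>E {..<d} A) = (\<Prod>i<d. emeasure (\<mu> i) (A i))" .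
  qed simp_all
qed


section \<open>Quadratic forms of Gaussian vectors\<close>

abbreviation std_normal_vec :: "nat \<Rightarrow> (nat \<Rightarrow> real) measure" where
  "std_normal_vec d \<equiv> \<Pi>\<^sub>M k\<in>{..<d}. std_normal_distribution"

lemma prob_space_std_normal: "prob_space std_normal_distribution"
  using real_dist_normal_dist by (rule real_distribution.axioms(1))

lemma product_prob_space_std_normal: "product_prob_space (\<lambda>_::nat. std_normal_distribution)"
  by (simp add: product_prob_space_def product_prob_space_axioms_def product_sigma_finite_def
      prob_space_std_normal prob_space_imp_sigma_finite)

lemma prob_space_std_normal_vec: "prob_space (std_normal_vec d)"
  by (rule prob_space_PiM) (rule prob_space_std_normal)

lemma measurable_component_std_normal_vec [measurable]:
  "k < d \<Longrightarrow> (\<lambda>x. x k) \<in> borel_measurable (std_normal_vec d)"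
proof -
  assume "k < d"
  then have "(\<lambda>x. x k) \<in> measurable (std_normal_vec d) std_normal_distribution"
    by (intro measurable_component_singleton) simp
  then show ?thesis by simp
qed

text \<open>The characteristic function of (z^2 - 1)/2 for standard normal z, a variable with mean 0
  and variance 1/2: the contribution of one eigenvalue to the centred quadratic form.\<close>

definition centered_chi_char :: "real \<Rightarrow> complex" where
  "centered_chi_char t = (CLINT z|std_normal_distribution. iexp (t * ((z\<^sup>2 - 1) / 2)))"

text \<open>The upper half follows from (1 - u + u^2) (1 + u) = 1 + u^3 >= 1 and 1 + u <= exp
  u.\<close>

lemma exp_minus_quadratic_approx:
  fixes u :: real
  assumes "0 \<le> u"
  shows "\<bar>exp (- u) - (1 - u)\<bar> \<le> u\<^sup>2"
proof -
  have "1 - u \<le> exp (- u)" using exp_ge_add_one_self[of "- u"] by simp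
  moreover have "exp (- u) \<le> 1 - u + u\<^sup>2"
  proof -
    have "(1 - u + u\<^sup>2) * (1 + u) = 1 + u ^ 3" by (simp add: algebra_simps power2_eq_square power3_eq_cube)
    then have "1 \<le> (1 - u + u\<^sup>2) * (1 + u)" using assms by simp
    also have "\<dots> \<le> (1 - u + u\<^sup>2) * exp u"
    proof (rule mult_left_mono)
      have "0 \<le> (u - 1/2)\<^sup>2 + 3/4" by simp
      then show "0 \<le> 1 - u + u\<^sup>2" by (simp add: power2_eq_square algebra_simps)
    qed (rule exp_ge_add_one_self)
    finally show ?thesis by (simp add: exp_minus field_simps)
  qed
  ultimately show ?thesis by simp
qed

lemma centered_chi_char_approx:
  obtains C where "0 \<le> C" "\<And>t. \<bar>t\<bar> \<le> 1 \<Longrightarrow> cmod (centered_chi_char t - exp (- t\<^sup>2 / 4)) \<le> C * \<bar>t\<bar> ^ 3"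
proof -
  let ?S = std_normal_distribution
  interpret S: prob_space ?S by (rule prob_space_std_normal)
  define X :: "real \<Rightarrow> real" where "X z = (z\<^sup>2 - 1) / 2" for z
  have [measurable]: "X \<in> borel_measurable borel" unfolding X_def by measurable
  note mom = integrable_std_normal_distribution_moment
  have X2: "(X z)\<^sup>2 = (z ^ 4 - 2 * z ^ 2 + 1) / 4" for z
    by (simp add: X_def power2_eq_square eval_nat_numeral algebra_simps)
  have X3: "(X z) ^ 3 = (z ^ 6 - 3 * z ^ 4 + 3 * z ^ 2 - 1) / 8" for z
  proof -
    have "((u - 1) / 2) ^ 3 = (u ^ 3 - 3 * u\<^sup>2 + 3 * u - 1) / 8" for u :: real
      by (simp add: power3_eq_cube power2_eq_square field_simps)
    from this[of "z\<^sup>2"] show ?thesis by (simp add: X_def power_mult[symmetric])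
  qed
  have int: "integrable ?S X" "integrable ?S (\<lambda>z. (X z)\<^sup>2)" "integrable ?S (\<lambda>z. (X z) ^ 3)"
    unfolding X2 X3 by (auto simp: X_def[abs_def] intro!: mom Bochner_Integration.integrable_diff Bochner_Integration.integrable_add)
  have int3: "integrable ?S (\<lambda>z. \<bar>X z\<bar> ^ 3)"
    using integrable_abs[OF int(3)] by (simp add: power_abs)
  have m2: "(LINT z|?S. z ^ 2) = 1" and m4: "(LINT z|?S. z ^ 4) = 3"
    using std_normal_distribution_even_moments(1)[of 1] std_normal_distribution_even_moments(1)[of 2]
    by (simp_all add: fact_numeral eval_nat_numeral)
  have EX: "S.expectation X = 0"
    unfolding X_def using mom[of 2] m2 S.prob_space by simp
  have EX2: "S.variance X = 1 / 2"
    unfolding EX using mom[of 2] mom[of 4] m2 m4 S.prob_space by (simp add: X2)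
  \<comment> \<open>The third-moment term bounds the distance to 1 - t^2/4; the added 1 pays for
    replacing this polynomial by exp (- t^2/4).\<close>
  define C where "C = S.expectation (\<lambda>z. \<bar>X z\<bar> ^ 3) / 6 + 1"
  have C0: "0 \<le> C" unfolding C_def by (intro add_nonneg_nonneg divide_nonneg_nonneg integral_nonneg_AE) auto
  show thesis
  proof (rule that[OF C0])
    fix t :: real assume t: "\<bar>t\<bar> \<le> 1"
    have "centered_chi_char t = char (distr ?S borel X) t"
      unfolding centered_chi_char_def char_def X_def by (subst integral_distr) auto
    then have "cmod (centered_chi_char t - (1 - t\<^sup>2 * (1 / 2) / 2)) \<le>
        (t\<^sup>2 / 6) * S.expectation (\<lambda>z. min (6 * (X z)\<^sup>2) (\<bar>t\<bar> * \<bar>X z\<bar> ^ 3))"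
      using S.char_approx3'[OF _ int(1,2) EX EX2 refl, of t] by simp
    also have "\<dots> \<le> (t\<^sup>2 / 6) * S.expectation (\<lambda>z. \<bar>t\<bar> * \<bar>X z\<bar> ^ 3)"
      using int int3 by (intro mult_left_mono integral_mono integrable_min integrable_mult_right) auto
    also have "\<dots> = (C - 1) * \<bar>t\<bar> ^ 3"
      by (simp add: C_def power3_eq_cube power2_eq_square abs_mult[symmetric])
    finally have 1: "cmod (centered_chi_char t - (1 - t\<^sup>2 / 4)) \<le> (C - 1) * \<bar>t\<bar> ^ 3" by simp
    have "\<bar>exp (- (t\<^sup>2 / 4)) - (1 - t\<^sup>2 / 4)\<bar> \<le> (t\<^sup>2 / 4)\<^sup>2"
      by (rule exp_minus_quadratic_approx) simp
    also have "(t\<^sup>2 / 4)\<^sup>2 = \<bar>t\<bar> ^ 4 / 16"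
      by (simp add: power_divide power_mult[symmetric])
    also have "\<dots> \<le> \<bar>t\<bar> ^ 4" by simp
    also have "\<dots> \<le> \<bar>t\<bar> ^ 3" using t by (intro power_decreasing) auto
    finally have "cmod (complex_of_real (1 - t\<^sup>2 / 4 - exp (- (t\<^sup>2 / 4)))) \<le> \<bar>t\<bar> ^ 3"
      unfolding norm_of_real by (simp add: abs_minus_commute)
    then have 2: "cmod ((1 - t\<^sup>2 / 4) - exp (- t\<^sup>2 / 4)) \<le> \<bar>t\<bar> ^ 3"
      by (simp add: exp_of_real)
    show "cmod (centered_chi_char t - exp (- t\<^sup>2 / 4)) \<le> C * \<bar>t\<bar> ^ 3"
      using norm_triangle_ineq[of "centered_chi_char t - (1 - t\<^sup>2 / 4)" "(1 - t\<^sup>2 / 4) - exp (- t\<^sup>2 / 4)"] 1 2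
      by (simp add: algebra_simps)
  qed
qed

text \<open>A product of factors of modulus at most 1 changes by no more than the sum of the changes
  of its factors, and |lam|^3 <= \<delta> lam^2. The dimension does not enter the bound; this is
  essential because d grows with m while the sum of the squared eigenvalues stays fixed.\<close>

lemma centered_quadratic_form_char_approx:
  obtains C where "0 \<le> C" "\<And>d (lam :: nat \<Rightarrow> real) \<delta>. (\<And>k. k < d \<Longrightarrow> \<bar>lam k\<bar> \<le> \<delta>) \<Longrightarrow> \<delta> \<le> 1 \<Longrightarrow>
    cmod ((CLINT x|std_normal_vec d. iexp (\<Sum>k<d. lam k * (((x k)\<^sup>2 - 1) / 2)))
      - exp (- (\<Sum>k<d. (lam k)\<^sup>2) / 4)) \<le> C * \<delta> * (\<Sum>k<d. (lam k)\<^sup>2)"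
proof -
  obtain C where C: "0 \<le> C" "\<And>t. \<bar>t\<bar> \<le> 1 \<Longrightarrow> cmod (centered_chi_char t - exp (- t\<^sup>2 / 4)) \<le> C * \<bar>t\<bar> ^ 3"
    using centered_chi_char_approx by blast
  interpret S: prob_space std_normal_distribution by (rule prob_space_std_normal)
  interpret product_prob_space "\<lambda>_::nat. std_normal_distribution" by (rule product_prob_space_std_normal)
  show thesis
  proof (rule that[OF C(1)])
    fix d :: nat and lam :: "nat \<Rightarrow> real" and \<delta> :: real
    assume lam: "\<And>k. k < d \<Longrightarrow> \<bar>lam k\<bar> \<le> \<delta>" and \<delta>: "\<delta> \<le> 1"
    have "(CLINT x|std_normal_vec d. iexp (\<Sum>k<d. lam k * (((x k)\<^sup>2 - 1) / 2)))
        = (CLINT x|std_normal_vec d. (\<Prod>k<d. iexp (lam k * (((x k)\<^sup>2 - 1) / 2))))"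
      by (simp add: sum_distrib_left exp_sum)
    also have "\<dots> = (\<Prod>k<d. centered_chi_char (lam k))"
      unfolding centered_chi_char_def
      by (rule product_integral_prod[of "{..<d}" "\<lambda>k z. iexp (lam k * ((z\<^sup>2 - 1) / 2))"])
        (auto intro!: S.integrable_const_bound[of _ 1])
    finally have L: "(CLINT x|std_normal_vec d. iexp (\<Sum>k<d. lam k * (((x k)\<^sup>2 - 1) / 2))) = (\<Prod>k<d. centered_chi_char (lam k))" .
    have R: "exp (- (\<Sum>k<d. (lam k)\<^sup>2) / 4) = (\<Prod>k<d. exp (- (lam k)\<^sup>2 / 4))"
      by (simp add: exp_sum[symmetric] sum_negf sum_divide_distrib)
    have n1: "cmod (centered_chi_char t) \<le> 1" for t
      unfolding centered_chi_char_def
      by (rule order_trans[OF integral_norm_bound]) (simp add: S.prob_space)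
    have "cmod ((\<Prod>k<d. centered_chi_char (lam k)) - (\<Prod>k<d. complex_of_real (exp (- (lam k)\<^sup>2 / 4))))
        \<le> (\<Sum>k<d. cmod (centered_chi_char (lam k) - complex_of_real (exp (- (lam k)\<^sup>2 / 4))))"
      by (rule norm_prod_diff) (auto simp: n1 simp del: of_real_exp)
    also have "\<dots> \<le> (\<Sum>k<d. C * \<delta> * (lam k)\<^sup>2)"
    proof (rule sum_mono)
      fix k assume "k \<in> {..<d}"
      then have k: "\<bar>lam k\<bar> \<le> \<delta>" using lam by simp
      then have "\<bar>lam k\<bar> \<le> 1" using \<delta> by linarith
      then have "cmod (centered_chi_char (lam k) - complex_of_real (exp (- (lam k)\<^sup>2 / 4))) \<le> C * \<bar>lam k\<bar> ^ 3"
        using C(2)[of "lam k"] by (simp add: exp_of_real)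
      also have "\<dots> = C * \<bar>lam k\<bar> * (lam k)\<^sup>2" by (simp add: power3_eq_cube power2_eq_square)
      also have "\<dots> \<le> C * \<delta> * (lam k)\<^sup>2" using k C(1) by (intro mult_right_mono mult_left_mono) auto
      finally show "cmod (centered_chi_char (lam k) - complex_of_real (exp (- (lam k)\<^sup>2 / 4))) \<le> C * \<delta> * (lam k)\<^sup>2" .
    qed
    finally show "cmod ((CLINT x|std_normal_vec d. iexp (\<Sum>k<d. lam k * (((x k)\<^sup>2 - 1) / 2)))
      - exp (- (\<Sum>k<d. (lam k)\<^sup>2) / 4)) \<le> C * \<delta> * (\<Sum>k<d. (lam k)\<^sup>2)"
      unfolding L R by (simp add: sum_distrib_left)
  qed
qed


section \<open>Convergence to the chi-square distribution\<close>

lemma char_std_normal_vec: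
  "(CLINT x|std_normal_vec r. iexp (\<Sum>k<r. x k * w k)) = exp (- (\<Sum>k<r. (w k)\<^sup>2) / 2)"
proof -
  interpret S: prob_space std_normal_distribution by (rule prob_space_std_normal)
  interpret product_prob_space "\<lambda>_::nat. std_normal_distribution" by (rule product_prob_space_std_normal)
  have "(CLINT x|std_normal_vec r. iexp (\<Sum>k<r. x k * w k)) = (CLINT x|std_normal_vec r. (\<Prod>k<r. iexp (w k * x k)))"
    by (simp add: sum_distrib_left exp_sum mult.commute)
  also have "\<dots> = (\<Prod>k<r. char std_normal_distribution (w k))"
    unfolding char_def
    by (rule product_integral_prod[of "{..<r}" "\<lambda>k z. iexp (w k * z)"]) (auto intro!: S.integrable_const_bound[of _ 1])
  also have "\<dots> = exp (- (\<Sum>k<r. (w k)\<^sup>2) / 2)"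
    unfolding char_std_normal_distribution
    by (simp add: exp_of_real[symmetric] exp_sum[symmetric] sum_negf sum_divide_distrib)
  finally show ?thesis .
qed

text \<open>The Laplace transform of \<open>|W|\<^sup>2\<close> is an average of the characteristic function of \<open>W\<close> over an
  independent Gaussian vector. This reduces the convergence of \<open>|W|\<^sup>2\<close> to pointwise convergence of the
  characteristic functions, without a multivariate continuity theorem.\<close>

lemma laplace_norm_eq_average_char:
  fixes W :: "nat \<Rightarrow> 'a \<Rightarrow> real"
  assumes M: "prob_space M" and W: "\<And>k. k < r \<Longrightarrow> W k \<in> borel_measurable M" and s: "0 \<le> s"
  shows "complex_of_real (LINT \<omega>|M. exp (- s * (\<Sum>k<r. (W k \<omega>)\<^sup>2))) =
    (CLINT x|std_normal_vec r. (CLINT \<omega>|M. iexp (\<Sum>k<r. (sqrt (2 * s) * x k) * W k \<omega>)))"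
proof -
  interpret M: prob_space M by fact
  interpret G: prob_space "std_normal_vec r" by (rule prob_space_std_normal_vec)
  interpret P: pair_prob_space M "std_normal_vec r" ..
  have [measurable]: "W k \<in> borel_measurable M" if "k < r" for k using W that .
  \<comment> \<open>The scale sqrt (2 s) turns exp (- |w|^2 / 2) into exp (- s |w|^2).\<close>
  have "(CLINT x|std_normal_vec r. iexp (\<Sum>k<r. (sqrt (2 * s) * x k) * W k \<omega>)) = exp (- s * (\<Sum>k<r. (W k \<omega>)\<^sup>2))" for \<omega>
  proof -
    have "(CLINT x|std_normal_vec r. iexp (\<Sum>k<r. (sqrt (2 * s) * x k) * W k \<omega>)) =
        (CLINT x|std_normal_vec r. iexp (\<Sum>k<r. x k * (sqrt (2 * s) * W k \<omega>)))"
      by (simp only: mult_ac)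
    also have "\<dots> = exp (- (\<Sum>k<r. (sqrt (2 * s) * W k \<omega>)\<^sup>2) / 2)" by (rule char_std_normal_vec)
    also have "(\<Sum>k<r. (sqrt (2 * s) * W k \<omega>)\<^sup>2) = 2 * s * (\<Sum>k<r. (W k \<omega>)\<^sup>2)"
      using s by (simp add: power_mult_distrib sum_distrib_left)
    finally show ?thesis by simp
  qed
  then have "complex_of_real (LINT \<omega>|M. exp (- s * (\<Sum>k<r. (W k \<omega>)\<^sup>2))) =
      (CLINT \<omega>|M. (CLINT x|std_normal_vec r. iexp (\<Sum>k<r. (sqrt (2 * s) * x k) * W k \<omega>)))"
    by (simp only: integral_complex_of_real)
  also have "\<dots> = (CLINT x|std_normal_vec r. (CLINT \<omega>|M. iexp (\<Sum>k<r. (sqrt (2 * s) * x k) * W k \<omega>)))"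
  proof (rule P.Fubini_integral[symmetric], rule P.integrable_const_bound[of _ 1])
    show "(\<lambda>(\<omega>, x). iexp (\<Sum>k<r. sqrt (2 * s) * x k * W k \<omega>)) \<in> borel_measurable (M \<Otimes>\<^sub>M std_normal_vec r)"
    proof -
      have "(\<lambda>p. sqrt (2 * s) * snd p k * W k (fst p)) \<in> borel_measurable (M \<Otimes>\<^sub>M std_normal_vec r)" if "k < r" for k
        using that measurable_compose[OF measurable_snd measurable_component_std_normal_vec[OF that], of M]
        by measurable
      then have "(\<lambda>p. iexp (\<Sum>k<r. sqrt (2 * s) * snd p k * W k (fst p))) \<in> borel_measurable (M \<Otimes>\<^sub>M std_normal_vec r)"
        by measurable
      then show ?thesis by (simp only: case_prod_beta')
    qed
  qed (auto simp: case_prod_beta')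
  finally show ?thesis .
qed

text \<open>The averaging Gaussian vector has the same law for every m, so dominated convergence
  with bound 1 applies to the inner characteristic functions. The limiting average is itself the
  Laplace transform of the squared norm of a standard Gaussian vector.\<close>

lemma laplace_norm_tendsto:
  fixes W :: "nat \<Rightarrow> nat \<Rightarrow> 'a \<Rightarrow> real"
  assumes M: "\<And>m. prob_space (M m)" and W: "\<And>m k. k < r \<Longrightarrow> W m k \<in> borel_measurable (M m)" and s: "0 \<le> s"
    and char: "\<And>\<theta>. (\<lambda>m. CLINT \<omega>|M m. iexp (\<Sum>k<r. \<theta> k * W m k \<omega>)) \<longlonglongrightarrow> exp (- (\<Sum>k<r. (\<theta> k)\<^sup>2) / 2)"
  shows "(\<lambda>m. LINT \<omega>|M m. exp (- s * (\<Sum>k<r. (W m k \<omega>)\<^sup>2))) \<longlonglongrightarrow> (LINT x|std_normal_vec r. exp (- s * (\<Sum>k<r. (x k)\<^sup>2)))"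
proof -
  interpret G: prob_space "std_normal_vec r" by (rule prob_space_std_normal_vec)
  let ?f = "\<lambda>m x. CLINT \<omega>|M m. iexp (\<Sum>k<r. (sqrt (2 * s) * x k) * W m k \<omega>)"
  have [measurable]: "W m k \<in> borel_measurable (M m)" if "k < r" for m k using W that .
  have meas: "?f m \<in> borel_measurable (std_normal_vec r)" for m
  proof -
    interpret M: prob_space "M m" by (rule M)
    have "(\<lambda>p. sqrt (2 * s) * fst p k * W m k (snd p)) \<in> borel_measurable (std_normal_vec r \<Otimes>\<^sub>M M m)" if "k < r" for k
      using that measurable_compose[OF measurable_fst measurable_component_std_normal_vec[OF that], of "M m"]
      by measurable
    then have "(\<lambda>p. iexp (\<Sum>k<r. sqrt (2 * s) * fst p k * W m k (snd p))) \<in> borel_measurable (std_normal_vec r \<Otimes>\<^sub>M M m)"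
      by measurable
    then show ?thesis
      by (intro M.borel_measurable_lebesgue_integral) (simp only: case_prod_beta')
  qed
  have "(\<lambda>m. CLINT x|std_normal_vec r. ?f m x) \<longlonglongrightarrow> (CLINT x|std_normal_vec r. complex_of_real (exp (- (\<Sum>k<r. (sqrt (2 * s) * x k)\<^sup>2) / 2)))"
  proof (rule integral_dominated_convergence[where w = "\<lambda>_. 1"])
    show "AE x in std_normal_vec r. (\<lambda>m. ?f m x) \<longlonglongrightarrow> complex_of_real (exp (- (\<Sum>k<r. (sqrt (2 * s) * x k)\<^sup>2) / 2))"
      by (intro AE_I2 char)
    show "AE x in std_normal_vec r. norm (?f m x) \<le> 1" for m
    proof (rule AE_I2)
      fix x
      interpret M: prob_space "M m" by (rule M)
      show "norm (?f m x) \<le> 1"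
        by (rule order_trans[OF integral_norm_bound]) (simp add: M.prob_space)
    qed
  qed (use meas in auto)
  also have "(\<lambda>m. CLINT x|std_normal_vec r. ?f m x) = (\<lambda>m. complex_of_real (LINT \<omega>|M m. exp (- s * (\<Sum>k<r. (W m k \<omega>)\<^sup>2))))"
    using laplace_norm_eq_average_char[OF M W s] by (intro ext) simp
  finally have "(\<lambda>m. complex_of_real (LINT \<omega>|M m. exp (- s * (\<Sum>k<r. (W m k \<omega>)\<^sup>2)))) \<longlonglongrightarrow>
      (CLINT x|std_normal_vec r. complex_of_real (exp (- (\<Sum>k<r. (sqrt (2 * s) * x k)\<^sup>2) / 2)))" .
  moreover have "- (\<Sum>k<r. (sqrt (2 * s) * x k)\<^sup>2) / 2 = - s * (\<Sum>k<r. (x k)\<^sup>2)" for x :: "nat \<Rightarrow> real"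
    using s by (simp add: power_mult_distrib sum_distrib_left[symmetric] mult.assoc)
  ultimately have "(\<lambda>m. complex_of_real (LINT \<omega>|M m. exp (- s * (\<Sum>k<r. (W m k \<omega>)\<^sup>2)))) \<longlonglongrightarrow>
      complex_of_real (LINT x|std_normal_vec r. exp (- s * (\<Sum>k<r. (x k)\<^sup>2)))"
    by (simp only: integral_complex_of_real)
  then show ?thesis by (simp only: tendsto_of_real_iff)
qed

text \<open>The substitution y = exp (- x) maps the half-line into [0, 1] and exp (- j x) to y^j.
  Polynomials approximate continuous functions of y uniformly, so integer arguments of the Laplace
  transform are enough; continuous step functions suffice to test weak convergence.\<close>

lemma laplace_imp_weak_conv:
  fixes \<mu>s :: "nat \<Rightarrow> real measure"
  assumes \<mu>s: "\<And>m. real_distribution (\<mu>s m)" "\<And>m. AE x in \<mu>s m. 0 \<le> x"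
    and \<mu>: "real_distribution \<mu>" "AE x in \<mu>. 0 \<le> x"
    and laplace: "\<And>j :: nat. (\<lambda>m. LINT x|\<mu>s m. exp (- real j * x)) \<longlonglongrightarrow> (LINT x|\<mu>. exp (- real j * x))"
  shows "weak_conv_m \<mu>s \<mu>"
proof (rule integral_cts_step_conv_imp_weak_conv[OF \<mu>s(1) \<mu>(1)])
  fix a b :: real assume ab: "a < b"
  \<comment> \<open>Beyond b the step function is 0, so its transform vanishes for y up to exp (- b)
    and extends continuously by 0 to y = 0, the image of infinity.\<close>
  define h where "h y = (if y \<le> 0 then 0 else cts_step a b (- ln y))" for y :: real
  have cts: "continuous_on UNIV (cts_step a b)"
    using cts_step_uniformly_continuous[OF ab] by (rule uniformly_continuous_imp_continuous)
  have h0: "h y = 0" if "y \<le> exp (- b)" for y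
  proof (cases "0 < y")
    case True
    then have "ln y \<le> - b" using that by (metis ln_exp ln_le_cancel_iff exp_gt_zero)
    then show ?thesis using ab by (simp add: h_def cts_step_def)
  qed (simp add: h_def)
  have "continuous_on ({..exp (- b)} \<union> {exp (- b)..}) h"
  proof (rule continuous_on_closed_Un)
    show "continuous_on {..exp (- b)} h"
      using h0 by (subst continuous_on_cong[of _ _ _ "\<lambda>_. 0"]) auto
    have "continuous_on {exp (- b)..} (\<lambda>y. cts_step a b (- ln y))"
      by (rule continuous_on_compose2[OF cts]) (auto intro!: continuous_intros less_le_trans[OF exp_gt_zero])
    moreover have "h y = cts_step a b (- ln y)" if "y \<in> {exp (- b)..}" for y
      using that less_le_trans[OF exp_gt_zero[of "- b"], of y] by (simp add: h_def)
    ultimately show "continuous_on {exp (- b)..} h" by (subst continuous_on_cong[OF refl])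
  qed auto
  then have hc: "continuous_on {0..1} h"
    by (rule continuous_on_subset) auto
  have hs: "cts_step a b x = h (exp (- x))" for x by (simp add: h_def)
  have [measurable]: "cts_step a b \<in> borel_measurable borel"
    using cts by (rule borel_measurable_continuous_onI)
  have approx: "\<bar>(LINT x|\<nu>. cts_step a b x) - (\<Sum>i\<le>n. c i * (LINT x|\<nu>. exp (- real i * x)))\<bar> \<le> e"
    if \<nu>: "real_distribution \<nu>" "AE x in \<nu>. 0 \<le> x" and g: "\<And>y. y \<in> {0..1} \<Longrightarrow> \<bar>h y - (\<Sum>i\<le>n. c i * y ^ i)\<bar> < e"
    for \<nu> and c :: "nat \<Rightarrow> real" and n e
  proof -
    interpret \<nu>: real_distribution \<nu> by fact
    have ie: "integrable \<nu> (\<lambda>x. exp (- real i * x))" for i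
    proof (rule \<nu>.integrable_const_bound[of _ 1])
      show "AE x in \<nu>. norm (exp (- real i * x)) \<le> 1" using \<nu>(2) by eventually_elim simp
    qed simp
    have ic: "integrable \<nu> (cts_step a b)" using ab by (rule \<nu>.integrable_cts_step)
    have isum: "integrable \<nu> (\<lambda>x. \<Sum>i\<le>n. c i * exp (- real i * x))"
      using ie by (intro Bochner_Integration.integrable_sum integrable_mult_right)
    have "(LINT x|\<nu>. cts_step a b x) - (\<Sum>i\<le>n. c i * (LINT x|\<nu>. exp (- real i * x))) =
        (LINT x|\<nu>. cts_step a b x - (\<Sum>i\<le>n. c i * exp (- real i * x)))"
      using ie ic isum by (simp add: Bochner_Integration.integral_diff Bochner_Integration.integral_sum)
    also have "\<bar>\<dots>\<bar> \<le> (LINT x|\<nu>. \<bar>cts_step a b x - (\<Sum>i\<le>n. c i * exp (- real i * x))\<bar>)"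
      by (rule integral_abs_bound)
    also have "\<dots> \<le> (LINT x|\<nu>. e)"
    proof (rule integral_mono_AE)
      show "AE x in \<nu>. \<bar>cts_step a b x - (\<Sum>i\<le>n. c i * exp (- real i * x))\<bar> \<le> e"
        using \<nu>(2)
      proof eventually_elim
        fix x :: real assume "0 \<le> x"
        then have "exp (- x) \<in> {0..1}" by simp
        from g[OF this] show "\<bar>cts_step a b x - (\<Sum>i\<le>n. c i * exp (- real i * x))\<bar> \<le> e"
          by (simp add: hs exp_of_nat_mult[symmetric] less_imp_le)
      qed
    qed (use ic isum in auto)
    also have "\<dots> = e" using \<nu>.prob_space by simp
    finally show ?thesis .
  qed
  show "(\<lambda>m. LINT x|\<mu>s m. cts_step a b x) \<longlonglongrightarrow> (LINT x|\<mu>. cts_step a b x)"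
  proof (rule LIMSEQ_I)
    fix \<epsilon> :: real assume "0 < \<epsilon>"
    define e where "e = \<epsilon> / 4"
    have e: "0 < e" using \<open>0 < \<epsilon>\<close> by (simp add: e_def)
    obtain g where g: "real_polynomial_function g" "\<And>y. y \<in> {0..1} \<Longrightarrow> \<bar>h y - g y\<bar> < e"
      using Stone_Weierstrass_real_polynomial_function[OF compact_Icc hc e] by blast
    obtain c n where c: "g = (\<lambda>y. \<Sum>i\<le>n. c i * y ^ i)"
      using g(1) unfolding real_polynomial_function_iff_sum by blast
    let ?L = "\<lambda>\<nu>. \<Sum>i\<le>n. c i * (LINT x|\<nu>. exp (- real i * x))"
    have "(\<lambda>m. ?L (\<mu>s m)) \<longlonglongrightarrow> ?L \<mu>"
      by (intro tendsto_sum tendsto_mult tendsto_const laplace)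
    then obtain n0 where n0: "\<And>m. n0 \<le> m \<Longrightarrow> norm (?L (\<mu>s m) - ?L \<mu>) < e"
      using LIMSEQ_D[OF _ e] by blast
    have "norm ((LINT x|\<mu>s m. cts_step a b x) - (LINT x|\<mu>. cts_step a b x)) < \<epsilon>" if "n0 \<le> m" for m
    proof -
      have "\<bar>(LINT x|\<mu>s m. cts_step a b x) - ?L (\<mu>s m)\<bar> \<le> e"
        by (rule approx[OF \<mu>s]) (use g(2) c in simp)
      moreover have "\<bar>(LINT x|\<mu>. cts_step a b x) - ?L \<mu>\<bar> \<le> e"
        by (rule approx[OF \<mu>]) (use g(2) c in simp)
      ultimately show ?thesis using n0[OF that] e unfolding e_def real_norm_def by linarith
    qed
    then show "\<exists>n0. \<forall>m\<ge>n0. norm ((LINT x|\<mu>s m. cts_step a b x) - (LINT x|\<mu>. cts_step a b x)) < \<epsilon>" by blast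
  qed
qed

section \<open>The chi-square law as a limit, and its quantiles\<close>

lemma chi_square_eq_distr: "chi_square r = distr (std_normal_vec r) borel (\<lambda>x. \<Sum>i<r. (x i)\<^sup>2)"
  unfolding chi_square_def normal_dist_def by simp

lemma real_distribution_chi_square: "real_distribution (chi_square r)"
proof -
  interpret G: prob_space "std_normal_vec r" by (rule prob_space_std_normal_vec)
  have "(\<lambda>x. \<Sum>i<r. (x i)\<^sup>2) \<in> borel_measurable (std_normal_vec r)" by measurable
  then show ?thesis unfolding chi_square_eq_distr by (rule G.real_distribution_distr)
qed

theorem norm_tendsto_chi_square:
  fixes W :: "nat \<Rightarrow> nat \<Rightarrow> 'a \<Rightarrow> real"
  assumes M: "\<And>m. prob_space (M m)" and W: "\<And>m k. k < r \<Longrightarrow> W m k \<in> borel_measurable (M m)"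
    and char: "\<And>\<theta>. (\<lambda>m. CLINT \<omega>|M m. iexp (\<Sum>k<r. \<theta> k * W m k \<omega>)) \<longlonglongrightarrow> exp (- (\<Sum>k<r. (\<theta> k)\<^sup>2) / 2)"
  shows "weak_conv_m (\<lambda>m. distr (M m) borel (\<lambda>\<omega>. \<Sum>k<r. (W m k \<omega>)\<^sup>2)) (chi_square r)"
proof (rule laplace_imp_weak_conv)
  have [measurable]: "W m k \<in> borel_measurable (M m)" if "k < r" for m k using W that .
  have T: "(\<lambda>\<omega>. \<Sum>k<r. (W m k \<omega>)\<^sup>2) \<in> borel_measurable (M m)" for m by measurable
  have G: "(\<lambda>x. \<Sum>i<r. (x i)\<^sup>2) \<in> borel_measurable (std_normal_vec r)" by measurable
  show "real_distribution (distr (M m) borel (\<lambda>\<omega>. \<Sum>k<r. (W m k \<omega>)\<^sup>2))" for m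
    using M T by (rule prob_space.real_distribution_distr)
  show "AE x in distr (M m) borel (\<lambda>\<omega>. \<Sum>k<r. (W m k \<omega>)\<^sup>2). 0 \<le> x" for m
    using T by (subst AE_distr_iff) (auto intro!: AE_I2 sum_nonneg)
  show "real_distribution (chi_square r)" by (rule real_distribution_chi_square)
  show "AE x in chi_square r. 0 \<le> x"
    unfolding chi_square_eq_distr using G by (subst AE_distr_iff) (auto intro!: AE_I2 sum_nonneg)
  fix j :: nat
  have "(\<lambda>m. LINT \<omega>|M m. exp (- real j * (\<Sum>k<r. (W m k \<omega>)\<^sup>2))) \<longlonglongrightarrow> (LINT x|std_normal_vec r. exp (- real j * (\<Sum>k<r. (x k)\<^sup>2)))"
    by (rule laplace_norm_tendsto[OF M W _ char]) auto
  also have "(\<lambda>m. LINT \<omega>|M m. exp (- real j * (\<Sum>k<r. (W m k \<omega>)\<^sup>2))) = (\<lambda>m. LINT x|distr (M m) borel (\<lambda>\<omega>. \<Sum>k<r. (W m k \<omega>)\<^sup>2). exp (- real j * x))"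
    using T by (intro ext integral_distr[symmetric]) auto
  also have "(LINT x|std_normal_vec r. exp (- real j * (\<Sum>k<r. (x k)\<^sup>2))) = (LINT x|chi_square r. exp (- real j * x))"
    unfolding chi_square_eq_distr using G by (intro integral_distr[symmetric]) auto
  finally show "(\<lambda>m. LINT x|distr (M m) borel (\<lambda>\<omega>. \<Sum>k<r. (W m k \<omega>)\<^sup>2). exp (- real j * x)) \<longlonglongrightarrow> (LINT x|chi_square r. exp (- real j * x))" .
qed

text \<open>Once all coordinates but the last are fixed, the last one must satisfy y^2 = c', which
  has at most two solutions, and the normal law gives them mass 0. For r = 0 the law would be a
  point mass at 0.\<close>

lemma chi_square_no_atoms:
  assumes "1 \<le> r"
  shows "measure (chi_square r) {c} = 0"
proof -
  interpret product_prob_space "\<lambda>_::nat. std_normal_distribution" by (rule product_prob_space_std_normal)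
  obtain r' where r: "r = Suc r'" using assms by (cases r) auto
  define f where "f x = (indicator {c} (\<Sum>i<r. (x i)\<^sup>2) :: ennreal)" for x :: "nat \<Rightarrow> real"
  have f: "f \<in> borel_measurable (std_normal_vec r)" unfolding f_def by measurable
  have eq: "{..<r} = insert r' {..<r'}" by (simp add: r lessThan_Suc)
  have "emeasure (chi_square r) {c} = (\<integral>\<^sup>+x. f x \<partial>std_normal_vec r)"
    unfolding chi_square_eq_distr f_def
    by (subst nn_integral_distr[symmetric, of _ _ borel]) simp_all
  also have "\<dots> = (\<integral>\<^sup>+x. \<integral>\<^sup>+y. f (x(r' := y)) \<partial>std_normal_distribution \<partial>std_normal_vec r')"
    using product_nn_integral_insert[of "{..<r'}" r' f] f unfolding eq by simp
  also have "\<dots> = (\<integral>\<^sup>+x. 0 \<partial>std_normal_vec r')"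
  proof (intro nn_integral_cong)
    fix x :: "nat \<Rightarrow> real"
    define c' where "c' = c - (\<Sum>i<r'. (x i)\<^sup>2)"
    have fx: "f (x(r' := y)) = indicator {y. y\<^sup>2 = c'} y" for y
    proof -
      have "(\<Sum>i<r'. ((x(r' := y)) i)\<^sup>2) = (\<Sum>i<r'. (x i)\<^sup>2)" by (intro sum.cong) auto
      then show ?thesis by (auto simp: f_def r c'_def indicator_def)
    qed
    have "finite {y. y\<^sup>2 = c'}"
    proof (rule finite_subset)
      show "{y. y\<^sup>2 = c'} \<subseteq> {sqrt c', - sqrt c'}" by (auto simp: real_sqrt_abs abs_if split: if_splits)
    qed simp
    then have null: "{y. y\<^sup>2 = c'} \<in> null_sets lborel" by (rule finite_imp_null_set_lborel)
    have "(\<integral>\<^sup>+y. f (x(r' := y)) \<partial>std_normal_distribution) = emeasure std_normal_distribution {y. y\<^sup>2 = c'}"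
      unfolding fx using null by (intro nn_integral_indicator) auto
    also have "\<dots> = 0"
    proof -
      have "{y. y\<^sup>2 = c'} \<in> null_sets std_normal_distribution"
        using null AE_not_in[OF null] by (subst null_sets_density_iff) (auto elim!: eventually_mono)
      then show ?thesis by blast
    qed
    finally show "(\<integral>\<^sup>+y. f (x(r' := y)) \<partial>std_normal_distribution) = 0" .
  qed
  finally show ?thesis by (simp add: measure_def)
qed

text \<open>Continuity makes the set in the infimum closed, so the quantile belongs to it.
  Approaching from the left, where the distribution function is below p, gives the other
  inequality.\<close>

lemma cdf_quantile:
  assumes D: "real_distribution D" and cont: "\<And>x. isCont (cdf D) x" and p: "0 < p" "p < 1"
  shows "cdf D (quantile D p) = p"
proof -
  interpret D: real_distribution D by fact
  let ?S = "{x. p \<le> cdf D x}"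
  have mono: "cdf D x \<le> cdf D y" if "x \<le> y" for x y using that by (rule D.cdf_nondecreasing)
  have "eventually (\<lambda>x. cdf D x > p) at_top"
    using D.cdf_lim_at_top_prob p(2) by (rule order_tendstoD)
  then obtain u where "p < cdf D u" by (metis eventually_at_top_linorder order_refl)
  then have ne: "?S \<noteq> {}" by (auto intro: less_imp_le)
  have "eventually (\<lambda>x. cdf D x < p) at_bot"
    using D.cdf_lim_at_bot p(1) by (rule order_tendstoD)
  then obtain l where l: "cdf D l < p" by (metis eventually_at_bot_linorder order_refl)
  have bd: "bdd_below ?S"
  proof (rule bdd_belowI)
    fix x assume "x \<in> ?S"
    then show "l \<le> x" using mono[of x l] l by force
  qed
  have "closed ?S" using cont by (intro closed_Collect_le continuous_on_const continuous_at_imp_continuous_on) auto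
  then have ge: "p \<le> cdf D (quantile D p)"
    using closed_contains_Inf[OF ne bd] by (simp add: quantile_def)
  have "cdf D (quantile D p) \<le> p"
  proof (rule tendsto_upperbound)
    show "(cdf D \<longlongrightarrow> cdf D (quantile D p)) (at_left (quantile D p))"
      using cont[of "quantile D p"] by (simp add: isCont_def filterlim_at_split)
    have "cdf D x \<le> p" if "x < quantile D p" for x
      using that cInf_lower[OF _ bd, of x] unfolding quantile_def by force
    then show "eventually (\<lambda>x. cdf D x \<le> p) (at_left (quantile D p))"
      by (intro eventually_at_leftI[of "quantile D p - 1"]) auto
  qed simp
  then show ?thesis using ge by simp
qed

lemma cdf_chi_square_quantile:
  assumes "1 \<le> r" "0 < p" "p < 1"
  shows "isCont (cdf (chi_square r)) x" "cdf (chi_square r) (quantile (chi_square r) p) = p"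
proof -
  interpret real_distribution "chi_square r" by (rule real_distribution_chi_square)
  show c: "isCont (cdf (chi_square r)) x" for x using chi_square_no_atoms[OF assms(1)] isCont_cdf by blast
  show "cdf (chi_square r) (quantile (chi_square r) p) = p"
    using real_distribution_chi_square c assms(2,3) by (rule cdf_quantile)
qed


section \<open>Stacked vectors and block-diagonal matrices\<close>

lemma stack_vecs_0: "stack_vecs 0 v = vNil"
  by (simp add: stack_vecs_def)

lemma stack_vecs_Suc: "stack_vecs (Suc m) v = stack_vecs m v @\<^sub>v v m"
proof -
  have "list_of_vec (stack_vecs (Suc m) v) = list_of_vec (stack_vecs m v @\<^sub>v v m)"
    by (simp add: stack_vecs_def list_vec)
  then show ?thesis by (metis vec_list)
qed

lemma stack_vecs_carrier:
  "(\<And>i. i < m \<Longrightarrow> v i \<in> carrier_vec (n i)) \<Longrightarrow> stack_vecs m v \<in> carrier_vec (\<Sum>i<m. n i)"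
proof (induction m)
  case (Suc m)
  have "stack_vecs m v \<in> carrier_vec (\<Sum>i<m. n i)" "v m \<in> carrier_vec (n m)"
    using Suc.IH Suc.prems by simp_all
  then show ?case unfolding stack_vecs_Suc by (intro carrier_vecI) simp
next
  case 0
  show ?case unfolding stack_vecs_0 by (intro carrier_vecI) simp
qed

lemma stack_vecs_cong: "(\<And>i. i < m \<Longrightarrow> v i = w i) \<Longrightarrow> stack_vecs m v = stack_vecs m w"
  by (induction m) (auto simp: stack_vecs_0 stack_vecs_Suc)

lemma scalar_prod_stack_vecs:
  fixes v w :: "nat \<Rightarrow> real vec"
  assumes "\<And>i. i < m \<Longrightarrow> v i \<in> carrier_vec (n i)" "\<And>i. i < m \<Longrightarrow> w i \<in> carrier_vec (n i)"
  shows "stack_vecs m v \<bullet> stack_vecs m w = (\<Sum>i<m. v i \<bullet> w i)"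
  using assms
proof (induction m)
  case (Suc m)
  have "stack_vecs m v \<in> carrier_vec (\<Sum>i<m. n i)" "stack_vecs m w \<in> carrier_vec (\<Sum>i<m. n i)"
    using Suc.prems by (auto intro!: stack_vecs_carrier)
  then show ?case
    using Suc by (simp add: stack_vecs_Suc scalar_prod_append[of _ "\<Sum>i<m. n i" _ "n m"])
qed (simp add: stack_vecs_0 scalar_prod_def)

lemma stack_vecs_add:
  fixes v w :: "nat \<Rightarrow> real vec"
  assumes "\<And>i. i < m \<Longrightarrow> v i \<in> carrier_vec (n i)" "\<And>i. i < m \<Longrightarrow> w i \<in> carrier_vec (n i)"
  shows "stack_vecs m (\<lambda>i. v i + w i) = stack_vecs m v + stack_vecs m w"
  using assms
proof (induction m)
  case (Suc m)
  have "stack_vecs m v \<in> carrier_vec (\<Sum>i<m. n i)" "stack_vecs m w \<in> carrier_vec (\<Sum>i<m. n i)"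
    using Suc.prems by (auto intro!: stack_vecs_carrier)
  then show ?case
    using Suc by (simp add: stack_vecs_Suc append_vec_add[of _ "\<Sum>i<m. n i" _ _ "n m"])
qed (auto simp: stack_vecs_0)

text \<open>Reduces claims about arbitrary vectors of the stacked space to claims about their
  clusterwise pieces.\<close>

lemma stack_vecs_exists:
  assumes "x \<in> carrier_vec (\<Sum>i<m. n i)"
  obtains v where "\<And>i. i < m \<Longrightarrow> v i \<in> carrier_vec (n i)" "x = stack_vecs m v"
  using assms
proof (induction m arbitrary: x thesis)
  case 0
  then have "x = vNil" by (intro eq_vecI) simp_all
  then show ?case using "0.prems"(1)[of "\<lambda>_. vNil"] by (simp add: stack_vecs_0)
next
  case (Suc m)
  let ?N = "\<Sum>i<m. n i"
  have x: "x \<in> carrier_vec (?N + n m)" using Suc.prems(2) by simp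
  obtain v where v: "\<And>i. i < m \<Longrightarrow> v i \<in> carrier_vec (n i)" "vec_first x ?N = stack_vecs m v"
    using Suc.IH[OF _ vec_first_carrier[of x ?N]] by blast
  show ?case
  proof (rule Suc.prems(1)[of "v(m := vec_last x (n m))"])
    have "stack_vecs m (v(m := vec_last x (n m))) = stack_vecs m v" by (rule stack_vecs_cong) simp
    then show "x = stack_vecs (Suc m) (v(m := vec_last x (n m)))"
      using vec_first_last_append[OF x] v(2) by (simp add: stack_vecs_Suc)
  qed (use v in \<open>auto simp: less_Suc_eq\<close>)
qed

lemma block_diag_Suc:
  "block_diag (Suc m) A = four_block_mat (block_diag m A) (0\<^sub>m (dim_row (block_diag m A)) (dim_col (A m)))
     (0\<^sub>m (dim_row (A m)) (dim_col (block_diag m A))) (A m)"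
  by (simp add: block_diag_def diag_block_mat_last Let_def)

lemma block_diag_carrier:
  "(\<And>i. i < m \<Longrightarrow> A i \<in> carrier_mat (n i) (k i)) \<Longrightarrow> block_diag m A \<in> carrier_mat (\<Sum>i<m. n i) (\<Sum>i<m. k i)"
proof (induction m)
  case (Suc m)
  then have "block_diag m A \<in> carrier_mat (\<Sum>i<m. n i) (\<Sum>i<m. k i)" "A m \<in> carrier_mat (n m) (k m)"
    by simp_all
  then show ?case unfolding block_diag_Suc by (intro carrier_matI) simp_all
next
  case 0
  show ?case by (intro carrier_matI) (simp_all add: block_diag_def)
qed

lemma block_diag_mult_stack_vecs:
  fixes v :: "nat \<Rightarrow> real vec"
  assumes "\<And>i. i < m \<Longrightarrow> A i \<in> carrier_mat (n i) (k i)" "\<And>i. i < m \<Longrightarrow> v i \<in> carrier_vec (k i)"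
  shows "block_diag m A *\<^sub>v stack_vecs m v = stack_vecs m (\<lambda>i. A i *\<^sub>v v i)"
  using assms
proof (induction m)
  case 0
  then show ?case by (intro eq_vecI) (auto simp: stack_vecs_0 block_diag_def)
next
  case (Suc m)
  have B: "block_diag m A \<in> carrier_mat (\<Sum>i<m. n i) (\<Sum>i<m. k i)"
    using Suc.prems by (intro block_diag_carrier) auto
  have v: "stack_vecs m v \<in> carrier_vec (\<Sum>i<m. k i)"
    using Suc.prems by (intro stack_vecs_carrier) auto
  have Am: "A m \<in> carrier_mat (n m) (k m)" and vm: "v m \<in> carrier_vec (k m)" using Suc.prems by auto
  have "block_diag (Suc m) A *\<^sub>v stack_vecs (Suc m) v = (block_diag m A *\<^sub>v stack_vecs m v) @\<^sub>v (A m *\<^sub>v v m)"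
    unfolding block_diag_Suc stack_vecs_Suc
    by (subst four_block_mat_mult_vec[OF B _ _ Am v vm])
       (use B Am v vm in \<open>auto simp: zero_mult_vec\<close>)
  then show ?case using Suc by (simp add: stack_vecs_Suc)
qed

lemma stack_mats_mult_vec:
  assumes "\<And>i. i < m \<Longrightarrow> X i \<in> carrier_mat (n i) p" and b: "b \<in> carrier_vec p"
  shows "stack_mats m p X *\<^sub>v b = stack_vecs m (\<lambda>i. X i *\<^sub>v b)"
proof -
  have rows: "list_of_vec (mat_of_rows p rs *\<^sub>v b) = map (\<lambda>r. r \<bullet> b) rs" if "set rs \<subseteq> carrier_vec p" for rs :: "real vec list"
  proof (rule nth_equalityI)
    fix i assume "i < length (list_of_vec (mat_of_rows p rs *\<^sub>v b))"
    then have i: "i < length rs" by simp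
    then have "rs ! i \<in> carrier_vec p" using that nth_mem by blast
    then show "list_of_vec (mat_of_rows p rs *\<^sub>v b) ! i = map (\<lambda>r. r \<bullet> b) rs ! i"
      using i by (simp add: list_of_vec_index)
  qed simp
  have Xi: "list_of_vec (X i *\<^sub>v b) = map (\<lambda>r. r \<bullet> b) (rows (X i))" if "i < m" for i
  proof -
    have Xi: "X i \<in> carrier_mat (n i) p" using assms(1)[OF that] .
    then have "mat_of_rows p (rows (X i)) = X i" using mat_of_rows_rows[of "X i"] by simp
    moreover have "set (rows (X i)) \<subseteq> carrier_vec p" using Xi rows_carrier[of "X i"] by simp
    ultimately show ?thesis using rows[of "rows (X i)"] by metis
  qed
  have "set (concat (map (\<lambda>i. rows (X i)) [0..<m])) \<subseteq> carrier_vec p"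
  proof -
    have "set (rows (X i)) \<subseteq> carrier_vec p" if "i < m" for i
      using rows_carrier[of "X i"] carrier_matD(2)[OF assms(1)[OF that]] by simp
    then show ?thesis by (simp add: UN_subset_iff)
  qed
  then have "list_of_vec (stack_mats m p X *\<^sub>v b) = concat (map (\<lambda>i. map (\<lambda>r. r \<bullet> b) (rows (X i))) [0..<m])"
    unfolding stack_mats_def by (simp add: rows map_concat o_def)
  also have "\<dots> = concat (map (\<lambda>i. list_of_vec (X i *\<^sub>v b)) [0..<m])"
    using Xi by (intro arg_cong[of _ _ concat]) simp
  finally show ?thesis unfolding stack_vecs_def by (metis vec_list)
qed

lemma stack_mats_carrier:
  assumes "\<And>i. i < m \<Longrightarrow> X i \<in> carrier_mat (n i) p"
  shows "stack_mats m p X \<in> carrier_mat (\<Sum>i<m. n i) p"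
proof -
  have "length (concat (map (\<lambda>i. rows (X i)) [0..<m])) = (\<Sum>i<m. n i)"
    using assms by (induction m) auto
  then show ?thesis unfolding stack_mats_def by (metis mat_of_rows_carrier(1))
qed

lemma block_diag_norm:
  fixes v :: "nat \<Rightarrow> real vec"
  assumes "\<And>i. i < m \<Longrightarrow> A i \<in> carrier_mat (n i) (k i)" "\<And>i. i < m \<Longrightarrow> v i \<in> carrier_vec (k i)"
  shows "(block_diag m A *\<^sub>v stack_vecs m v) \<bullet> (block_diag m A *\<^sub>v stack_vecs m v) = (\<Sum>i<m. (A i *\<^sub>v v i) \<bullet> (A i *\<^sub>v v i))"
proof -
  have "A i *\<^sub>v v i \<in> carrier_vec (n i)" if "i < m" for i using assms that by (meson mult_mat_vec_carrier)
  note Av = this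
  show ?thesis
    unfolding block_diag_mult_stack_vecs[of m A n k v, OF assms, simplified]
    by (rule scalar_prod_stack_vecs[of m _ n]) (rule Av, assumption)+
qed

lemma op_bounded_block_diag:
  assumes A: "\<And>i. i < m \<Longrightarrow> A i \<in> carrier_mat (n i) (k i)" and b: "\<And>i. i < m \<Longrightarrow> op_bounded (A i) c" and c: "0 \<le> c"
  shows "op_bounded (block_diag m A) c"
proof (rule op_boundedI[OF c])
  fix x :: "real vec" assume "x \<in> carrier_vec (dim_col (block_diag m A))"
  then have "x \<in> carrier_vec (\<Sum>i<m. k i)" using block_diag_carrier[of m A n k] A by simp
  then obtain v where v: "\<And>i. i < m \<Longrightarrow> v i \<in> carrier_vec (k i)" "x = stack_vecs m v"
    using stack_vecs_exists[of x k m] by blast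
  have e1: "(block_diag m A *\<^sub>v x) \<bullet> (block_diag m A *\<^sub>v x) = (\<Sum>i<m. (A i *\<^sub>v v i) \<bullet> (A i *\<^sub>v v i))"
    unfolding v(2) by (rule block_diag_norm[of m A n k]) (simp_all add: A v(1))
  have e2: "x \<bullet> x = (\<Sum>i<m. v i \<bullet> v i)"
    unfolding v(2) by (rule scalar_prod_stack_vecs[of m v k]) (simp_all add: v(1))
  show "(block_diag m A *\<^sub>v x) \<bullet> (block_diag m A *\<^sub>v x) \<le> c * (x \<bullet> x)"
    unfolding e1 e2 sum_distrib_left
  proof (rule sum_mono)
    fix i assume "i \<in> {..<m}"
    then have i: "i < m" by simp
    show "(A i *\<^sub>v v i) \<bullet> (A i *\<^sub>v v i) \<le> c * (v i \<bullet> v i)"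
      by (rule op_boundedD[OF b[OF i]]) (use A[OF i] v(1)[OF i] in simp)
  qed
qed

lemma block_diag_norm_ge:
  assumes A: "\<And>i. i < m \<Longrightarrow> A i \<in> carrier_mat (n i) (k i)"
    and b: "\<And>i x. i < m \<Longrightarrow> x \<in> carrier_vec (k i) \<Longrightarrow> c * (x \<bullet> x) \<le> (A i *\<^sub>v x) \<bullet> (A i *\<^sub>v x)"
    and x: "x \<in> carrier_vec (\<Sum>i<m. k i)"
  shows "c * (x \<bullet> x) \<le> (block_diag m A *\<^sub>v x) \<bullet> (block_diag m A *\<^sub>v x)"
proof -
  obtain v where v: "\<And>i. i < m \<Longrightarrow> v i \<in> carrier_vec (k i)" "x = stack_vecs m v"
    using stack_vecs_exists[OF x] by blast
  have e1: "(block_diag m A *\<^sub>v x) \<bullet> (block_diag m A *\<^sub>v x) = (\<Sum>i<m. (A i *\<^sub>v v i) \<bullet> (A i *\<^sub>v v i))"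
    unfolding v(2) by (rule block_diag_norm[of m A n k]) (simp_all add: A v(1))
  have e2: "x \<bullet> x = (\<Sum>i<m. v i \<bullet> v i)"
    unfolding v(2) by (rule scalar_prod_stack_vecs[of m v k]) (simp_all add: v(1))
  show ?thesis
    unfolding e1 e2 sum_distrib_left
    using b v(1) by (intro sum_mono) auto
qed

lemma fro_four_block_diag:
  assumes A: "A \<in> carrier_mat a b" and B: "B \<in> carrier_mat c d"
  shows "fro (four_block_mat A (0\<^sub>m a d) (0\<^sub>m c b) B) = fro A + fro B"
proof -
  have split: "(\<Sum>i<x + y. f i) = (\<Sum>i<x. f i) + (\<Sum>i<y. f (x + i))" for x y :: nat and f :: "nat \<Rightarrow> real"
    by (induction y) (simp_all add: add.assoc)
  show ?thesis
    using A B unfolding fro_def by (simp add: split)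
qed

lemma fro_block_diag:
  assumes "\<And>i. i < m \<Longrightarrow> A i \<in> carrier_mat (n i) (k i)"
  shows "fro (block_diag m A) = (\<Sum>i<m. fro (A i))"
  using assms
proof (induction m)
  case (Suc m)
  have B: "block_diag m A \<in> carrier_mat (\<Sum>i<m. n i) (\<Sum>i<m. k i)"
    using Suc.prems by (intro block_diag_carrier) auto
  have "fro (block_diag (Suc m) A) = fro (block_diag m A) + fro (A m)"
    unfolding block_diag_Suc using B Suc.prems[of m] fro_four_block_diag[OF B, of "A m" "n m" "k m"] by simp
  then show ?case using Suc by simp
qed (simp add: block_diag_def fro_def)

text \<open>Connects the Kronecker form of \<open>Psi\<close> with the blockwise lemmas: quotient
  and remainder by q are the block and the position inside the block.\<close>

lemma kron_one_eq_block_diag: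
  assumes P: "P \<in> carrier_mat q q"
  shows "kron (1\<^sub>m m) P = block_diag m (\<lambda>_. P)"
proof (induction m)
  case 0
  show ?case using P by (intro eq_matI) (auto simp: kron_def block_diag_def)
next
  case (Suc m)
  have B: "block_diag m (\<lambda>_. P) \<in> carrier_mat (m * q) (m * q)"
    using block_diag_carrier[of m "\<lambda>_. P" "\<lambda>_. q" "\<lambda>_. q"] P by simp
  show ?case
  proof (rule eq_matI)
    fix i j assume "i < dim_row (block_diag (Suc m) (\<lambda>_. P))" "j < dim_col (block_diag (Suc m) (\<lambda>_. P))"
    then have ij: "i < Suc m * q" "j < Suc m * q" using B P by (auto simp: block_diag_Suc)
    then have q: "0 < q" by (cases q) auto
    have div_lt: "l div q < Suc m" "l mod q < q" if "l < Suc m * q" for l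
      using that q by (auto simp: less_mult_imp_div_less)
    \<comment> \<open>Indices from m q on lie in the new last block.\<close>
    have hi: "l div q = m" "l mod q = l - m * q" if "l < Suc m * q" "\<not> l < m * q" for l
    proof -
      have l: "l = (l - m * q) + m * q" "l - m * q < q" using that by auto
      have "((l - m * q) + m * q) div q = (l - m * q) div q + m" "((l - m * q) + m * q) mod q = (l - m * q) mod q"
        using q by simp_all
      then show "l div q = m" "l mod q = l - m * q" using l by simp_all
    qed
    have lo: "l div q < m" if "l < m * q" for l using that by (rule less_mult_imp_div_less)
    have IH: "block_diag m (\<lambda>_. P) $$ (i, j) = 1\<^sub>m m $$ (i div q, j div q) * P $$ (i mod q, j mod q)"
      if "i < m * q" "j < m * q"
      using that P unfolding Suc.IH[symmetric] by (simp add: kron_def)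
    have "kron (1\<^sub>m (Suc m)) P $$ (i, j) = (if i div q = j div q then 1 else 0) * P $$ (i mod q, j mod q)"
      using ij P div_lt by (simp add: kron_def)
    also have "\<dots> = block_diag (Suc m) (\<lambda>_. P) $$ (i, j)"
      using ij B P IH lo[of i] lo[of j] hi[of i] hi[of j]
      by (cases "i < m * q"; cases "j < m * q") (auto simp: block_diag_Suc)
    finally show "kron (1\<^sub>m (Suc m)) P $$ (i, j) = block_diag (Suc m) (\<lambda>_. P) $$ (i, j)" .
  qed (use B P in \<open>auto simp: kron_def block_diag_Suc\<close>)
qed


section \<open>Quadratic forms in the model matrices\<close>

lemma orthogonal_norm:
  fixes Q :: "real mat"
  assumes Q: "Q \<in> carrier_mat n n" "Q * Q\<^sup>T = 1\<^sub>m n" and x: "x \<in> carrier_vec n"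
  shows "(\<Sum>k<n. ((Q\<^sup>T *\<^sub>v x) $ k)\<^sup>2) = x \<bullet> x"
proof -
  have "(\<Sum>k<n. ((Q\<^sup>T *\<^sub>v x) $ k)\<^sup>2) = (Q\<^sup>T *\<^sub>v x) \<bullet> (Q\<^sup>T *\<^sub>v x)"
    using Q by (simp add: scalar_prod_def power2_eq_square lessThan_atLeast0)
  also have "\<dots> = x \<bullet> x"
    using semi_orthogonal_norm[of "Q\<^sup>T" n n _ x] Q x by simp
  finally show ?thesis .
qed

text \<open>In the diagonalization of \<open>Z\<^sup>T * Z\<close> every diagonal entry belongs to
  the finite spectrum and so lies between its extremes. The eigenvalue assumption is used below only
  through these norm inequalities.\<close>

lemma gamma_bounds:
  fixes Z :: "real mat"
  assumes Z: "Z \<in> carrier_mat n q" and lo: "a \<le> gamma_min (Z\<^sup>T * Z)" and hi: "gamma_max (Z\<^sup>T * Z) \<le> b"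
    and x: "x \<in> carrier_vec q"
  shows "a * (x \<bullet> x) \<le> (Z *\<^sub>v x) \<bullet> (Z *\<^sub>v x)" "(Z *\<^sub>v x) \<bullet> (Z *\<^sub>v x) \<le> b * (x \<bullet> x)"
proof -
  let ?A = "Z\<^sup>T * Z"
  have A: "?A \<in> carrier_mat q q" "?A\<^sup>T = ?A" using Z by (auto simp: mat_assoc)
  obtain Q d where Q: "Q \<in> carrier_mat q q" "Q\<^sup>T * Q = 1\<^sub>m q" "Q * Q\<^sup>T = 1\<^sub>m q" "?A = Q * mat_diag q d * Q\<^sup>T"
    using spectral_decomposition[OF A] by blast
  have fin: "finite (spectrum ?A)" using card_finite_spectrum[OF A(1)] by simp
  have d: "a \<le> d k \<and> d k \<le> b" if k: "k < q" for k
  proof -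
    note ev = spectral_decomposition_eigenvalue[OF Q(1,2,4) k]
    have "col Q k \<noteq> 0\<^sub>v q"
    proof
      assume "col Q k = 0\<^sub>v q"
      then show False using ev(2) by simp
    qed
    moreover have "dim_row ?A = q" using A(1) by (rule carrier_matD(1))
    ultimately have "eigenvector ?A (col Q k) (d k)"
      unfolding eigenvector_def using ev by (simp only: simp_thms)
    then have "d k \<in> spectrum ?A" unfolding spectrum_def eigenvalue_def by blast
    then have "gamma_min ?A \<le> d k" "d k \<le> gamma_max ?A"
      using fin unfolding gamma_min_def gamma_max_def by (auto intro: Min_le Max_ge)
    then show ?thesis using lo hi by linarith
  qed
  have Zx: "Z *\<^sub>v x \<in> carrier_vec n" using Z x by (rule mult_mat_vec_carrier)
  have "(Z *\<^sub>v x) \<bullet> (Z *\<^sub>v x) = (Z\<^sup>T *\<^sub>v (Z *\<^sub>v x)) \<bullet> x"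
    by (rule scalar_prod_mult_mat_vec[OF Z Zx x])
  also have "\<dots> = x \<bullet> (Z\<^sup>T *\<^sub>v (Z *\<^sub>v x))"
    using Z x by (intro comm_scalar_prod[of _ q] carrier_vecI) auto
  also have "Z\<^sup>T *\<^sub>v (Z *\<^sub>v x) = ?A *\<^sub>v x" using Z x by (simp add: mat_assoc)
  also have "x \<bullet> (?A *\<^sub>v x) = (\<Sum>k<q. d k * ((Q\<^sup>T *\<^sub>v x) $ k)\<^sup>2)"
    by (rule diagonal_quadratic_form[OF Q(1,4) x])
  finally have e: "(Z *\<^sub>v x) \<bullet> (Z *\<^sub>v x) = (\<Sum>k<q. d k * ((Q\<^sup>T *\<^sub>v x) $ k)\<^sup>2)" .
  show "a * (x \<bullet> x) \<le> (Z *\<^sub>v x) \<bullet> (Z *\<^sub>v x)" "(Z *\<^sub>v x) \<bullet> (Z *\<^sub>v x) \<le> b * (x \<bullet> x)"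
    unfolding e orthogonal_norm[OF Q(1,3) x, symmetric] sum_distrib_left
    using d by (auto intro!: sum_mono mult_right_mono)
qed

lemma sandwich_index:
  fixes L G :: "real mat"
  assumes L: "L \<in> carrier_mat a n" and G: "G \<in> carrier_mat n n" and ij: "i < a" "j < a"
  shows "(L * G * L\<^sup>T) $$ (i, j) = (\<Sum>k<n. \<Sum>l<n. L $$ (i, k) * G $$ (k, l) * L $$ (j, l))"
proof -
  have "(L * G * L\<^sup>T) $$ (i, j) = (\<Sum>k<n. L $$ (i, k) * (\<Sum>l<n. G $$ (k, l) * L $$ (j, l)))"
    using L G ij by (simp add: scalar_prod_def lessThan_atLeast0)
  then show ?thesis by (simp add: sum_distrib_left mult.assoc)
qed

text \<open>Linear dependence on the parameter is stated entry by entry, so that it passes through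
  products as an identity of real sums.\<close>

lemma sandwich_linear:
  fixes L :: "real mat"
  assumes L: "L \<in> carrier_mat a n" and G: "G \<in> carrier_mat n n" "\<And>t. t \<in> T \<Longrightarrow> H t \<in> carrier_mat n n"
    and lin: "\<And>k l. k < n \<Longrightarrow> l < n \<Longrightarrow> G $$ (k, l) = (\<Sum>t\<in>T. u t * H t $$ (k, l))" and ij: "i < a" "j < a"
  shows "(L * G * L\<^sup>T) $$ (i, j) = (\<Sum>t\<in>T. u t * (L * H t * L\<^sup>T) $$ (i, j))"
proof -
  have "(L * G * L\<^sup>T) $$ (i, j) = (\<Sum>k<n. \<Sum>l<n. \<Sum>t\<in>T. L $$ (i, k) * (u t * H t $$ (k, l)) * L $$ (j, l))"
    unfolding sandwich_index[OF L G(1) ij]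
    by (intro sum.cong refl) (simp add: lin sum_distrib_left sum_distrib_right)
  also have "\<dots> = (\<Sum>k<n. \<Sum>t\<in>T. \<Sum>l<n. L $$ (i, k) * (u t * H t $$ (k, l)) * L $$ (j, l))"
    by (intro sum.cong refl sum.swap)
  also have "\<dots> = (\<Sum>t\<in>T. \<Sum>k<n. \<Sum>l<n. L $$ (i, k) * (u t * H t $$ (k, l)) * L $$ (j, l))"
    by (rule sum.swap)
  also have "\<dots> = (\<Sum>t\<in>T. u t * (L * H t * L\<^sup>T) $$ (i, j))"
    by (intro sum.cong refl) (simp add: sandwich_index[OF L G(2) ij] sum_distrib_left mult_ac)
  finally show ?thesis .
qed

text \<open>With a the larger and b the smaller index, the columns before column b of the lower
  triangle occupy b q - b (b - 1) / 2 places, and row a stands a - b places further.\<close>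

definition vech_index :: "nat \<Rightarrow> nat \<Rightarrow> nat \<Rightarrow> nat" where
  "vech_index q i j = min i j * q + max i j - min i j * (min i j + 1) div 2"

lemma Psi1_index: "i < q \<Longrightarrow> j < q \<Longrightarrow> Psi1 q v $$ (i, j) = v (vech_index q i j)"
  by (simp add: Psi1_def vech_index_def Let_def)

lemma Psi1_carrier: "Psi1 q v \<in> carrier_mat q q"
  by (simp add: Psi1_def)

lemma vech_index_less:
  assumes "i < q" "j < q"
  shows "vech_index q i j < npar q - 1"
proof -
  define a b where "a = max i j" and "b = min i j"
  have ab: "b \<le> a" "a < q" using assms by (auto simp: a_def b_def)
  define s t where "s = q * (q + 1) div 2" and "t = b * (b + 1) div 2"
  \<comment> \<open>Doubling removes the divisions; the strict inequality becomes one between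
    polynomials in b, k and l.\<close>
  have e: "2 * t = b * (b + 1)" "2 * s = q * (q + 1)"
    unfolding s_def t_def by (simp_all add: dvd_mult_div_cancel)
  obtain k where k: "q = a + 1 + k" using ab(2) by (metis add.commute add.left_commute less_imp_Suc_add Suc_eq_plus1 add_Suc_right)
  obtain l where l: "a = b + l" using ab(1) le_Suc_ex by blast
  have "2 * (b * q + a) < q * (q + 1) + b * (b + 1)"
    unfolding k l by (simp add: algebra_simps)
  then have "2 * (b * q + a) < 2 * s + 2 * t" by (simp only: e)
  moreover have "0 < 2 * s" unfolding e using ab by simp
  moreover have "w - t < s" if "2 * w < 2 * s + 2 * t" "0 < 2 * s" for w :: nat using that by arith
  ultimately have "b * q + a - t < s" by blast
  then show ?thesis
    unfolding vech_index_def npar_def a_def[symmetric] b_def[symmetric] by (simp add: s_def t_def)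
qed

text \<open>The index formula need not be inverted. For the parameter that is 1 at j only,
  \<open>vech_Psi1\<close> puts a 1 into the half-vectorization, so some lower-triangular entry
  equals 1, and its index can only be j.\<close>

lemma vech_index_surj:
  assumes "j < npar q - 1"
  obtains a b where "a < q" "b < q" "vech_index q a b = j"
proof -
  let ?\<psi> = "\<lambda>k. if k = j then 1 else 0 :: real"
  have "vech (Psi1 q ?\<psi>) $ j = 1" unfolding vech_Psi1 using assms by simp
  moreover have "j < dim_vec (vech (Psi1 q ?\<psi>))" unfolding vech_Psi1 using assms by simp
  ultimately have "1 \<in> set (list_of_vec (vech (Psi1 q ?\<psi>)))"
    by (metis length_list_of_vec list_of_vec_index nth_mem)
  then have "1 \<in> set (concat (map (\<lambda>j'. map (\<lambda>i. Psi1 q ?\<psi> $$ (i, j')) [j'..<q]) [0..<q]))"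
    unfolding vech_def list_vec using Psi1_carrier[of q ?\<psi>] by simp
  then obtain b a where ba: "Psi1 q ?\<psi> $$ (a, b) = 1" "b \<le> a" "a < q" by (auto simp: set_concat)
  then have ab: "a < q" "b < q" "Psi1 q ?\<psi> $$ (a, b) = 1" by simp_all
  show thesis using ab Psi1_index[OF ab(1,2), of ?\<psi>] by (intro that[OF ab(1,2)]) (simp split: if_splits)
qed

lemma fro_Psi1_le:
  assumes "\<And>k. \<bar>v k\<bar> \<le> b"
  shows "fro (Psi1 q v) \<le> (real q)\<^sup>2 * b\<^sup>2"
proof -
  have "(v k)\<^sup>2 \<le> b\<^sup>2" for k
    using assms[of k] by (intro abs_le_square_iff[THEN iffD1]) simp
  then have "fro (Psi1 q v) \<le> (\<Sum>i<q. \<Sum>j<q. b\<^sup>2)"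
    unfolding fro_def using Psi1_carrier[of q v] by (simp add: Psi1_index sum_mono del: sum_constant)
  then show ?thesis by (simp add: power2_eq_square)
qed

text \<open>Every covariance parameter is an entry of the matrix, so its square is at most the whole
  squared norm. The crude factor counts parameters and is constant because q is fixed.\<close>

lemma fro_Psi1_ge: "(\<Sum>j<npar q - 1. (v j)\<^sup>2) \<le> real (npar q - 1) * fro (Psi1 q v)"
proof -
  have "(v j)\<^sup>2 \<le> fro (Psi1 q v)" if j: "j < npar q - 1" for j
  proof -
    obtain a b where ab: "a < q" "b < q" "vech_index q a b = j" using vech_index_surj[OF j] .
    then show ?thesis using fro_entry_le[of a "Psi1 q v" b] Psi1_carrier[of q v] by (simp add: Psi1_index)
  qed
  then have "(\<Sum>j<npar q - 1. (v j)\<^sup>2) \<le> (\<Sum>j<npar q - 1. fro (Psi1 q v))" by (intro sum_mono) simp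
  then show ?thesis by simp
qed

lemma Psi_block_diag: "Psi m q v = block_diag m (\<lambda>_. Psi1 q v)"
  unfolding Psi_def by (rule kron_one_eq_block_diag[OF Psi1_carrier])

lemma Psi_carrier: "Psi m q v \<in> carrier_mat (m * q) (m * q)"
  using Psi1_carrier[of q v] by (auto simp: Psi_def kron_def intro!: carrier_matI)

lemma Psi_index:
  assumes "a < m * q" "b < m * q"
  shows "Psi m q v $$ (a, b) = (if a div q = b div q then v (vech_index q (a mod q) (b mod q)) else 0)"
proof -
  have q: "0 < q" using assms by (cases q) auto
  have "a div q < m" "b div q < m" using assms by (auto intro: less_mult_imp_div_less)
  then show ?thesis
    using assms q Psi1_carrier[of q v] by (simp add: Psi_def kron_def Psi1_index)
qed

lemma vech_index_commute: "vech_index q i j = vech_index q j i"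
  by (simp add: vech_index_def max.commute min.commute)

lemma Psi_sym: "(Psi m q v)\<^sup>T = Psi m q v"
  using Psi_carrier[of m q v] by (intro eq_matI) (auto simp: Psi_index vech_index_commute)

lemma op_bounded_Psi:
  assumes "\<And>k. \<bar>v k\<bar> \<le> b"
  shows "op_bounded (Psi m q v) ((real q)\<^sup>2 * b\<^sup>2)"
  unfolding Psi_block_diag
  by (rule op_bounded_block_diag[of m _ "\<lambda>_. q" "\<lambda>_. q"])
     (auto intro: op_bounded_mono[OF op_bounded_fro fro_Psi1_le[OF assms]] Psi1_carrier)

lemma fro_Psi: "fro (Psi m q v) = real m * fro (Psi1 q v)"
  unfolding Psi_block_diag using fro_block_diag[of m "\<lambda>_. Psi1 q v" "\<lambda>_. q" "\<lambda>_. q"] Psi1_carrier by simp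

abbreviation basis_fun :: "nat \<Rightarrow> nat \<Rightarrow> real" where
  "basis_fun j \<equiv> (\<lambda>k. if k = j then 1 else 0)"

text \<open>An entry of \<open>Psi\<close> is a single coordinate of the parameter or 0, so its
  derivative does not depend on \<psi> and equals the same entry at a basis vector.\<close>

lemma H_mat_eq_Psi: "H_mat m q j \<psi> = Psi m q (basis_fun j)"
proof (rule eq_matI)
  fix a b assume "a < dim_row (Psi m q (basis_fun j))" "b < dim_col (Psi m q (basis_fun j))"
  then have ab: "a < m * q" "b < m * q" using Psi_carrier[of m q "basis_fun j"] by auto
  let ?i = "vech_index q (a mod q) (b mod q)"
  have "(\<lambda>t. Psi m q (\<psi>(j := t)) $$ (a, b)) =
      (\<lambda>t. if a div q = b div q then if ?i = j then t else \<psi> ?i else 0)"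
    using ab by (auto simp: Psi_index)
  moreover have "deriv (\<lambda>t. if a div q = b div q then if ?i = j then t else \<psi> ?i else 0) (\<psi> j)
      = (if a div q = b div q then basis_fun j ?i else 0)"
    by (cases "a div q = b div q"; cases "?i = j") simp_all
  ultimately show "H_mat m q j \<psi> $$ (a, b) = Psi m q (basis_fun j) $$ (a, b)"
    using ab by (simp add: H_mat_def Psi_index)
qed (use Psi_carrier[of m q "basis_fun j"] in \<open>auto simp: H_mat_def\<close>)

lemma Psi_linear:
  assumes "a < m * q" "b < m * q"
  shows "Psi m q u $$ (a, b) = (\<Sum>j<npar q. u j * Psi m q (basis_fun j) $$ (a, b))"
proof -
  have q: "0 < q" using assms by (cases q) auto
  let ?i = "vech_index q (a mod q) (b mod q)"
  have "?i < npar q" using vech_index_less[of "a mod q" q "b mod q"] q by (simp add: npar_def)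
  then have "(\<Sum>j<npar q. u j * basis_fun j ?i) = u ?i"
    by (simp add: if_distrib[of "\<lambda>x. _ * x"] cong: if_cong)
  then show ?thesis using assms by (simp add: Psi_index)
qed


lemma trace_linear:
  assumes G: "G \<in> carrier_mat n n" "\<And>t. t \<in> T \<Longrightarrow> H t \<in> carrier_mat n n"
    and lin: "\<And>k l. k < n \<Longrightarrow> l < n \<Longrightarrow> G $$ (k, l) = (\<Sum>t\<in>T. u t * H t $$ (k, l))"
  shows "trace G = (\<Sum>t\<in>T. u t * trace (H t))"
proof -
  have "trace G = (\<Sum>i<n. \<Sum>t\<in>T. u t * H t $$ (i, i))" using G(1) lin by (simp add: trace_def)
  also have "\<dots> = (\<Sum>t\<in>T. \<Sum>i<n. u t * H t $$ (i, i))" by (rule sum.swap)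
  also have "\<dots> = (\<Sum>t\<in>T. u t * trace (H t))"
    by (intro sum.cong refl) (simp add: trace_def carrier_matD(1)[OF G(2)] sum_distrib_left)
  finally show ?thesis .
qed

lemma trace_mult_bilinear:
  assumes G: "G \<in> carrier_mat n n" "\<And>t. t \<in> T \<Longrightarrow> H t \<in> carrier_mat n n"
    and lin: "\<And>k l. k < n \<Longrightarrow> l < n \<Longrightarrow> G $$ (k, l) = (\<Sum>t\<in>T. u t * H t $$ (k, l))"
  shows "trace (G * G) = (\<Sum>s\<in>T. \<Sum>t\<in>T. u s * u t * trace (H s * H t))"
proof -
  have "trace (G * G) = (\<Sum>i<n. \<Sum>j<n. \<Sum>s\<in>T. \<Sum>t\<in>T. (u s * H s $$ (i, j)) * (u t * H t $$ (j, i)))"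
    unfolding trace_mult[OF G(1) G(1)] by (intro sum.cong refl) (simp add: lin sum_product)
  also have "\<dots> = (\<Sum>i<n. \<Sum>s\<in>T. \<Sum>j<n. \<Sum>t\<in>T. (u s * H s $$ (i, j)) * (u t * H t $$ (j, i)))"
    by (rule sum.cong[OF refl], rule sum.swap)
  also have "\<dots> = (\<Sum>i<n. \<Sum>s\<in>T. \<Sum>t\<in>T. \<Sum>j<n. (u s * H s $$ (i, j)) * (u t * H t $$ (j, i)))"
    by (rule sum.cong[OF refl], rule sum.cong[OF refl], rule sum.swap)
  also have "\<dots> = (\<Sum>s\<in>T. \<Sum>i<n. \<Sum>t\<in>T. \<Sum>j<n. (u s * H s $$ (i, j)) * (u t * H t $$ (j, i)))"
    by (rule sum.swap)
  also have "\<dots> = (\<Sum>s\<in>T. \<Sum>t\<in>T. \<Sum>i<n. \<Sum>j<n. (u s * H s $$ (i, j)) * (u t * H t $$ (j, i)))"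
    by (rule sum.cong[OF refl], rule sum.swap)
  also have "\<dots> = (\<Sum>s\<in>T. \<Sum>t\<in>T. u s * u t * trace (H s * H t))"
    by (intro sum.cong refl) (simp add: trace_mult[OF G(2) G(2)] sum_distrib_left mult_ac)
  finally show ?thesis .
qed

lemma quadratic_form_linear:
  fixes x :: "real vec"
  assumes G: "G \<in> carrier_mat n n" "\<And>t. t \<in> T \<Longrightarrow> H t \<in> carrier_mat n n" and x: "x \<in> carrier_vec n"
    and lin: "\<And>k l. k < n \<Longrightarrow> l < n \<Longrightarrow> G $$ (k, l) = (\<Sum>t\<in>T. u t * H t $$ (k, l))"
  shows "x \<bullet> (G *\<^sub>v x) = (\<Sum>t\<in>T. u t * (x \<bullet> (H t *\<^sub>v x)))"
proof -
  have qf: "x \<bullet> (A *\<^sub>v x) = (\<Sum>i<n. \<Sum>j<n. x $ i * A $$ (i, j) * x $ j)" if "A \<in> carrier_mat n n" for A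
    using that x by (simp add: scalar_prod_def lessThan_atLeast0 sum_distrib_left mult.assoc)
  have "x \<bullet> (G *\<^sub>v x) = (\<Sum>i<n. \<Sum>j<n. \<Sum>t\<in>T. x $ i * (u t * H t $$ (i, j)) * x $ j)"
    unfolding qf[OF G(1)] by (intro sum.cong refl) (simp add: lin sum_distrib_left sum_distrib_right)
  also have "\<dots> = (\<Sum>i<n. \<Sum>t\<in>T. \<Sum>j<n. x $ i * (u t * H t $$ (i, j)) * x $ j)"
    by (intro sum.cong refl sum.swap)
  also have "\<dots> = (\<Sum>t\<in>T. \<Sum>i<n. \<Sum>j<n. x $ i * (u t * H t $$ (i, j)) * x $ j)"
    by (rule sum.swap)
  also have "\<dots> = (\<Sum>t\<in>T. u t * (x \<bullet> (H t *\<^sub>v x)))"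
    by (intro sum.cong refl) (simp add: qf[OF G(2)] sum_distrib_left mult_ac)
  finally show ?thesis .
qed

lemma fro_add_smult_one:
  assumes F: "F \<in> carrier_mat n n"
  shows "fro (F + t \<cdot>\<^sub>m 1\<^sub>m n) = fro F + 2 * t * trace F + real n * t\<^sup>2"
proof -
  have "(\<Sum>j<n. (F $$ (i, j) + (if i = j then t else 0))\<^sup>2) = (\<Sum>j<n. (F $$ (i, j))\<^sup>2) + (2 * t * F $$ (i, i) + t\<^sup>2)"
    if "i < n" for i
  proof -
    have "(\<Sum>j<n. (F $$ (i, j) + (if i = j then t else 0))\<^sup>2) =
        (\<Sum>j<n. (F $$ (i, j))\<^sup>2 + (if i = j then 2 * t * F $$ (i, i) + t\<^sup>2 else 0))"
      by (intro sum.cong refl) (auto simp: power2_eq_square algebra_simps)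
    then show ?thesis using that by (simp add: sum.distrib)
  qed
  then have "(\<Sum>i<n. \<Sum>j<n. (F $$ (i, j) + (if i = j then t else 0))\<^sup>2)
      = (\<Sum>i<n. (\<Sum>j<n. (F $$ (i, j))\<^sup>2) + (2 * t * F $$ (i, i) + t\<^sup>2))"
    by (intro sum.cong) auto
  moreover have "fro (F + t \<cdot>\<^sub>m 1\<^sub>m n) = (\<Sum>i<n. \<Sum>j<n. (F $$ (i, j) + (if i = j then t else 0))\<^sup>2)"
    using F by (auto simp: fro_def intro!: sum.cong)
  ultimately show ?thesis
    using F by (simp add: fro_def trace_def sum.distrib sum_distrib_left)
qed

lemma quadratic_form_Psi_nonneg:
  assumes psd: "psd (Psi1 q v)" and w: "w \<in> carrier_vec (m * q)"
  shows "0 \<le> w \<bullet> (Psi m q v *\<^sub>v w)"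
proof -
  have "w \<in> carrier_vec (\<Sum>i<m. q)" using w by simp
  then obtain f where f: "\<And>i. i < m \<Longrightarrow> f i \<in> carrier_vec q" "w = stack_vecs m f"
    using stack_vecs_exists[of w "\<lambda>_. q" m] by blast
  have P: "Psi1 q v *\<^sub>v f i \<in> carrier_vec q" if "i < m" for i
    using Psi1_carrier f(1)[OF that] by (rule mult_mat_vec_carrier)
  have "Psi m q v *\<^sub>v w = stack_vecs m (\<lambda>i. Psi1 q v *\<^sub>v f i)"
    unfolding Psi_block_diag f(2)
    by (rule block_diag_mult_stack_vecs[of m _ "\<lambda>_. q" "\<lambda>_. q"]) (simp_all add: f(1) Psi1_carrier)
  then have "w \<bullet> (Psi m q v *\<^sub>v w) = (\<Sum>i<m. f i \<bullet> (Psi1 q v *\<^sub>v f i))"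
    unfolding f(2) using scalar_prod_stack_vecs[of m f "\<lambda>_. q" "\<lambda>i. Psi1 q v *\<^sub>v f i"] f(1) P by simp
  also have "0 \<le> \<dots>"
    using psd f(1) Psi1_carrier[of q v] unfolding psd_def by (intro sum_nonneg) auto
  finally show ?thesis .
qed

section \<open>Bounds for a fixed design, uniform in the number of clusters\<close>

locale cluster_design =
  fixes m q N d :: nat and Z V :: "real mat" and c :: real
  assumes q_pos: "1 \<le> q" and c_ge: "1 \<le> c"
    and Z_carrier: "Z \<in> carrier_mat N (m * q)"
    and Z_upper: "op_bounded Z c"
    and Z_lower: "\<And>x. x \<in> carrier_vec (m * q) \<Longrightarrow> inverse c * (x \<bullet> x) \<le> (Z *\<^sub>v x) \<bullet> (Z *\<^sub>v x)"
    and V_carrier: "V \<in> carrier_mat N d" and V_orth: "V\<^sup>T * V = 1\<^sub>m d"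
begin

abbreviation Sig :: "(nat \<Rightarrow> real) \<Rightarrow> real mat" where
  "Sig \<equiv> Sigma_mat m q Z"

text \<open>\<open>\<kappa>\<close> b^2 bounds the squared operator norm of \<open>Sig v\<close>
  when the coordinates are at most b. The factors c, q^2 and c come from Z, \<open>Psi\<close> and
  \<open>Z\<^sup>T\<close>, the last summand from the error variance.\<close>

definition \<kappa> :: real where
  "\<kappa> = 2 * (c * (real q)\<^sup>2 * c) + 2"

lemma \<kappa>_pos: "0 < \<kappa>"
  unfolding \<kappa>_def using c_ge by (intro add_nonneg_pos) auto

lemma ZPZ_carrier: "Z * Psi m q v * Z\<^sup>T \<in> carrier_mat N N"
  using Z_carrier Psi_carrier[of m q v] by (intro carrier_matI) simp_all

lemma ZPZ_sym: "(Z * Psi m q v * Z\<^sup>T)\<^sup>T = Z * Psi m q v * Z\<^sup>T"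
  using Z_carrier Psi_carrier[of m q v] by (simp add: mat_assoc Psi_sym)

lemma Sig_eq: "Sig v = Z * Psi m q v * Z\<^sup>T + psi_last q v \<cdot>\<^sub>m 1\<^sub>m N"
  using Z_carrier by (simp add: Sigma_mat_def)

lemma Sig_carrier: "Sig v \<in> carrier_mat N N"
  unfolding Sig_eq using ZPZ_carrier[of v] by (intro carrier_matI) simp_all

lemma Sig_sym: "(Sig v)\<^sup>T = Sig v"
  unfolding Sig_eq
  by (subst transpose_add[OF ZPZ_carrier]) (auto simp: ZPZ_sym intro!: eq_matI)

lemma Sig_linear:
  assumes kl: "k < N" "l < N"
  shows "Sig u $$ (k, l) = (\<Sum>j<npar q. u j * Sig (basis_fun j) $$ (k, l))"
proof -
  have ix: "Sig v $$ (k, l) = (Z * Psi m q v * Z\<^sup>T) $$ (k, l) + psi_last q v * (if k = l then 1 else 0)" for v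
    unfolding Sig_eq using ZPZ_carrier[of v] kl by simp
  have "(Z * Psi m q u * Z\<^sup>T) $$ (k, l) = (\<Sum>j\<in>{..<npar q}. u j * (Z * Psi m q (basis_fun j) * Z\<^sup>T) $$ (k, l))"
    by (rule sandwich_linear[OF Z_carrier Psi_carrier Psi_carrier Psi_linear kl])
  moreover have "psi_last q u = (\<Sum>j<npar q. u j * psi_last q (basis_fun j))"
    by (simp add: psi_last_def npar_def if_distrib[of "\<lambda>x. _ * x"] cong: if_cong)
  ultimately show ?thesis
    unfolding ix by (simp add: distrib_left sum.distrib sum_distrib_right mult.assoc)
qed

lemma op_bounded_Sig:
  assumes v: "\<And>k. \<bar>v k\<bar> \<le> b"
  shows "op_bounded (Sig v) (\<kappa> * b\<^sup>2)"
proof -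
  have "op_bounded (Z * Psi m q v) (c * ((real q)\<^sup>2 * b\<^sup>2))"
    using Z_upper op_bounded_Psi[OF v] by (rule op_bounded_mult) (use Z_carrier Psi_carrier[of m q v] in simp)
  then have "op_bounded (Z * Psi m q v * Z\<^sup>T) (c * ((real q)\<^sup>2 * b\<^sup>2) * c)"
    by (rule op_bounded_mult[OF _ op_bounded_transpose[OF Z_upper]]) (use Z_carrier Psi_carrier[of m q v] in simp)
  then have "op_bounded (Sig v) (2 * (c * ((real q)\<^sup>2 * b\<^sup>2) * c) + 2 * (psi_last q v)\<^sup>2)"
    unfolding Sig_eq by (rule op_bounded_add[OF _ op_bounded_smult_one ZPZ_carrier]) simp
  moreover have "(psi_last q v)\<^sup>2 \<le> b\<^sup>2"
    unfolding psi_last_def using v[of "npar q - 1"] by (intro abs_le_square_iff[THEN iffD1]) simp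
  ultimately show ?thesis
    by (elim op_bounded_mono) (simp add: \<kappa>_def algebra_simps)
qed

text \<open>The matrix F has its range in the column space of Z, of dimension m q. If P projects
  onto that space, then tr F = tr (P F), and Cauchy-Schwarz brings in the squared norm m q of P.
  With N in place of m q there would be no margin against the error term in
  \<open>fro_Sig_ge\<close>.\<close>

lemma trace_ZPZ_le: "(trace (Z * Psi m q v * Z\<^sup>T))\<^sup>2 \<le> real (m * q) * fro (Z * Psi m q v * Z\<^sup>T)"
proof -
  let ?F = "Z * Psi m q v * Z\<^sup>T"
  have S: "Z\<^sup>T * Z \<in> carrier_mat (m * q) (m * q)" "(Z\<^sup>T * Z)\<^sup>T = Z\<^sup>T * Z"
    using Z_carrier by (auto simp: mat_assoc)
  have pos: "0 < x \<bullet> ((Z\<^sup>T * Z) *\<^sub>v x)" if x: "x \<in> carrier_vec (m * q)" "x \<noteq> 0\<^sub>v (m * q)" for x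
  proof -
    have "0 < x \<bullet> x" using conjugate_square_greater_0_vec[OF x(1)] x(2) by simp
    then have "0 < inverse c * (x \<bullet> x)" using c_ge by simp
    also have "\<dots> \<le> (Z *\<^sub>v x) \<bullet> (Z *\<^sub>v x)" by (rule Z_lower[OF x(1)])
    also have "\<dots> = (Z\<^sup>T *\<^sub>v (Z *\<^sub>v x)) \<bullet> x"
      by (rule scalar_prod_mult_mat_vec[OF Z_carrier _ x(1)]) (use Z_carrier x in \<open>auto intro: mult_mat_vec_carrier\<close>)
    also have "\<dots> = x \<bullet> (Z\<^sup>T *\<^sub>v (Z *\<^sub>v x))"
      using Z_carrier x by (intro comm_scalar_prod[of _ "m * q"] carrier_vecI) auto
    also have "Z\<^sup>T *\<^sub>v (Z *\<^sub>v x) = (Z\<^sup>T * Z) *\<^sub>v x" using Z_carrier x by (simp add: mat_assoc)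
    finally show ?thesis .
  qed
  obtain L K where LK: "L \<in> carrier_mat (m * q) (m * q)" "K \<in> carrier_mat (m * q) (m * q)" "L\<^sup>T = L" "K\<^sup>T = K"
    "L * L = Z\<^sup>T * Z" "L * K = 1\<^sub>m (m * q)" "K * L = 1\<^sub>m (m * q)"
    by (rule pos_def_sqrt[OF S pos])
  \<comment> \<open>K is the inverse root of \<open>Z\<^sup>T * Z\<close>, so the columns of W are
    orthonormal and \<open>W * W\<^sup>T\<close> is the projection onto the column space of
    Z.\<close>
  define W where "W = Z * K"
  have W: "W \<in> carrier_mat N (m * q)" unfolding W_def using Z_carrier LK(2) by (rule mult_carrier_mat)
  have "W\<^sup>T * W = K * ((Z\<^sup>T * Z) * K)"
    unfolding W_def using Z_carrier LK(2) by (simp add: mat_assoc LK(4))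
  also have "\<dots> = (K * L) * (L * K)"
    unfolding LK(5)[symmetric] using LK(1,2) by (simp add: mat_assoc)
  finally have WW: "W\<^sup>T * W = 1\<^sub>m (m * q)" unfolding LK(6,7) by simp
  have "W * W\<^sup>T * Z = Z * (K * (K * (Z\<^sup>T * Z)))"
    unfolding W_def using Z_carrier LK(2) by (simp add: mat_assoc LK(4))
  also have "K * (K * (Z\<^sup>T * Z)) = K * ((K * L) * L)"
    unfolding LK(5)[symmetric] using LK(1,2) by (simp add: mat_assoc)
  also have "\<dots> = 1\<^sub>m (m * q)" using LK by simp
  finally have WZ: "W * W\<^sup>T * Z = Z" using Z_carrier by simp
  have WF: "(W * W\<^sup>T) * ?F = ?F"
  proof -
    have "(W * W\<^sup>T) * ?F = (W * W\<^sup>T * Z) * Psi m q v * Z\<^sup>T"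
      using W Z_carrier Psi_carrier[of m q v] by (simp add: mat_assoc)
    then show ?thesis unfolding WZ .
  qed
  have Wc: "W * W\<^sup>T \<in> carrier_mat N N" using W by (intro carrier_matI) simp_all
  have "fro (W * W\<^sup>T) = trace ((W * W\<^sup>T) * (W * W\<^sup>T))"
    by (rule fro_symmetric) (use W in \<open>simp add: mat_assoc\<close>)
  also have "(W * W\<^sup>T) * (W * W\<^sup>T) = W * ((W\<^sup>T * W) * W\<^sup>T)" using W by (simp add: mat_assoc)
  also have "\<dots> = W * W\<^sup>T" unfolding WW using W by simp
  also have "trace (W * W\<^sup>T) = trace (W\<^sup>T * W)" by (rule trace_comm) (use W in simp_all)
  finally have "fro (W * W\<^sup>T) = real (m * q)" unfolding WW trace_one .
  then show ?thesis using trace_mult_le[OF Wc ZPZ_carrier[of v]] unfolding WF by simp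
qed

text \<open>The lower bound for Z is applied on the left of \<open>Psi\<close> and, after a
  transposition, on the right, at the price of a factor inverse c each time. The m equal blocks of
  \<open>Psi\<close> are the source of the linear growth of the information.\<close>

lemma fro_ZPZ_ge: "(inverse c)\<^sup>2 * (real m * fro (Psi1 q v)) \<le> fro (Z * Psi m q v * Z\<^sup>T)"
proof -
  have i: "0 \<le> inverse c" using c_ge by simp
  have "inverse c * fro (Psi m q v) \<le> fro (Z * Psi m q v)"
    by (rule fro_mult_ge) (use Z_lower Z_carrier Psi_carrier[of m q v] in auto)
  also have "fro (Z * Psi m q v) = fro (Psi m q v * Z\<^sup>T)"
    using fro_transpose[of "Z * Psi m q v"] Z_carrier Psi_carrier[of m q v] by (simp add: mat_assoc Psi_sym)
  finally have "inverse c * (inverse c * fro (Psi m q v)) \<le> inverse c * fro (Psi m q v * Z\<^sup>T)"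
    using i by (rule mult_left_mono)
  also have "\<dots> \<le> fro (Z * (Psi m q v * Z\<^sup>T))"
    by (rule fro_mult_ge) (use Z_lower Z_carrier Psi_carrier[of m q v] in auto)
  also have "Z * (Psi m q v * Z\<^sup>T) = Z * Psi m q v * Z\<^sup>T"
    using Z_carrier Psi_carrier[of m q v] by (simp add: mat_assoc)
  finally show ?thesis by (simp add: fro_Psi power2_eq_square mult.assoc)
qed

text \<open>The random effects and the error variance are separately identified because each cluster has on
  average more than \<open>q\<close> observations; \<open>\<epsilon>\<close> measures the excess.\<close>

lemma fro_Sig_ge:
  assumes \<epsilon>: "0 < \<epsilon>" "(1 + \<epsilon>) * real (m * q) \<le> real N"
  shows "(min 1 \<epsilon> / 4) * ((inverse c)\<^sup>2 / real (npar q)) * real m * (\<Sum>j<npar q. (v j)\<^sup>2) \<le> fro (Sig v)"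
proof -
  let ?F = "Z * Psi m q v * Z\<^sup>T"
  define t where "t = psi_last q v"
  \<comment> \<open>With x the norm of the random-effects part and y = |t| sqrt (m q), the expansion
    of \<open>fro (Sig v)\<close> is at least x^2 - 2 x y + (1 + \<epsilon>) y^2, a form that is
    positive definite exactly because \<epsilon> > 0.\<close>
  define x where "x = sqrt (fro ?F)"
  define y where "y = \<bar>t\<bar> * sqrt (real (m * q))"
  define e where "e = min 1 \<epsilon>"
  have e: "0 < e" "e \<le> 1" "e \<le> \<epsilon>" using \<epsilon> by (auto simp: e_def)
  have x2: "x\<^sup>2 = fro ?F" using fro_nonneg by (simp add: x_def)
  have y2: "y\<^sup>2 = real (m * q) * t\<^sup>2" by (simp add: y_def power_mult_distrib)
  have "\<bar>trace ?F\<bar> \<le> sqrt (real (m * q)) * x"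
    using real_sqrt_le_mono[OF trace_ZPZ_le[of v]] by (simp add: x_def real_sqrt_mult)
  then have "\<bar>t\<bar> * \<bar>trace ?F\<bar> \<le> \<bar>t\<bar> * (sqrt (real (m * q)) * x)" by (intro mult_left_mono) auto
  then have "\<bar>t * trace ?F\<bar> \<le> x * y" by (simp add: y_def abs_mult mult_ac)
  then have tr: "- (2 * x * y) \<le> 2 * t * trace ?F" by (simp only: mult.assoc abs_le_iff) linarith
  have "(1 + \<epsilon>) * y\<^sup>2 \<le> real N * t\<^sup>2"
    unfolding y2 using mult_right_mono[OF \<epsilon>(2), of "t\<^sup>2"] by (simp add: mult.assoc)
  then have "x\<^sup>2 - 2 * x * y + (1 + \<epsilon>) * y\<^sup>2 \<le> fro (Sig v)"
    unfolding Sig_eq fro_add_smult_one[OF ZPZ_carrier] x2[symmetric] t_def[symmetric] using tr by linarith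
  \<comment> \<open>The difference of the two sides is written through the squares of x - y and x -
    2 y; the weight 1 - e/2 of the first is nonnegative because e is at most 1.\<close>
  moreover have "(e / 4) * (x\<^sup>2 + y\<^sup>2) \<le> x\<^sup>2 - 2 * x * y + (1 + \<epsilon>) * y\<^sup>2"
  proof -
    have "0 \<le> (1 - e / 2) * (x - y)\<^sup>2" using e by simp
    moreover have "0 \<le> (e / 4) * (x - 2 * y)\<^sup>2" using e by simp
    moreover have "e * y\<^sup>2 \<le> \<epsilon> * y\<^sup>2" using e by (intro mult_right_mono) auto
    moreover have "0 \<le> e * y\<^sup>2" using e by simp
    moreover have "(1 - e / 2) * (x - y)\<^sup>2 + (e / 4) * (x - 2 * y)\<^sup>2 =
        x\<^sup>2 - 2 * (x * y) + y\<^sup>2 - (e / 4) * x\<^sup>2 + (e / 2) * y\<^sup>2"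
      by (simp add: power2_eq_square field_simps)
    ultimately show ?thesis by (simp add: algebra_simps)
  qed
  \<comment> \<open>x^2 controls the entries of Psi_1 by \<open>fro_Psi1_ge\<close>, and y^2
    controls the error variance; the common factor is at most m, so it also serves the
    latter.\<close>
  moreover have "((inverse c)\<^sup>2 / real (npar q)) * real m * (\<Sum>j<npar q. (v j)\<^sup>2) \<le> x\<^sup>2 + y\<^sup>2"
  proof -
    let ?r = "real (npar q)"
    have r: "1 \<le> ?r" and Suc: "npar q = Suc (npar q - 1)" by (simp_all add: npar_def)
    have ic: "(inverse c)\<^sup>2 \<le> 1" "0 \<le> (inverse c)\<^sup>2"
      using c_ge by (auto simp: power_le_one inverse_le_1_iff)
    have "(\<Sum>j<npar q - 1. (v j)\<^sup>2) \<le> ?r * fro (Psi1 q v)"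
      using fro_Psi1_ge[of v q] by (rule order_trans) (intro mult_right_mono fro_nonneg, simp)
    then have "((inverse c)\<^sup>2 / ?r * real m) * (\<Sum>j<npar q - 1. (v j)\<^sup>2) \<le> ((inverse c)\<^sup>2 / ?r * real m) * (?r * fro (Psi1 q v))"
      using ic r by (intro mult_left_mono) auto
    also have "\<dots> = (inverse c)\<^sup>2 * (real m * fro (Psi1 q v))" using r by simp
    also have "\<dots> \<le> x\<^sup>2" unfolding x2 by (rule fro_ZPZ_ge)
    finally have 1: "((inverse c)\<^sup>2 / ?r * real m) * (\<Sum>j<npar q - 1. (v j)\<^sup>2) \<le> x\<^sup>2" .
    have "(inverse c)\<^sup>2 / ?r \<le> 1" using ic r by (simp add: divide_le_eq)
    then have "(inverse c)\<^sup>2 / ?r * real m \<le> 1 * real m" by (intro mult_right_mono) auto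
    also have "\<dots> \<le> real (m * q)" using q_pos mult_left_mono[of 1 "real q" "real m"] by simp
    finally have 2: "((inverse c)\<^sup>2 / ?r * real m) * t\<^sup>2 \<le> y\<^sup>2" unfolding y2 by (rule mult_right_mono) simp
    have "(\<Sum>j<npar q. (v j)\<^sup>2) = (\<Sum>j<npar q - 1. (v j)\<^sup>2) + t\<^sup>2"
      by (subst Suc) (simp add: t_def psi_last_def)
    then show ?thesis using 1 2 by (simp add: distrib_left)
  qed
  then have "(e / 4) * (((inverse c)\<^sup>2 / real (npar q)) * real m * (\<Sum>j<npar q. (v j)\<^sup>2)) \<le> (e / 4) * (x\<^sup>2 + y\<^sup>2)"
    using e by (intro mult_left_mono) auto
  ultimately have "(e / 4) * (((inverse c)\<^sup>2 / real (npar q)) * real m * (\<Sum>j<npar q. (v j)\<^sup>2)) \<le> fro (Sig v)"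
    by linarith
  then show ?thesis unfolding e_def by (simp only: mult.assoc)
qed

end


section \<open>A fixed parameter: standardized covariance and information\<close>

locale cluster_param = cluster_design +
  fixes \<psi> :: "nat \<Rightarrow> real" and a b :: real
  assumes psd_Psi1: "psd (Psi1 q \<psi>)" and a_pos: "0 < a" and a_le: "a \<le> psi_last q \<psi>"
    and b_ge: "\<And>k. \<bar>\<psi> k\<bar> \<le> b"
begin

abbreviation S :: "real mat" where "S \<equiv> Sigma_res m q Z V \<psi>"
abbreviation K :: "real mat" where "K \<equiv> mat_inv_sqrt S"

lemma b_pos: "0 < b"
  using a_pos a_le b_ge[of "npar q - 1"] unfolding psi_last_def by linarith

lemma V_semi: "op_bounded V 1" "op_bounded (V\<^sup>T) 1"
  using op_bounded_semi_orthogonal[OF V_carrier V_orth refl] by simp_all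

lemma S_carrier: "S \<in> carrier_mat d d"
  unfolding Sigma_res_def using V_carrier Sig_carrier[of \<psi>] by (intro carrier_matI) simp_all

lemma S_sym: "S\<^sup>T = S"
  unfolding Sigma_res_def using V_carrier Sig_carrier[of \<psi>] by (simp add: mat_assoc Sig_sym)

lemma Sig_quadratic_eq:
  assumes y: "y \<in> carrier_vec N"
  shows "y \<bullet> (Sig \<psi> *\<^sub>v y) = (Z\<^sup>T *\<^sub>v y) \<bullet> (Psi m q \<psi> *\<^sub>v (Z\<^sup>T *\<^sub>v y)) + psi_last q \<psi> * (y \<bullet> y)"
proof -
  let ?w = "Z\<^sup>T *\<^sub>v y"
  have w: "?w \<in> carrier_vec (m * q)" using Z_carrier by (intro carrier_vecI) simp
  have Pw: "Psi m q \<psi> *\<^sub>v ?w \<in> carrier_vec (m * q)" using Psi_carrier w by (rule mult_mat_vec_carrier)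
  have F: "(Z * Psi m q \<psi> * Z\<^sup>T) *\<^sub>v y = Z *\<^sub>v (Psi m q \<psi> *\<^sub>v ?w)"
    using Z_carrier Psi_carrier[of m q \<psi>] y by (simp add: mat_assoc)
  have "y \<bullet> (Sig \<psi> *\<^sub>v y) = y \<bullet> (Z *\<^sub>v (Psi m q \<psi> *\<^sub>v ?w)) + psi_last q \<psi> * (y \<bullet> y)"
    unfolding Sig_eq
    using y ZPZ_carrier[of \<psi>] F mult_mat_vec_carrier[OF Z_carrier Pw]
    by (subst add_mult_distrib_mat_vec[of _ N N])
       (simp_all add: smult_one_mat_vec scalar_prod_add_distrib[of _ N])
  also have "y \<bullet> (Z *\<^sub>v (Psi m q \<psi> *\<^sub>v ?w)) = ?w \<bullet> (Psi m q \<psi> *\<^sub>v ?w)"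
    by (rule scalar_prod_mult_mat_vec[OF Z_carrier y Pw])
  finally show ?thesis .
qed

text \<open>The random effects contribute a nonnegative amount even when Psi_1 is singular. The
  bound a comes from the error variance alone and therefore also holds on the boundary of the
  parameter set.\<close>

lemma Sig_quadratic_ge:
  assumes y: "y \<in> carrier_vec N"
  shows "a * (y \<bullet> y) \<le> y \<bullet> (Sig \<psi> *\<^sub>v y)"
proof -
  have w: "Z\<^sup>T *\<^sub>v y \<in> carrier_vec (m * q)" using Z_carrier by (intro carrier_vecI) simp
  have "psi_last q \<psi> * (y \<bullet> y) \<le> y \<bullet> (Sig \<psi> *\<^sub>v y)"
    using quadratic_form_Psi_nonneg[OF psd_Psi1 w] Sig_quadratic_eq[OF y] by simp
  then show ?thesis
    using mult_right_mono[OF a_le scalar_prod_self_nonneg[of y]] by linarith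
qed

lemma S_quadratic:
  assumes x: "x \<in> carrier_vec d"
  shows "x \<bullet> (S *\<^sub>v x) = (V *\<^sub>v x) \<bullet> (Sig \<psi> *\<^sub>v (V *\<^sub>v x))"
proof -
  have Vx: "V *\<^sub>v x \<in> carrier_vec N" using V_carrier x by (rule mult_mat_vec_carrier)
  have SVx: "Sig \<psi> *\<^sub>v (V *\<^sub>v x) \<in> carrier_vec N" using Sig_carrier Vx by (rule mult_mat_vec_carrier)
  have "S *\<^sub>v x = V\<^sup>T *\<^sub>v (Sig \<psi> *\<^sub>v (V *\<^sub>v x))"
    unfolding Sigma_res_def using V_carrier Sig_carrier[of \<psi>] x by (simp add: mat_assoc)
  then have "x \<bullet> (S *\<^sub>v x) = x \<bullet> (V\<^sup>T *\<^sub>v (Sig \<psi> *\<^sub>v (V *\<^sub>v x)))" by simp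
  also have "\<dots> = (V\<^sup>T\<^sup>T *\<^sub>v x) \<bullet> (Sig \<psi> *\<^sub>v (V *\<^sub>v x))"
    by (rule scalar_prod_mult_mat_vec[OF _ x SVx]) (use V_carrier in simp)
  finally show ?thesis by simp
qed

lemma S_ge:
  assumes x: "x \<in> carrier_vec d"
  shows "a * (x \<bullet> x) \<le> x \<bullet> (S *\<^sub>v x)"
proof -
  have Vx: "V *\<^sub>v x \<in> carrier_vec N" using V_carrier x by (rule mult_mat_vec_carrier)
  show ?thesis
    unfolding S_quadratic[OF x] using Sig_quadratic_ge[OF Vx] semi_orthogonal_norm[OF V_carrier V_orth refl x] by simp
qed

lemma S_sqrt:
  obtains L where "L \<in> carrier_mat d d" "K \<in> carrier_mat d d" "L\<^sup>T = L" "K\<^sup>T = K"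
    "L * L = S" "L * K = 1\<^sub>m d" "K * L = 1\<^sub>m d" "mat_inv S = K * K"
proof -
  have pos: "0 < x \<bullet> (S *\<^sub>v x)" if x: "x \<in> carrier_vec d" "x \<noteq> 0\<^sub>v d" for x
  proof -
    have "0 < x \<bullet> x" using conjugate_square_greater_0_vec[OF x(1)] x(2) by simp
    then have "0 < a * (x \<bullet> x)" using a_pos by simp
    also have "\<dots> \<le> x \<bullet> (S *\<^sub>v x)" by (rule S_ge[OF x(1)])
    finally show ?thesis .
  qed
  obtain L K' where "L \<in> carrier_mat d d" "K' \<in> carrier_mat d d" "L\<^sup>T = L" "K'\<^sup>T = K'"
    "L * L = S" "L * K' = 1\<^sub>m d" "K' * L = 1\<^sub>m d" "K' = mat_inv_sqrt S" "mat_inv S = K' * K'"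
    by (rule pos_def_sqrt[OF S_carrier S_sym pos])
  then show thesis by (intro that[of L]) simp_all
qed

lemma K_carrier: "K \<in> carrier_mat d d" and K_sym: "K\<^sup>T = K"
  by (rule S_sqrt, assumption)+

lemma mat_inv_S: "mat_inv S = K * K"
  by (rule S_sqrt)

lemma KSK: "K * S * K = 1\<^sub>m d"
proof -
  obtain L where L: "L \<in> carrier_mat d d" "K \<in> carrier_mat d d" "L * L = S" "L * K = 1\<^sub>m d" "K * L = 1\<^sub>m d"
    by (rule S_sqrt)
  have "X * (L * L) * X = (X * L) * (L * X)" if "X \<in> carrier_mat d d" for X
    using L(1) that by (simp add: mat_assoc)
  from this[OF L(2)] show ?thesis unfolding L(3,4,5) by simp
qed

text \<open>With y = K x and x = L y one has |x|^2 = y.Sy >= a |y|^2.\<close>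

lemma op_bounded_K: "op_bounded K (1 / a)"
proof (rule op_boundedI)
  show "0 \<le> 1 / a" using a_pos by simp
  fix x :: "real vec" assume "x \<in> carrier_vec (dim_col K)"
  then have x: "x \<in> carrier_vec d" using K_carrier by simp
  obtain L where L: "L \<in> carrier_mat d d" "K \<in> carrier_mat d d" "L\<^sup>T = L" "L * L = S" "L * K = 1\<^sub>m d"
    by (rule S_sqrt)
  define y where "y = K *\<^sub>v x"
  have y: "y \<in> carrier_vec d" unfolding y_def using L(2) x by (rule mult_mat_vec_carrier)
  have Ly: "L *\<^sub>v y \<in> carrier_vec d" using L(1) y by (rule mult_mat_vec_carrier)
  have "L *\<^sub>v y = (L * K) *\<^sub>v x" unfolding y_def using L(1,2) x by (simp add: mat_assoc)
  then have xL: "x = L *\<^sub>v y" unfolding L(5) using x by simp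
  have "S *\<^sub>v y = L *\<^sub>v (L *\<^sub>v y)" unfolding L(4)[symmetric] using L(1) y by (simp add: mat_assoc)
  then have "y \<bullet> (S *\<^sub>v y) = x \<bullet> x"
    using scalar_prod_mult_mat_vec[OF L(1) y Ly] unfolding L(3) xL by simp
  then have "a * (y \<bullet> y) \<le> x \<bullet> x" using S_ge[OF y] by simp
  then show "(K *\<^sub>v x) \<bullet> (K *\<^sub>v x) \<le> 1 / a * (x \<bullet> x)"
    using a_pos by (simp add: y_def field_simps)
qed

text \<open>Since \<open>op_bounded\<close> records squares, the square of \<open>\<Lambda>\<close>
  is the constant of S, whereas \<open>\<Lambda>\<close> itself is the constant of the root of
  S.\<close>

definition \<Lambda> :: real where "\<Lambda> = sqrt \<kappa> * b"

lemma \<Lambda>_pos: "0 < \<Lambda>"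
  using \<kappa>_pos b_pos by (simp add: \<Lambda>_def)

lemma op_bounded_S: "op_bounded S (\<Lambda>\<^sup>2)"
proof -
  have "op_bounded (V\<^sup>T * Sig \<psi> * V) (1 * (\<kappa> * b\<^sup>2) * 1)"
    by (intro op_bounded_mult V_semi op_bounded_Sig b_ge) (use V_carrier Sig_carrier[of \<psi>] in simp_all)
  then show ?thesis using \<kappa>_pos by (simp add: Sigma_res_def \<Lambda>_def power_mult_distrib)
qed

text \<open>Cauchy-Schwarz in |Lx|^2 = x.Sx trades the root of S for S itself.\<close>

lemma op_bounded_sqrt:
  assumes L: "L \<in> carrier_mat d d" "L\<^sup>T = L" "L * L = S"
  shows "op_bounded L \<Lambda>"
proof (rule op_boundedI)
  show "0 \<le> \<Lambda>" using \<Lambda>_pos by simp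
  fix x :: "real vec" assume "x \<in> carrier_vec (dim_col L)"
  then have x: "x \<in> carrier_vec d" using L by simp
  have Lx: "L *\<^sub>v x \<in> carrier_vec d" using L(1) x by (rule mult_mat_vec_carrier)
  have "S *\<^sub>v x = L *\<^sub>v (L *\<^sub>v x)" unfolding L(3)[symmetric] using L(1) x by (simp add: mat_assoc)
  then have e: "(L *\<^sub>v x) \<bullet> (L *\<^sub>v x) = x \<bullet> (S *\<^sub>v x)"
    using scalar_prod_mult_mat_vec[OF L(1) x Lx] unfolding L(2) by simp
  have "(x \<bullet> (S *\<^sub>v x))\<^sup>2 \<le> (x \<bullet> x) * ((S *\<^sub>v x) \<bullet> (S *\<^sub>v x))"
    by (rule scalar_prod_Cauchy_Schwarz) (use x S_carrier in simp)
  also have "\<dots> \<le> (x \<bullet> x) * (\<Lambda>\<^sup>2 * (x \<bullet> x))"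
    using op_boundedD[OF op_bounded_S, of x] x S_carrier by (intro mult_left_mono scalar_prod_self_nonneg) simp
  finally have "(x \<bullet> (S *\<^sub>v x))\<^sup>2 \<le> (\<Lambda> * (x \<bullet> x))\<^sup>2" by (simp only: power2_eq_square mult_ac)
  then have "x \<bullet> (S *\<^sub>v x) \<le> \<Lambda> * (x \<bullet> x)"
    by (rule power2_le_imp_le) (intro mult_nonneg_nonneg scalar_prod_self_nonneg less_imp_le[OF \<Lambda>_pos])
  then show "(L *\<^sub>v x) \<bullet> (L *\<^sub>v x) \<le> \<Lambda> * (x \<bullet> x)" unfolding e .
qed

text \<open>Since \<open>\<Sigma>\<close> is linear in the parameter, the combination \<open>\<Sum>\<^sub>j u\<^sub>j A\<^sub>j\<close> is the
  matrix \<open>Bm u\<close>, so that the information is half its squared Frobenius norm.\<close>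

definition Bm :: "(nat \<Rightarrow> real) \<Rightarrow> real mat" where
  "Bm u = (K * V\<^sup>T) * Sig u * (K * V\<^sup>T)\<^sup>T"

lemma KV_carrier: "K * V\<^sup>T \<in> carrier_mat d N"
  using K_carrier V_carrier by (intro carrier_matI) simp_all

lemma Bm_carrier: "Bm u \<in> carrier_mat d d"
  unfolding Bm_def using K_carrier V_carrier by (intro carrier_matI) simp_all

lemma Bm_sym: "(Bm u)\<^sup>T = Bm u"
proof -
  have "(X * G * X\<^sup>T)\<^sup>T = X * G * X\<^sup>T" if "X \<in> carrier_mat d N" "G \<in> carrier_mat N N" "G\<^sup>T = G" for X G :: "real mat"
    using that by (simp add: mat_assoc)
  from this[OF KV_carrier Sig_carrier Sig_sym] show ?thesis unfolding Bm_def .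
qed

lemma Bm_linear:
  "i < d \<Longrightarrow> j < d \<Longrightarrow> Bm u $$ (i, j) = (\<Sum>k\<in>{..<npar q}. u k * Bm (basis_fun k) $$ (i, j))"
  unfolding Bm_def by (rule sandwich_linear[OF KV_carrier Sig_carrier Sig_carrier Sig_linear])

lemma op_bounded_Bm:
  assumes "\<And>k. \<bar>u k\<bar> \<le> h"
  shows "op_bounded (Bm u) (\<kappa> * h\<^sup>2 / a\<^sup>2)"
proof -
  have KV: "op_bounded (K * V\<^sup>T) (1 / a * 1)"
    by (intro op_bounded_mult op_bounded_K V_semi) (use K_carrier V_carrier in simp)
  have "op_bounded (Bm u) ((1 / a * 1) * (\<kappa> * h\<^sup>2) * (1 / a * 1))"
    unfolding Bm_def
    by (rule op_bounded_mult[OF op_bounded_mult[OF KV op_bounded_Sig[OF assms]] op_bounded_transpose[OF KV]])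
       (use V_carrier Sig_carrier[of u] in simp_all)
  then show ?thesis by (simp add: power2_eq_square)
qed

text \<open>Undoing the standardization, \<open>L * (Bm u * L)\<close> is
  \<open>V\<^sup>T * Sig u * V\<close>, and each factor L costs at most \<open>\<Lambda>\<close>.
  The numerator is what \<open>fro_compression\<close> leaves of \<open>fro (Sig u)\<close> when N -
  d directions are removed.\<close>

lemma fro_Bm_ge:
  assumes u: "\<And>k. \<bar>u k\<bar> \<le> h"
  shows "(fro (Sig u) - 2 * (\<kappa> * h\<^sup>2) * (real N - real d)) / \<Lambda>\<^sup>2 \<le> fro (Bm u)"
proof -
  obtain L where L: "L \<in> carrier_mat d d" "K \<in> carrier_mat d d" "L\<^sup>T = L" "L * L = S" "L * K = 1\<^sub>m d" "K * L = 1\<^sub>m d"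
    by (rule S_sqrt)
  let ?M = "V\<^sup>T * Sig u * V"
  have "L * (Bm u * L) = (L * K) * (?M * (K * L))"
    unfolding Bm_def using L(1,2) K_sym V_carrier Sig_carrier[of u] by (simp add: mat_assoc)
  also have "\<dots> = ?M" unfolding L(5,6) using V_carrier Sig_carrier[of u] by simp
  finally have M: "L * (Bm u * L) = ?M" .
  have Lb: "op_bounded L \<Lambda>" by (rule op_bounded_sqrt[OF L(1,3,4)])
  have "fro ?M \<le> \<Lambda> * fro (Bm u * L)"
    unfolding M[symmetric] by (rule fro_mult_le[OF Lb]) (use L(1) Bm_carrier[of u] in simp)
  also have "\<dots> \<le> \<Lambda> * (\<Lambda> * fro (Bm u))"
    by (intro mult_left_mono fro_mult_right_le[OF Lb]) (use L(1) Bm_carrier[of u] \<Lambda>_pos in simp_all)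
  finally have "fro ?M \<le> \<Lambda>\<^sup>2 * fro (Bm u)" by (simp add: power2_eq_square mult.assoc)
  moreover have "fro (Sig u) \<le> fro ?M + 2 * (\<kappa> * h\<^sup>2) * (real N - real d)"
    by (rule fro_compression[OF V_carrier V_orth refl Sig_carrier Sig_sym op_bounded_Sig[OF u]])
  ultimately show ?thesis using \<Lambda>_pos by (simp add: divide_le_eq mult.commute)
qed

text \<open>Both branches of \<open>A_res\<close> come from one formula: at a basis vector
  \<open>Sig\<close> is the partial derivative of \<Sigma>. For the last one it is the identity, and
  the orthonormal columns of V leave K K, the inverse of S.\<close>

lemma A_res_eq_Bm:
  assumes j: "j < npar q"
  shows "A_res m q Z V j \<psi> = Bm (basis_fun j)"
proof (cases "j < npar q - 1")
  case True
  then have "psi_last q (basis_fun j) = 0" by (simp add: psi_last_def)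
  then have "Sig (basis_fun j) = Z * Psi m q (basis_fun j) * Z\<^sup>T"
    unfolding Sig_eq using ZPZ_carrier[of "basis_fun j"] by (intro eq_matI) auto
  then show ?thesis
    using True K_carrier K_sym V_carrier Z_carrier Psi_carrier[of m q "basis_fun j"]
    by (simp add: A_res_def Bm_def Let_def H_mat_eq_Psi mat_assoc)
next
  case False
  then have jr: "j = npar q - 1" using j by simp
  have "Psi m q (basis_fun j) = 0\<^sub>m (m * q) (m * q)"
  proof (rule eq_matI)
    fix x y assume "x < dim_row (0\<^sub>m (m * q) (m * q) :: real mat)" "y < dim_col (0\<^sub>m (m * q) (m * q) :: real mat)"
    then have xy: "x < m * q" "y < m * q" by simp_all
    have "vech_index q (x mod q) (y mod q) \<noteq> j"
      using vech_index_less[of "x mod q" q "y mod q"] q_pos unfolding jr by simp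
    then show "Psi m q (basis_fun j) $$ (x, y) = 0\<^sub>m (m * q) (m * q) $$ (x, y)" using xy by (simp add: Psi_index)
  qed (use Psi_carrier[of m q "basis_fun j"] in simp_all)
  moreover have "psi_last q (basis_fun j) = 1" by (simp add: psi_last_def jr)
  ultimately have "Sig (basis_fun j) = 1\<^sub>m N"
    unfolding Sig_eq using Z_carrier by (intro eq_matI) auto
  then have "Bm (basis_fun j) = K * ((V\<^sup>T * V) * K)"
    unfolding Bm_def using K_carrier K_sym V_carrier by (simp add: mat_assoc)
  also have "\<dots> = mat_inv S"
    unfolding V_orth mat_inv_S using K_carrier by simp
  finally show ?thesis using False by (simp add: A_res_def Let_def)
qed

end


section \<open>Gaussian quadratic forms and the standardized score\<close>

lemma scalar_prod_lessThan: "dim_vec w = n \<Longrightarrow> v \<bullet> w = (\<Sum>k<n. v $ k * w $ k)"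
  by (simp add: scalar_prod_def lessThan_atLeast0)

lemma trace_diag:
  assumes Q: "Q \<in> carrier_mat n n" "Q\<^sup>T * Q = 1\<^sub>m n"
  shows "trace (Q * mat_diag n f * Q\<^sup>T) = (\<Sum>k<n. f k)"
proof -
  have "trace (Q * mat_diag n f * Q\<^sup>T) = trace (Q\<^sup>T * (Q * mat_diag n f))"
    by (rule trace_comm) (use Q(1) in simp_all)
  also have "Q\<^sup>T * (Q * mat_diag n f) = (Q\<^sup>T * Q) * mat_diag n f" using Q(1) by (simp add: mat_assoc)
  finally show ?thesis unfolding Q(2) by (simp add: trace_def mat_diag_def)
qed

lemma fro_diag:
  assumes Q: "Q \<in> carrier_mat n n" "Q\<^sup>T * Q = 1\<^sub>m n" and A: "A = Q * mat_diag n f * Q\<^sup>T" "A\<^sup>T = A"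
  shows "fro A = (\<Sum>k<n. (f k)\<^sup>2)"
proof -
  have "A * A = Q * (mat_diag n f * ((Q\<^sup>T * Q) * (mat_diag n f * Q\<^sup>T)))"
    unfolding A(1) using Q(1) by (simp add: mat_assoc del: mat_diag_diag)
  also have "\<dots> = Q * ((mat_diag n f * mat_diag n f) * Q\<^sup>T)"
    unfolding Q(2) using Q(1) by (simp add: mat_assoc del: mat_diag_diag)
  also have "\<dots> = Q * mat_diag n (\<lambda>k. f k * f k) * Q\<^sup>T"
    using Q(1) by (simp add: mat_assoc)
  finally have "A * A = Q * mat_diag n (\<lambda>k. f k * f k) * Q\<^sup>T" .
  then show ?thesis
    using trace_diag[OF Q] by (simp add: fro_symmetric[OF A(2)] power2_eq_square)
qed

text \<open>By the Cramer-Wold device, this says that \<open>R\<close> is a standard Gaussian vector.\<close>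

definition std_gaussian :: "'a measure \<Rightarrow> nat \<Rightarrow> ('a \<Rightarrow> real vec) \<Rightarrow> bool" where
  "std_gaussian M d R \<longleftrightarrow> prob_space M \<and> (\<forall>\<omega>\<in>space M. R \<omega> \<in> carrier_vec d) \<and>
     (\<forall>t\<in>carrier_vec d. (\<lambda>\<omega>. t \<bullet> R \<omega>) \<in> borel_measurable M \<and>
        (CLINT \<omega>|M. iexp (t \<bullet> R \<omega>)) = exp (- (t \<bullet> t) / 2))"

text \<open>In an eigenbasis of B the coordinates of R are independent standard normals by
  \<open>distr_PiM_if_char_product\<close>, and the form becomes a weighted sum of variables (z^2 -
  1)/2. The squared weights sum to \<open>fro B\<close>. C is chosen before the probability space,
  the dimension and B.\<close>

lemma gaussian_quadratic_form_char:
  obtains C where "0 \<le> C" "\<And>(M :: 'a measure) R B d \<delta>. std_gaussian M d R \<Longrightarrow>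
    B \<in> carrier_mat d d \<Longrightarrow> B\<^sup>T = B \<Longrightarrow> op_bounded B (\<delta>\<^sup>2) \<Longrightarrow> 0 \<le> \<delta> \<Longrightarrow> \<delta> \<le> 1 \<Longrightarrow>
    cmod ((CLINT \<omega>|M. iexp (1 / 2 * (R \<omega> \<bullet> (B *\<^sub>v R \<omega>) - trace B))) - exp (- fro B / 4)) \<le> C * \<delta> * fro B"
proof -
  obtain C where C: "0 \<le> C" "\<And>d (lam :: nat \<Rightarrow> real) \<delta>. (\<And>k. k < d \<Longrightarrow> \<bar>lam k\<bar> \<le> \<delta>) \<Longrightarrow> \<delta> \<le> 1 \<Longrightarrow>
    cmod ((CLINT x|std_normal_vec d. iexp (\<Sum>k<d. lam k * (((x k)\<^sup>2 - 1) / 2)))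
      - exp (- (\<Sum>k<d. (lam k)\<^sup>2) / 4)) \<le> C * \<delta> * (\<Sum>k<d. (lam k)\<^sup>2)"
    using centered_quadratic_form_char_approx by blast
  show thesis
  proof (rule that[OF C(1)])
    fix M :: "'a measure" and R B d \<delta>
    assume std: "std_gaussian M d R"
      and B: "B \<in> carrier_mat d d" "B\<^sup>T = B" and bd: "op_bounded B (\<delta>\<^sup>2)" and \<delta>: "0 \<le> \<delta>" "\<delta> \<le> 1"
    have M: "prob_space M" and R: "\<And>\<omega>. \<omega> \<in> space M \<Longrightarrow> R \<omega> \<in> carrier_vec d"
      and meas: "\<And>t. t \<in> carrier_vec d \<Longrightarrow> (\<lambda>\<omega>. t \<bullet> R \<omega>) \<in> borel_measurable M"
      and char: "\<And>t. t \<in> carrier_vec d \<Longrightarrow> (CLINT \<omega>|M. iexp (t \<bullet> R \<omega>)) = exp (- (t \<bullet> t) / 2)"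
      using std unfolding std_gaussian_def by blast+
    obtain Q lam where Q: "Q \<in> carrier_mat d d" "Q\<^sup>T * Q = 1\<^sub>m d" "Q * Q\<^sup>T = 1\<^sub>m d" "B = Q * mat_diag d lam * Q\<^sup>T"
      using spectral_decomposition[OF B] by blast
    have lam: "\<bar>lam k\<bar> \<le> \<delta>" if "k < d" for k
    proof -
      have "(lam k)\<^sup>2 \<le> \<delta>\<^sup>2"
        by (rule op_bounded_eigenvalue[OF bd B(1) spectral_decomposition_eigenvalue[OF Q(1,2,4) that]])
      then show ?thesis using \<delta>(1) by (simp add: abs_le_square_iff[symmetric])
    qed
    define X where "X k \<omega> = col Q k \<bullet> R \<omega>" for k \<omega>
    have Xm: "X k \<in> borel_measurable M" if "k < d" for k
      unfolding X_def[abs_def] by (rule meas) (use Q(1) that in simp)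
    have Xix: "(Q\<^sup>T *\<^sub>v R \<omega>) $ k = X k \<omega>" if "k < d" for k \<omega>
      using Q(1) that by (simp add: X_def)
    have law: "distr M (std_normal_vec d) (\<lambda>\<omega>. \<lambda>k\<in>{..<d}. X k \<omega>) = std_normal_vec d"
    proof (rule distr_PiM_if_char_product[OF M Xm real_dist_normal_dist])
      fix t :: "nat \<Rightarrow> real"
      define s where "s = vec d t"
      have s: "s \<in> carrier_vec d" by (simp add: s_def)
      have Qs: "Q *\<^sub>v s \<in> carrier_vec d" using Q(1) s by (rule mult_mat_vec_carrier)
      have "(\<Sum>k<d. t k * X k \<omega>) = (Q *\<^sub>v s) \<bullet> R \<omega>" if "\<omega> \<in> space M" for \<omega>
      proof -
        have "(\<Sum>k<d. t k * X k \<omega>) = s \<bullet> (Q\<^sup>T *\<^sub>v R \<omega>)"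
          by (subst scalar_prod_lessThan[of _ d]) (use Q(1) Xix in \<open>auto simp: s_def simp del: index_mult_mat_vec\<close>)
        also have "\<dots> = (Q\<^sup>T\<^sup>T *\<^sub>v s) \<bullet> R \<omega>"
          by (rule scalar_prod_mult_mat_vec[OF _ s R[OF that]]) (use Q(1) in simp)
        finally show ?thesis by simp
      qed
      then have "(CLINT \<omega>|M. iexp (\<Sum>k<d. t k * X k \<omega>)) = (CLINT \<omega>|M. iexp ((Q *\<^sub>v s) \<bullet> R \<omega>))"
        by (intro Bochner_Integration.integral_cong refl) simp
      also have "\<dots> = exp (- ((Q *\<^sub>v s) \<bullet> (Q *\<^sub>v s)) / 2)" by (rule char[OF Qs])
      also have "(Q *\<^sub>v s) \<bullet> (Q *\<^sub>v s) = (\<Sum>k<d. (t k)\<^sup>2)"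
        unfolding semi_orthogonal_norm[OF Q(1,2) refl s]
        by (simp add: s_def scalar_prod_def power2_eq_square lessThan_atLeast0)
      finally show "(CLINT \<omega>|M. iexp (\<Sum>k<d. t k * X k \<omega>)) = (\<Prod>k<d. char std_normal_distribution (t k))"
        unfolding char_std_normal_distribution
        by (simp add: exp_of_real[symmetric] exp_sum[symmetric] sum_negf sum_divide_distrib)
    qed
    have quad: "1 / 2 * (R \<omega> \<bullet> (B *\<^sub>v R \<omega>) - trace B) = (\<Sum>k<d. lam k * (((X k \<omega>)\<^sup>2 - 1) / 2))" if "\<omega> \<in> space M" for \<omega>
    proof -
      have "R \<omega> \<bullet> (B *\<^sub>v R \<omega>) = (\<Sum>k<d. lam k * ((Q\<^sup>T *\<^sub>v R \<omega>) $ k)\<^sup>2)"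
        by (rule diagonal_quadratic_form[OF Q(1,4) R[OF that]])
      also have "\<dots> = (\<Sum>k<d. lam k * (X k \<omega>)\<^sup>2)" by (intro sum.cong refl) (simp only: Xix lessThan_iff)
      finally have "R \<omega> \<bullet> (B *\<^sub>v R \<omega>) - trace B = (\<Sum>k<d. lam k * (X k \<omega>)\<^sup>2 - lam k)"
        unfolding Q(4) trace_diag[OF Q(1,2)] by (simp add: sum_subtractf)
      then show ?thesis by (simp add: sum_distrib_left right_diff_distrib diff_divide_distrib)
    qed
    have XP: "(\<lambda>\<omega>. \<lambda>k\<in>{..<d}. X k \<omega>) \<in> measurable M (std_normal_vec d)"
      by (rule measurable_restrict) (use Xm in simp)
    have gm: "(\<lambda>x. iexp (\<Sum>k<d. lam k * (((x k)\<^sup>2 - 1) / 2))) \<in> borel_measurable (std_normal_vec d)"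
      by measurable
    have "(CLINT \<omega>|M. iexp (1 / 2 * (R \<omega> \<bullet> (B *\<^sub>v R \<omega>) - trace B))) = (CLINT \<omega>|M. iexp (\<Sum>k<d. lam k * ((((\<lambda>k\<in>{..<d}. X k \<omega>) k)\<^sup>2 - 1) / 2)))"
      by (intro Bochner_Integration.integral_cong refl) (simp only: quad, simp)
    also have "\<dots> = (CLINT x|distr M (std_normal_vec d) (\<lambda>\<omega>. \<lambda>k\<in>{..<d}. X k \<omega>). iexp (\<Sum>k<d. lam k * (((x k)\<^sup>2 - 1) / 2)))"
      by (rule integral_distr[OF XP gm, symmetric])
    finally have "(CLINT \<omega>|M. iexp (1 / 2 * (R \<omega> \<bullet> (B *\<^sub>v R \<omega>) - trace B))) = (CLINT x|std_normal_vec d. iexp (\<Sum>k<d. lam k * (((x k)\<^sup>2 - 1) / 2)))"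
      unfolding law .
    then show "cmod ((CLINT \<omega>|M. iexp (1 / 2 * (R \<omega> \<bullet> (B *\<^sub>v R \<omega>) - trace B))) - exp (- fro B / 4)) \<le> C * \<delta> * fro B"
      unfolding fro_diag[OF Q(1,2,4) B(2)] using C(2)[of d lam \<delta>] lam \<delta>(2) by simp
  qed
qed

context cluster_param
begin

abbreviation info :: "real mat" where "info \<equiv> info_res m q Z V \<psi>"

abbreviation ext :: "real vec \<Rightarrow> nat \<Rightarrow> real" where
  "ext x \<equiv> (\<lambda>k. if k < npar q then x $ k else 0)"

lemma info_carrier: "info \<in> carrier_mat (npar q) (npar q)"
  by (simp add: info_res_def)

lemma info_index: "i < npar q \<Longrightarrow> j < npar q \<Longrightarrow> info $$ (i, j) = trace (Bm (basis_fun i) * Bm (basis_fun j)) / 2"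
  by (simp add: info_res_def A_res_eq_Bm)

lemma info_sym: "info\<^sup>T = info"
proof (rule eq_matI)
  fix i j assume "i < dim_row info" "j < dim_col info"
  then have ij: "i < npar q" "j < npar q" using info_carrier by simp_all
  have "trace (Bm (basis_fun i) * Bm (basis_fun j)) = trace (Bm (basis_fun j) * Bm (basis_fun i))"
    by (rule trace_comm) (use Bm_carrier[of "basis_fun i"] Bm_carrier[of "basis_fun j"] in simp_all)
  then show "info\<^sup>T $$ (i, j) = info $$ (i, j)" using ij info_carrier by (simp add: info_index)
qed (use info_carrier in simp_all)

text \<open>The information is the Gram matrix of the matrices \<open>Bm (basis_fun j)\<close> for
  half the trace product.\<close>

lemma info_quadratic:
  assumes x: "x \<in> carrier_vec (npar q)"
  shows "x \<bullet> (info *\<^sub>v x) = fro (Bm (ext x)) / 2"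
proof -
  have "fro (Bm (ext x)) = trace (Bm (ext x) * Bm (ext x))" by (rule fro_symmetric[OF Bm_sym])
  also have "\<dots> = (\<Sum>s\<in>{..<npar q}. \<Sum>t\<in>{..<npar q}. ext x s * ext x t * trace (Bm (basis_fun s) * Bm (basis_fun t)))"
    by (rule trace_mult_bilinear[OF Bm_carrier Bm_carrier Bm_linear])
  also have "\<dots> = (\<Sum>s<npar q. \<Sum>t<npar q. 2 * (x $ s * (info $$ (s, t) * x $ t)))"
    by (intro sum.cong refl) (simp add: info_index)
  also have "\<dots> = 2 * (x \<bullet> (info *\<^sub>v x))"
    using x info_carrier by (simp add: scalar_prod_def lessThan_atLeast0 sum_distrib_left)
  finally show ?thesis by simp
qed

abbreviation Rv :: "real vec \<Rightarrow> real vec" where "Rv y \<equiv> R_res m q Z V y \<psi>"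

lemma Rv_carrier: "Rv y \<in> carrier_vec d"
  unfolding R_res_def using K_carrier by (intro carrier_vecI) simp

lemma score_linear:
  "(\<Sum>j<npar q. u j * score_res m q Z V y \<psi> $ j) = 1 / 2 * (Rv y \<bullet> (Bm u *\<^sub>v Rv y) - trace (Bm u))"
proof -
  have "Rv y \<bullet> (Bm u *\<^sub>v Rv y) = (\<Sum>j\<in>{..<npar q}. u j * (Rv y \<bullet> (Bm (basis_fun j) *\<^sub>v Rv y)))"
    by (rule quadratic_form_linear[OF Bm_carrier Bm_carrier Rv_carrier Bm_linear])
  moreover have "trace (Bm u) = (\<Sum>j\<in>{..<npar q}. u j * trace (Bm (basis_fun j)))"
    by (rule trace_linear[OF Bm_carrier Bm_carrier Bm_linear])
  ultimately have "1 / 2 * (Rv y \<bullet> (Bm u *\<^sub>v Rv y) - trace (Bm u)) =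
      (\<Sum>j<npar q. u j * (1 / 2 * (Rv y \<bullet> (Bm (basis_fun j) *\<^sub>v Rv y) - trace (Bm (basis_fun j)))))"
    by (simp add: sum_subtractf[symmetric] sum_divide_distrib right_diff_distrib diff_divide_distrib)
  also have "\<dots> = (\<Sum>j<npar q. u j * score_res m q Z V y \<psi> $ j)"
    by (intro sum.cong refl) (simp add: score_res_def A_res_eq_Bm)
  finally show ?thesis by simp
qed

text \<open>With J the inverse root of the information, \<theta>.W is the score paired with u = J
  \<theta>, hence a centred form with matrix \<open>Bm u\<close>. Standardization fixes its squared
  norm at 2 |\<theta>|^2, and the lower bound \<rho> converts this into smallness of u, of order 1 /
  sqrt \<rho>.\<close>

lemma standardized_score:
  assumes \<rho>: "0 < \<rho>" "\<And>u. (\<And>k. npar q \<le> k \<Longrightarrow> u k = 0) \<Longrightarrow> \<rho> * (\<Sum>j<npar q. (u j)\<^sup>2) \<le> fro (Bm u)"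
  shows "invertible_mat info" "W_res m q Z V y \<psi> \<in> carrier_vec (npar q)"
    and "\<And>\<theta>. \<theta> \<in> carrier_vec (npar q) \<Longrightarrow> \<exists>u. (\<forall>k\<ge>npar q. u k = 0) \<and> fro (Bm u) = 2 * (\<theta> \<bullet> \<theta>) \<and>
      \<rho> * (\<Sum>j<npar q. (u j)\<^sup>2) \<le> 2 * (\<theta> \<bullet> \<theta>) \<and>
      (\<forall>y. \<theta> \<bullet> W_res m q Z V y \<psi> = 1 / 2 * (Rv y \<bullet> (Bm u *\<^sub>v Rv y) - trace (Bm u)))"
proof -
  let ?r = "npar q"
  have pos: "0 < x \<bullet> (info *\<^sub>v x)" if x: "x \<in> carrier_vec ?r" "x \<noteq> 0\<^sub>v ?r" for x
  proof -
    have "0 < x \<bullet> x" using conjugate_square_greater_0_vec[OF x(1)] x(2) by simp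
    also have "x \<bullet> x = (\<Sum>j<?r. (ext x j)\<^sup>2)"
      using x(1) by (simp add: scalar_prod_def power2_eq_square lessThan_atLeast0)
    finally have "0 < \<rho> * (\<Sum>j<?r. (ext x j)\<^sup>2)" using \<rho>(1) by simp
    also have "\<dots> \<le> fro (Bm (ext x))" by (rule \<rho>(2)) simp
    finally show ?thesis unfolding info_quadratic[OF x(1)] by simp
  qed
  obtain L J where LJ: "L \<in> carrier_mat ?r ?r" "J \<in> carrier_mat ?r ?r" "L\<^sup>T = L" "J\<^sup>T = J"
    "L * L = info" "L * J = 1\<^sub>m ?r" "J * L = 1\<^sub>m ?r" "J = mat_inv_sqrt info"
    by (rule pos_def_sqrt[OF info_carrier info_sym pos])
  have JI: "info * (J * J) = 1\<^sub>m ?r" "(J * J) * info = 1\<^sub>m ?r" "J * (info * J) = 1\<^sub>m ?r"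
  proof -
    have "L * L * (J * J) = L * ((L * J) * J)" "(J * J) * (L * L) = J * ((J * L) * L)" "J * ((L * L) * J) = (J * L) * (L * J)"
      using LJ(1,2) by (simp_all add: mat_assoc)
    then show "info * (J * J) = 1\<^sub>m ?r" "(J * J) * info = 1\<^sub>m ?r" "J * (info * J) = 1\<^sub>m ?r"
      unfolding LJ(5) LJ(6,7) using LJ(1,2,6,7) by simp_all
  qed
  show "invertible_mat info"
    unfolding invertible_mat_def inverts_mat_def using JI(1,2) info_carrier LJ(2)
    by (intro conjI exI[of _ "J * J"]) simp_all
  show "W_res m q Z V y \<psi> \<in> carrier_vec ?r"
    unfolding W_res_def LJ(8)[symmetric] using LJ(2) by (intro carrier_vecI) simp
  fix \<theta> :: "real vec" assume \<theta>: "\<theta> \<in> carrier_vec ?r"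
  define x where "x = J *\<^sub>v \<theta>"
  have x: "x \<in> carrier_vec ?r" unfolding x_def using LJ(2) \<theta> by (rule mult_mat_vec_carrier)
  have Ix: "info *\<^sub>v x \<in> carrier_vec ?r" using info_carrier x by (rule mult_mat_vec_carrier)
  have "\<theta> \<bullet> (J *\<^sub>v (info *\<^sub>v x)) = (J\<^sup>T *\<^sub>v \<theta>) \<bullet> (info *\<^sub>v x)"
    by (rule scalar_prod_mult_mat_vec[OF LJ(2) \<theta> Ix])
  moreover have "J *\<^sub>v (info *\<^sub>v x) = (J * (info * J)) *\<^sub>v \<theta>"
    unfolding x_def using LJ(2) info_carrier \<theta> by (simp add: mat_assoc)
  ultimately have "x \<bullet> (info *\<^sub>v x) = \<theta> \<bullet> \<theta>"
    unfolding LJ(4) x_def[symmetric] JI(3) using \<theta> by simp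
  then have fro: "fro (Bm (ext x)) = 2 * (\<theta> \<bullet> \<theta>)" unfolding info_quadratic[OF x] by simp
  have lin: "\<theta> \<bullet> W_res m q Z V y \<psi> = 1 / 2 * (Rv y \<bullet> (Bm (ext x) *\<^sub>v Rv y) - trace (Bm (ext x)))" for y
  proof -
    have sc: "score_res m q Z V y \<psi> \<in> carrier_vec ?r" by (simp add: score_res_def)
    have "\<theta> \<bullet> W_res m q Z V y \<psi> = (J\<^sup>T *\<^sub>v \<theta>) \<bullet> score_res m q Z V y \<psi>"
      unfolding W_res_def LJ(8)[symmetric] by (rule scalar_prod_mult_mat_vec[OF LJ(2) \<theta> sc])
    also have "\<dots> = (\<Sum>j<?r. ext x j * score_res m q Z V y \<psi> $ j)"
      unfolding LJ(4) x_def[symmetric] using sc by (simp add: scalar_prod_def lessThan_atLeast0)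
    finally show ?thesis unfolding score_linear .
  qed
  have "\<rho> * (\<Sum>j<?r. (ext x j)\<^sup>2) \<le> fro (Bm (ext x))" by (rule \<rho>(2)) simp
  then show "\<exists>u. (\<forall>k\<ge>?r. u k = 0) \<and> fro (Bm u) = 2 * (\<theta> \<bullet> \<theta>) \<and> \<rho> * (\<Sum>j<?r. (u j)\<^sup>2) \<le> 2 * (\<theta> \<bullet> \<theta>) \<and>
      (\<forall>y. \<theta> \<bullet> W_res m q Z V y \<psi> = 1 / 2 * (Rv y \<bullet> (Bm u *\<^sub>v Rv y) - trace (Bm u)))"
    using fro lin by (intro exI[of _ "ext x"]) simp
qed

end


section \<open>The law of the residual vector\<close>

lemma char_normal_dist:
  assumes v: "0 \<le> v"
  shows "(CLINT x|normal_dist 0 v. iexp x) = exp (- v / 2)"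
proof (cases "v = 0")
  case True
  then show ?thesis by (simp add: normal_dist_def integral_return)
next
  case False
  then have s: "0 < sqrt v" using v by simp
  interpret S: prob_space std_normal_distribution by (rule prob_space_std_normal)
  have "distributed std_normal_distribution lborel (\<lambda>x. x) std_normal_density"
    unfolding distributed_def by (auto simp: distr_id2)
  from S.normal_density_affine[OF this, of "sqrt v" 0] s
  have "distributed std_normal_distribution lborel (\<lambda>x. sqrt v * x) (normal_density 0 (sqrt v))"
    by simp
  then have D: "distr std_normal_distribution lborel (\<lambda>x. sqrt v * x) = normal_dist 0 v"
    using False by (simp add: distributed_def normal_dist_def)
  have "(CLINT x|normal_dist 0 v. iexp x) = (CLINT x|std_normal_distribution. iexp (sqrt v * x))"
    unfolding D[symmetric] by (rule integral_distr) auto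
  also have "\<dots> = char std_normal_distribution (sqrt v)" unfolding char_def ..
  also have "\<dots> = exp (- v / 2)" unfolding char_std_normal_distribution using v by (simp add: exp_of_real)
  finally show ?thesis .
qed

lemma measurable_scalar_prod_borel_vec [measurable]:
  assumes t: "t \<in> carrier_vec d"
  shows "(\<lambda>v. t \<bullet> v) \<in> borel_measurable (borel_vec d)"
proof -
  have sp: "space (borel_vec d) = carrier_vec d" by (simp add: borel_vec_def)
  have f: "(\<lambda>v :: real vec. \<lambda>k\<in>{..<d}. v $ k) \<in> measurable (borel_vec d) (\<Pi>\<^sub>M k\<in>{..<d}. (borel :: real measure))"
    unfolding borel_vec_def by (rule measurable_vimage_algebra1) (auto simp: space_PiM)
  have comp: "(\<lambda>v. v $ k) \<in> borel_measurable (borel_vec d)" if k: "k < d" for k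
    using measurable_compose[OF f measurable_component_singleton[of k "{..<d}"]] k by simp
  have "(\<lambda>v. \<Sum>k<d. t $ k * v $ k) \<in> borel_measurable (borel_vec d)"
    by (intro borel_measurable_sum borel_measurable_times borel_measurable_const comp) simp
  moreover have "t \<bullet> v = (\<Sum>k<d. t $ k * v $ k)" if "v \<in> space (borel_vec d)" for v
    using that sp by (intro scalar_prod_lessThan) simp
  ultimately show ?thesis by (simp cong: measurable_cong)
qed

lemma mv_normal_char:
  assumes W: "mv_normal M d W (0\<^sub>v d) \<Sigma>" and t: "t \<in> carrier_vec d" and nn: "0 \<le> t \<bullet> (\<Sigma> *\<^sub>v t)"
  shows "(CLINT \<omega>|M. iexp (t \<bullet> W \<omega>)) = exp (- (t \<bullet> (\<Sigma> *\<^sub>v t)) / 2)"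
proof -
  have "W \<in> measurable M (borel_vec d)" using W by (simp add: mv_normal_def)
  then have m: "(\<lambda>\<omega>. t \<bullet> W \<omega>) \<in> borel_measurable M"
    by (rule measurable_compose[OF _ measurable_scalar_prod_borel_vec[OF t]])
  have "(CLINT \<omega>|M. iexp (t \<bullet> W \<omega>)) = (CLINT x|distr M borel (\<lambda>\<omega>. t \<bullet> W \<omega>). iexp x)"
    by (rule integral_distr[symmetric, OF m]) simp
  also have "distr M borel (\<lambda>\<omega>. t \<bullet> W \<omega>) = normal_dist 0 (t \<bullet> (\<Sigma> *\<^sub>v t))"
    using W t by (simp add: mv_normal_def)
  finally show ?thesis using char_normal_dist[OF nn] by simp
qed

lemma mv_normal_space: "mv_normal M d W \<mu> \<Sigma> \<Longrightarrow> \<omega> \<in> space M \<Longrightarrow> W \<omega> \<in> carrier_vec d"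
  using measurable_space[of W M "borel_vec d" \<omega>] by (simp add: mv_normal_def borel_vec_def)

context cluster_param
begin

text \<open>A direction g orthogonal to the mean pairs with the data as (\<open>Z\<^sup>T\<close>
  g).U + g.E. Independence splits the characteristic function into one factor per cluster and
  source, and the exponents recombine to the quadratic form of \<Sigma>.\<close>

lemma cluster_model_char:
  assumes model: "cluster_model M m q n X Zf \<beta> \<psi> U E Y" and Zb: "Z = block_diag m Zf" and Nn: "N = (\<Sum>i<m. n i)"
    and X: "\<And>i. i < m \<Longrightarrow> X i \<in> carrier_mat (n i) p" and Zf: "\<And>i. i < m \<Longrightarrow> Zf i \<in> carrier_mat (n i) q"
    and \<beta>: "\<beta> \<in> carrier_vec p" and g: "g \<in> carrier_vec N"
    and gX: "\<And>\<omega>. g \<bullet> (stack_mats m p X *\<^sub>v \<beta>) = 0"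
  shows "(\<lambda>\<omega>. g \<bullet> stack_vecs m (\<lambda>i. Y i \<omega>)) \<in> borel_measurable M"
    "(CLINT \<omega>|M. iexp (g \<bullet> stack_vecs m (\<lambda>i. Y i \<omega>))) = exp (- (g \<bullet> (Sig \<psi> *\<^sub>v g)) / 2)"
proof -
  interpret M: prob_space M using model by (simp add: cluster_model_def)
  have U: "mv_normal M q (U i) (0\<^sub>v q) (Psi1 q \<psi>)" and E: "mv_normal M (n i) (E i) (0\<^sub>v (n i)) (psi_last q \<psi> \<cdot>\<^sub>m 1\<^sub>m (n i))"
    if "i < m" for i
    using model that by (simp_all add: cluster_model_def)
  have ind: "M.indep_vars (case_sum (\<lambda>i. borel_vec q) (\<lambda>i. borel_vec (n i))) (case_sum U E) ({..<m} <+> {..<m})"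
    using model by (simp add: cluster_model_def)
  have Y: "Y i \<omega> = X i *\<^sub>v \<beta> + Zf i *\<^sub>v U i \<omega> + E i \<omega>" if "i < m" "\<omega> \<in> space M" for i \<omega>
    using model that by (simp add: cluster_model_def)
  define w where "w = Z\<^sup>T *\<^sub>v g"
  have w: "w \<in> carrier_vec (m * q)" unfolding w_def using Z_carrier by (intro carrier_vecI) simp
  then obtain wf where wf: "\<And>i. i < m \<Longrightarrow> wf i \<in> carrier_vec q" "w = stack_vecs m wf"
    using stack_vecs_exists[of w "\<lambda>_. q" m] by auto
  obtain gf where gf: "\<And>i. i < m \<Longrightarrow> gf i \<in> carrier_vec (n i)" "g = stack_vecs m gf"
    using stack_vecs_exists[of g n m] g Nn by blast
  have sum: "g \<bullet> stack_vecs m (\<lambda>i. Y i \<omega>) = (\<Sum>i<m. wf i \<bullet> U i \<omega>) + (\<Sum>i<m. gf i \<bullet> E i \<omega>)" if \<omega>: "\<omega> \<in> space M" for \<omega>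
  proof -
    have Uc: "U i \<omega> \<in> carrier_vec q" and Ec: "E i \<omega> \<in> carrier_vec (n i)" if "i < m" for i
      using mv_normal_space[OF U[OF that] \<omega>] mv_normal_space[OF E[OF that] \<omega>] .
    have Xc: "X i *\<^sub>v \<beta> \<in> carrier_vec (n i)" and ZUc: "Zf i *\<^sub>v U i \<omega> \<in> carrier_vec (n i)" if "i < m" for i
      using mult_mat_vec_carrier[OF X[OF that] \<beta>] mult_mat_vec_carrier[OF Zf[OF that] Uc[OF that]] .
    have sX: "stack_vecs m (\<lambda>i. X i *\<^sub>v \<beta>) \<in> carrier_vec N" and sZ: "stack_vecs m (\<lambda>i. Zf i *\<^sub>v U i \<omega>) \<in> carrier_vec N"
      and sE: "stack_vecs m (\<lambda>i. E i \<omega>) \<in> carrier_vec N" and sU: "stack_vecs m (\<lambda>i. U i \<omega>) \<in> carrier_vec (m * q)"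
      using stack_vecs_carrier[of m "\<lambda>i. X i *\<^sub>v \<beta>" n] stack_vecs_carrier[of m "\<lambda>i. Zf i *\<^sub>v U i \<omega>" n]
        stack_vecs_carrier[of m "\<lambda>i. E i \<omega>" n] stack_vecs_carrier[of m "\<lambda>i. U i \<omega>" "\<lambda>_. q"] Xc ZUc Ec Uc Nn
      by simp_all
    have "stack_vecs m (\<lambda>i. Y i \<omega>) = stack_vecs m (\<lambda>i. (X i *\<^sub>v \<beta> + Zf i *\<^sub>v U i \<omega>) + E i \<omega>)"
      by (rule stack_vecs_cong) (rule Y[OF _ \<omega>])
    also have "\<dots> = stack_vecs m (\<lambda>i. X i *\<^sub>v \<beta> + Zf i *\<^sub>v U i \<omega>) + stack_vecs m (\<lambda>i. E i \<omega>)"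
      by (rule stack_vecs_add[of m _ n]) (use Xc ZUc Ec in \<open>auto intro: add_carrier_vec\<close>)
    also have "stack_vecs m (\<lambda>i. X i *\<^sub>v \<beta> + Zf i *\<^sub>v U i \<omega>) = stack_vecs m (\<lambda>i. X i *\<^sub>v \<beta>) + stack_vecs m (\<lambda>i. Zf i *\<^sub>v U i \<omega>)"
      by (rule stack_vecs_add[of m _ n]) (use Xc ZUc in auto)
    finally have "g \<bullet> stack_vecs m (\<lambda>i. Y i \<omega>) =
        g \<bullet> stack_vecs m (\<lambda>i. X i *\<^sub>v \<beta>) + g \<bullet> stack_vecs m (\<lambda>i. Zf i *\<^sub>v U i \<omega>) + g \<bullet> stack_vecs m (\<lambda>i. E i \<omega>)"
      using g sX sZ sE by (simp add: scalar_prod_add_distrib[of _ N])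
    also have "stack_vecs m (\<lambda>i. X i *\<^sub>v \<beta>) = stack_mats m p X *\<^sub>v \<beta>"
      by (rule stack_mats_mult_vec[symmetric, of m X n]) (use X \<beta> in auto)
    also have "g \<bullet> (stack_mats m p X *\<^sub>v \<beta>) = 0" by (rule gX)
    also have "stack_vecs m (\<lambda>i. Zf i *\<^sub>v U i \<omega>) = Z *\<^sub>v stack_vecs m (\<lambda>i. U i \<omega>)"
      unfolding Zb by (rule block_diag_mult_stack_vecs[symmetric, of m Zf n "\<lambda>_. q"]) (use Zf Uc in auto)
    also have "g \<bullet> (Z *\<^sub>v stack_vecs m (\<lambda>i. U i \<omega>)) = w \<bullet> stack_vecs m (\<lambda>i. U i \<omega>)"
      unfolding w_def by (rule scalar_prod_mult_mat_vec[OF Z_carrier g sU])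
    also have "\<dots> = (\<Sum>i<m. wf i \<bullet> U i \<omega>)"
      unfolding wf(2) by (rule scalar_prod_stack_vecs[of m wf "\<lambda>_. q"]) (use wf(1) Uc in auto)
    also have "g \<bullet> stack_vecs m (\<lambda>i. E i \<omega>) = (\<Sum>i<m. gf i \<bullet> E i \<omega>)"
      unfolding gf(2) by (rule scalar_prod_stack_vecs[of m gf n]) (use gf(1) Ec in auto)
    finally show ?thesis by simp
  qed
  have mU: "(\<lambda>\<omega>. wf i \<bullet> U i \<omega>) \<in> borel_measurable M" and mE: "(\<lambda>\<omega>. gf i \<bullet> E i \<omega>) \<in> borel_measurable M" if i: "i < m" for i
    using U[OF i] E[OF i] measurable_compose[OF _ measurable_scalar_prod_borel_vec[OF wf(1)[OF i]], of "U i" M]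
      measurable_compose[OF _ measurable_scalar_prod_borel_vec[OF gf(1)[OF i]], of "E i" M]
    by (simp_all add: mv_normal_def)
  show "(\<lambda>\<omega>. g \<bullet> stack_vecs m (\<lambda>i. Y i \<omega>)) \<in> borel_measurable M"
  proof (subst measurable_cong[OF sum])
    show "(\<lambda>\<omega>. (\<Sum>i<m. wf i \<bullet> U i \<omega>) + (\<Sum>i<m. gf i \<bullet> E i \<omega>)) \<in> borel_measurable M"
      by (intro borel_measurable_add borel_measurable_sum mU mE) simp_all
  qed
  \<comment> \<open>Effects carry the tag \<open>Inl\<close> and errors the tag \<open>Inr\<close>,
    so joint independence of both families gives a single product over the disjoint union.\<close>
  define h where "h = case_sum (\<lambda>i v. iexp (wf i \<bullet> v)) (\<lambda>i v. iexp (gf i \<bullet> v))"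
  let ?I = "{..<m} <+> {..<m}"
  have indh: "M.indep_vars (\<lambda>_. borel) (\<lambda>j \<omega>. h j (case_sum U E j \<omega>)) ?I"
  proof (rule M.indep_vars_compose2[OF ind])
    fix j assume "j \<in> ?I"
    then show "h j \<in> borel_measurable (case_sum (\<lambda>i. borel_vec q) (\<lambda>i. borel_vec (n i)) j)"
    proof (cases j)
      case (Inl i)
      then have [measurable]: "wf i \<in> carrier_vec q" using \<open>j \<in> ?I\<close> wf(1) by auto
      show ?thesis unfolding Inl h_def by simp
    next
      case (Inr i)
      then have [measurable]: "gf i \<in> carrier_vec (n i)" using \<open>j \<in> ?I\<close> gf(1) by auto
      show ?thesis unfolding Inr h_def by simp
    qed
  qed
  have hU: "h (Inl i) (U i \<omega>) = iexp (wf i \<bullet> U i \<omega>)" and hE: "h (Inr i) (E i \<omega>) = iexp (gf i \<bullet> E i \<omega>)" for i \<omega>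
    by (simp_all add: h_def)
  have "(CLINT \<omega>|M. iexp (g \<bullet> stack_vecs m (\<lambda>i. Y i \<omega>))) = (CLINT \<omega>|M. (\<Prod>j\<in>?I. h j (case_sum U E j \<omega>)))"
  proof (rule Bochner_Integration.integral_cong[OF refl])
    fix \<omega> assume "\<omega> \<in> space M"
    then show "iexp (g \<bullet> stack_vecs m (\<lambda>i. Y i \<omega>)) = (\<Prod>j\<in>?I. h j (case_sum U E j \<omega>))"
      unfolding sum[OF \<open>\<omega> \<in> space M\<close>]
      by (simp add: prod.Plus hU hE distrib_left exp_add sum_distrib_left exp_sum)
  qed
  also have "\<dots> = (\<Prod>j\<in>?I. (CLINT \<omega>|M. h j (case_sum U E j \<omega>)))"
  proof (rule M.indep_vars_lebesgue_integral[OF _ indh])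
    fix j assume j: "j \<in> ?I"
    show "complex_integrable M (\<lambda>\<omega>. h j (case_sum U E j \<omega>))"
    proof (rule M.integrable_const_bound[of _ 1])
      show "(\<lambda>\<omega>. h j (case_sum U E j \<omega>)) \<in> borel_measurable M"
        using indh j unfolding M.indep_vars_def2 by blast
    qed (cases j, auto simp: h_def)
  qed simp
  also have "\<dots> = (\<Prod>i<m. CLINT \<omega>|M. iexp (wf i \<bullet> U i \<omega>)) * (\<Prod>i<m. CLINT \<omega>|M. iexp (gf i \<bullet> E i \<omega>))"
    by (simp add: prod.Plus hU hE)
  also have "(\<Prod>i<m. CLINT \<omega>|M. iexp (wf i \<bullet> U i \<omega>)) = (\<Prod>i<m. exp (complex_of_real (- (wf i \<bullet> (Psi1 q \<psi> *\<^sub>v wf i)) / 2)))"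
  proof (rule prod.cong[OF refl])
    fix i assume "i \<in> {..<m}"
    then have i: "i < m" by simp
    have "0 \<le> wf i \<bullet> (Psi1 q \<psi> *\<^sub>v wf i)" using psd_Psi1 wf(1)[OF i] Psi1_carrier[of q \<psi>] by (auto simp: psd_def)
    from mv_normal_char[OF U[OF i] wf(1)[OF i] this]
    show "(CLINT \<omega>|M. iexp (wf i \<bullet> U i \<omega>)) = exp (complex_of_real (- (wf i \<bullet> (Psi1 q \<psi> *\<^sub>v wf i)) / 2))"
      by (simp only: exp_of_real)
  qed
  also have "\<dots> = exp (complex_of_real (- (w \<bullet> (Psi m q \<psi> *\<^sub>v w)) / 2))"
  proof -
    have P: "Psi1 q \<psi> *\<^sub>v wf i \<in> carrier_vec q" if "i < m" for i
      using Psi1_carrier wf(1)[OF that] by (rule mult_mat_vec_carrier)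
    have "Psi m q \<psi> *\<^sub>v w = stack_vecs m (\<lambda>i. Psi1 q \<psi> *\<^sub>v wf i)"
      unfolding Psi_block_diag wf(2)
      by (rule block_diag_mult_stack_vecs[of m _ "\<lambda>_. q" "\<lambda>_. q"]) (simp_all add: wf(1) Psi1_carrier)
    then have "w \<bullet> (Psi m q \<psi> *\<^sub>v w) = (\<Sum>i<m. wf i \<bullet> (Psi1 q \<psi> *\<^sub>v wf i))"
      unfolding wf(2) using scalar_prod_stack_vecs[of m wf "\<lambda>_. q" "\<lambda>i. Psi1 q \<psi> *\<^sub>v wf i"] wf(1) P by simp
    then show ?thesis by (simp add: exp_sum[symmetric] sum_negf sum_divide_distrib)
  qed
  also have "(\<Prod>i<m. CLINT \<omega>|M. iexp (gf i \<bullet> E i \<omega>)) = (\<Prod>i<m. exp (complex_of_real (- (psi_last q \<psi> * (gf i \<bullet> gf i)) / 2)))"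
  proof (rule prod.cong[OF refl])
    fix i assume "i \<in> {..<m}"
    then have i: "i < m" by simp
    have e: "gf i \<bullet> ((psi_last q \<psi> \<cdot>\<^sub>m 1\<^sub>m (n i)) *\<^sub>v gf i) = psi_last q \<psi> * (gf i \<bullet> gf i)"
      using gf(1)[OF i] by (simp add: smult_one_mat_vec)
    have "0 \<le> psi_last q \<psi> * (gf i \<bullet> gf i)"
      using a_pos a_le by (intro mult_nonneg_nonneg scalar_prod_self_nonneg) simp
    from mv_normal_char[OF E[OF i] gf(1)[OF i], unfolded e, OF this]
    show "(CLINT \<omega>|M. iexp (gf i \<bullet> E i \<omega>)) = exp (complex_of_real (- (psi_last q \<psi> * (gf i \<bullet> gf i)) / 2))"
      by (simp only: exp_of_real)
  qed
  also have "\<dots> = exp (complex_of_real (- (psi_last q \<psi> * (g \<bullet> g)) / 2))"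
  proof -
    have "g \<bullet> g = (\<Sum>i<m. gf i \<bullet> gf i)"
      unfolding gf(2) by (rule scalar_prod_stack_vecs[of m gf n]) (use gf(1) in auto)
    then show ?thesis by (simp add: exp_sum[symmetric] sum_negf sum_divide_distrib sum_distrib_left)
  qed
  also have "exp (complex_of_real (- (w \<bullet> (Psi m q \<psi> *\<^sub>v w)) / 2)) * exp (complex_of_real (- (psi_last q \<psi> * (g \<bullet> g)) / 2))
      = exp (complex_of_real (- (w \<bullet> (Psi m q \<psi> *\<^sub>v w) + psi_last q \<psi> * (g \<bullet> g)) / 2))"
    unfolding exp_add[symmetric] of_real_add[symmetric] by (simp add: add_divide_distrib diff_divide_distrib)
  also have "w \<bullet> (Psi m q \<psi> *\<^sub>v w) + psi_last q \<psi> * (g \<bullet> g) = g \<bullet> (Sig \<psi> *\<^sub>v g)"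
    using Sig_quadratic_eq[OF g] by (simp add: w_def)
  finally show "(CLINT \<omega>|M. iexp (g \<bullet> stack_vecs m (\<lambda>i. Y i \<omega>))) = exp (- (g \<bullet> (Sig \<psi> *\<^sub>v g)) / 2)"
    by (simp only: exp_of_real)
qed

text \<open>Pairing t with R amounts to pairing V K t with the data, a direction orthogonal to the
  columns of X. The variance is t.(K S K) t = t.t by \<open>KSK\<close>. Thus R is exactly Gaussian
  for every m, and the only approximation lies in the quadratic forms.\<close>

lemma residual_char:
  assumes model: "cluster_model M m q n X Zf \<beta> \<psi> U E Y" and Zb: "Z = block_diag m Zf" and Nn: "N = (\<Sum>i<m. n i)"
    and X: "\<And>i. i < m \<Longrightarrow> X i \<in> carrier_mat (n i) p" and Zf: "\<And>i. i < m \<Longrightarrow> Zf i \<in> carrier_mat (n i) q"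
    and \<beta>: "\<beta> \<in> carrier_vec p" and VX: "V\<^sup>T * stack_mats m p X = 0\<^sub>m d p"
    and t: "t \<in> carrier_vec d"
  shows "(\<lambda>\<omega>. t \<bullet> Rv (stack_vecs m (\<lambda>i. Y i \<omega>))) \<in> borel_measurable M"
    "(CLINT \<omega>|M. iexp (t \<bullet> Rv (stack_vecs m (\<lambda>i. Y i \<omega>)))) = exp (- (t \<bullet> t) / 2)"
proof -
  define s where "s = K *\<^sub>v t"
  define g where "g = V *\<^sub>v s"
  have s: "s \<in> carrier_vec d" unfolding s_def using K_carrier t by (rule mult_mat_vec_carrier)
  have g: "g \<in> carrier_vec N" unfolding g_def using V_carrier s by (rule mult_mat_vec_carrier)
  have XX: "stack_mats m p X \<in> carrier_mat N p" unfolding Nn using X by (rule stack_mats_carrier)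
  have tR: "t \<bullet> Rv y = g \<bullet> y" if y: "y \<in> carrier_vec N" for y
  proof -
    have Vy: "V\<^sup>T *\<^sub>v y \<in> carrier_vec d" using V_carrier by (intro carrier_vecI) simp
    have "t \<bullet> Rv y = (K\<^sup>T *\<^sub>v t) \<bullet> (V\<^sup>T *\<^sub>v y)"
      unfolding R_res_def by (rule scalar_prod_mult_mat_vec[OF K_carrier t Vy])
    also have "\<dots> = s \<bullet> (V\<^sup>T *\<^sub>v y)" unfolding K_sym s_def ..
    also have "\<dots> = (V\<^sup>T\<^sup>T *\<^sub>v s) \<bullet> y"
      by (rule scalar_prod_mult_mat_vec[OF _ s y]) (use V_carrier in simp)
    finally show ?thesis by (simp add: g_def)
  qed
  have gX: "g \<bullet> (stack_mats m p X *\<^sub>v \<beta>) = 0"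
  proof -
    have Xb: "stack_mats m p X *\<^sub>v \<beta> \<in> carrier_vec N" using XX \<beta> by (rule mult_mat_vec_carrier)
    have "s \<bullet> (V\<^sup>T *\<^sub>v (stack_mats m p X *\<^sub>v \<beta>)) = (V\<^sup>T\<^sup>T *\<^sub>v s) \<bullet> (stack_mats m p X *\<^sub>v \<beta>)"
      by (rule scalar_prod_mult_mat_vec[OF _ s Xb]) (use V_carrier in simp)
    moreover have "V\<^sup>T *\<^sub>v (stack_mats m p X *\<^sub>v \<beta>) = (V\<^sup>T * stack_mats m p X) *\<^sub>v \<beta>"
      using V_carrier XX \<beta> by (simp add: mat_assoc)
    ultimately show ?thesis unfolding VX g_def using s \<beta> by (simp add: zero_mult_vec)
  qed
  have Yc: "stack_vecs m (\<lambda>i. Y i \<omega>) \<in> carrier_vec N" if \<omega>: "\<omega> \<in> space M" for \<omega>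
    unfolding Nn
  proof (rule stack_vecs_carrier)
    fix i assume i: "i < m"
    have "Y i \<omega> = X i *\<^sub>v \<beta> + Zf i *\<^sub>v U i \<omega> + E i \<omega>" "mv_normal M (n i) (E i) (0\<^sub>v (n i)) (psi_last q \<psi> \<cdot>\<^sub>m 1\<^sub>m (n i))"
      using model i \<omega> by (simp_all add: cluster_model_def)
    then show "Y i \<omega> \<in> carrier_vec (n i)"
      using mv_normal_space[OF _ \<omega>] by (intro carrier_vecI) auto
  qed
  note eq = tR[OF Yc]
  note char = cluster_model_char[OF model Zb Nn X Zf \<beta> g gX, simplified]
  show "(\<lambda>\<omega>. t \<bullet> Rv (stack_vecs m (\<lambda>i. Y i \<omega>))) \<in> borel_measurable M"
    using char(1) by (subst measurable_cong[OF eq])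
  have "(CLINT \<omega>|M. iexp (t \<bullet> Rv (stack_vecs m (\<lambda>i. Y i \<omega>)))) = (CLINT \<omega>|M. iexp (g \<bullet> stack_vecs m (\<lambda>i. Y i \<omega>)))"
    by (intro Bochner_Integration.integral_cong refl) (simp only: eq)
  also have "\<dots> = exp (- (g \<bullet> (Sig \<psi> *\<^sub>v g)) / 2)" using char(2) by simp
  also have "g \<bullet> (Sig \<psi> *\<^sub>v g) = s \<bullet> (S *\<^sub>v s)" unfolding g_def by (rule S_quadratic[OF s, symmetric])
  also have "s \<bullet> (S *\<^sub>v s) = t \<bullet> t"
  proof -
    have Ss: "S *\<^sub>v s \<in> carrier_vec d" using S_carrier s by (rule mult_mat_vec_carrier)
    have "t \<bullet> (K *\<^sub>v (S *\<^sub>v s)) = (K\<^sup>T *\<^sub>v t) \<bullet> (S *\<^sub>v s)" by (rule scalar_prod_mult_mat_vec[OF K_carrier t Ss])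
    moreover have "K *\<^sub>v (S *\<^sub>v s) = (K * S * K) *\<^sub>v t"
      unfolding s_def using K_carrier S_carrier t by (simp add: mat_assoc)
    ultimately show ?thesis unfolding KSK K_sym s_def[symmetric] using t by simp
  qed
  finally show "(CLINT \<omega>|M. iexp (t \<bullet> Rv (stack_vecs m (\<lambda>i. Y i \<omega>)))) = exp (- (t \<bullet> t) / 2)" .
qed

end


section \<open>Coverage of the restricted score region\<close>

context cluster_param
begin

text \<open>\<open>g'\<close> is half of the constant in \<open>fro_Sig_ge\<close>. The other half
  pays for projecting out the fixed effects, which costs at most 2 \<kappa> g m |u|^2. What remains
  is divided by the square of \<open>\<Lambda>\<close>, that is \<kappa> b^2.\<close>

lemma fro_Bm_lower:
  assumes \<epsilon>: "0 < \<epsilon>" "(1 + \<epsilon>) * real (m * q) \<le> real N"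
    and codim: "real N - real d \<le> g * real m" "0 \<le> g" "2 * \<kappa> * g \<le> g'"
    and g': "g' = (min 1 \<epsilon> / 4) * ((inverse c)\<^sup>2 / real (npar q)) / 2"
    and u: "\<And>k. npar q \<le> k \<Longrightarrow> u k = 0"
  shows "(g' * real m / (\<kappa> * b\<^sup>2)) * (\<Sum>j<npar q. (u j)\<^sup>2) \<le> fro (Bm u)"
proof -
  let ?s = "\<Sum>j<npar q. (u j)\<^sup>2"
  define h where "h = sqrt ?s"
  have s: "0 \<le> ?s" by (rule sum_nonneg) simp
  have h2: "h\<^sup>2 = ?s" using s by (simp add: h_def)
  have uh: "\<bar>u k\<bar> \<le> h" for k
  proof (cases "k < npar q")
    case True
    then have "(u k)\<^sup>2 \<le> ?s" by (intro member_le_sum) auto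
    then have "sqrt ((u k)\<^sup>2) \<le> h" unfolding h_def by (rule real_sqrt_le_mono)
    then show ?thesis by simp
  next
    case False
    then show ?thesis using u[of k] s by (simp add: h_def)
  qed
  have "2 * g' * real m * ?s \<le> fro (Sig u)"
    using fro_Sig_ge[OF \<epsilon>, of u] unfolding g' by (simp add: mult.assoc)
  moreover have "2 * (\<kappa> * ?s) * (real N - real d) \<le> 2 * (\<kappa> * ?s) * (g * real m)"
    using codim(1) \<kappa>_pos s by (intro mult_left_mono) auto
  moreover have "2 * (\<kappa> * ?s) * (g * real m) \<le> g' * (real m * ?s)"
    using mult_right_mono[OF codim(3), of "real m * ?s"] s by (simp add: mult_ac)
  ultimately have "g' * real m * ?s \<le> fro (Sig u) - 2 * (\<kappa> * h\<^sup>2) * (real N - real d)"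
    unfolding h2 by (simp add: mult.assoc)
  then have "(g' * real m * ?s) / \<Lambda>\<^sup>2 \<le> (fro (Sig u) - 2 * (\<kappa> * h\<^sup>2) * (real N - real d)) / \<Lambda>\<^sup>2"
    by (rule divide_right_mono) simp
  also have "\<dots> \<le> fro (Bm u)" by (rule fro_Bm_ge[OF uh])
  also have "\<Lambda>\<^sup>2 = \<kappa> * b\<^sup>2" using \<kappa>_pos by (simp add: \<Lambda>_def power_mult_distrib)
  finally show ?thesis by simp
qed

end

text \<open>The lower bound \<rho> on the information is left abstract here; in the application it
  is proportional to m.\<close>

locale cluster_param_model = cluster_param +
  fixes M :: "'a measure" and n :: "nat \<Rightarrow> nat" and p :: nat and X Zf :: "nat \<Rightarrow> real mat" and \<beta> :: "real vec"
    and U E Y :: "nat \<Rightarrow> 'a \<Rightarrow> real vec" and \<rho> :: real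
  assumes model: "cluster_model M m q n X Zf \<beta> \<psi> U E Y" and Zb: "Z = block_diag m Zf" and Nn: "N = (\<Sum>i<m. n i)"
    and X: "\<And>i. i < m \<Longrightarrow> X i \<in> carrier_mat (n i) p" and Zf: "\<And>i. i < m \<Longrightarrow> Zf i \<in> carrier_mat (n i) q"
    and \<beta>: "\<beta> \<in> carrier_vec p" and VX: "V\<^sup>T * stack_mats m p X = 0\<^sub>m d p"
    and \<psi>: "\<psi> \<in> param_set q"
    and \<rho>: "0 < \<rho>" "\<And>u. (\<And>k. npar q \<le> k \<Longrightarrow> u k = 0) \<Longrightarrow> \<rho> * (\<Sum>j<npar q. (u j)\<^sup>2) \<le> fro (Bm u)"
begin

definition W :: "nat \<Rightarrow> 'a \<Rightarrow> real" where
  "W k \<omega> = W_res m q Z V (stack_vecs m (\<lambda>i. Y i \<omega>)) \<psi> $ k"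

abbreviation RY :: "'a \<Rightarrow> real vec" where
  "RY \<omega> \<equiv> Rv (stack_vecs m (\<lambda>i. Y i \<omega>))"

lemma prob_space_M: "prob_space M"
  using model by (simp add: cluster_model_def)

lemmas R_char = residual_char[OF model Zb Nn X Zf \<beta> VX, simplified]

lemma RY_std_gaussian: "std_gaussian M d RY"
  unfolding std_gaussian_def
proof (intro conjI ballI)
  fix t :: "real vec" assume t: "t \<in> carrier_vec d"
  show "(\<lambda>\<omega>. t \<bullet> RY \<omega>) \<in> borel_measurable M" using t by (rule R_char(1))
  show "(CLINT \<omega>|M. iexp (t \<bullet> RY \<omega>)) = exp (- (t \<bullet> t) / 2)" using R_char(2)[OF t] by simp
qed (rule prob_space_M Rv_carrier)+

lemma score:
  "invertible_mat info"
  "W_res m q Z V y \<psi> \<in> carrier_vec (npar q)"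
  "\<theta> \<in> carrier_vec (npar q) \<Longrightarrow> \<exists>u. (\<forall>k\<ge>npar q. u k = 0) \<and> fro (Bm u) = 2 * (\<theta> \<bullet> \<theta>) \<and>
      \<rho> * (\<Sum>j<npar q. (u j)\<^sup>2) \<le> 2 * (\<theta> \<bullet> \<theta>) \<and>
      (\<forall>y. \<theta> \<bullet> W_res m q Z V y \<psi> = 1 / 2 * (Rv y \<bullet> (Bm u *\<^sub>v Rv y) - trace (Bm u)))"
proof -
  show "invertible_mat info" by (rule standardized_score(1)[OF \<rho>(1)]) (rule \<rho>(2), blast)
  show "W_res m q Z V y \<psi> \<in> carrier_vec (npar q)"
    by (rule standardized_score(2)[OF \<rho>(1)]) (rule \<rho>(2), blast)
  show "\<exists>u. (\<forall>k\<ge>npar q. u k = 0) \<and> fro (Bm u) = 2 * (\<theta> \<bullet> \<theta>) \<and>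
      \<rho> * (\<Sum>j<npar q. (u j)\<^sup>2) \<le> 2 * (\<theta> \<bullet> \<theta>) \<and>
      (\<forall>y. \<theta> \<bullet> W_res m q Z V y \<psi> = 1 / 2 * (Rv y \<bullet> (Bm u *\<^sub>v Rv y) - trace (Bm u)))"
    if "\<theta> \<in> carrier_vec (npar q)"
    by (rule standardized_score(3)[OF \<rho>(1) _ that]) (rule \<rho>(2), blast)
qed

lemma W_combination:
  assumes "u \<in> carrier_vec (npar q)"
  shows "u \<bullet> W_res m q Z V (stack_vecs m (\<lambda>i. Y i \<omega>)) \<psi> = (\<Sum>k<npar q. u $ k * W k \<omega>)"
  unfolding W_def by (rule scalar_prod_lessThan) (rule carrier_vecD[OF score(2)])

text \<open>Each component of W is a quadratic polynomial in the coordinates of R, which are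
  measurable as scalar products with unit vectors.\<close>

lemma W_measurable:
  assumes k: "k < npar q"
  shows "W k \<in> borel_measurable M"
proof -
  let ?e = "unit_vec (npar q) k :: real vec"
  obtain u where u: "\<And>y. ?e \<bullet> W_res m q Z V y \<psi> = 1 / 2 * (Rv y \<bullet> (Bm u *\<^sub>v Rv y) - trace (Bm u))"
    using score(3)[of ?e] by auto
  have comp: "(\<lambda>\<omega>. RY \<omega> $ i) \<in> borel_measurable M" if i: "i < d" for i
  proof -
    have "unit_vec d i \<bullet> RY \<omega> = RY \<omega> $ i" for \<omega>
      using Rv_carrier i by (rule scalar_prod_left_unit)
    then show ?thesis using R_char(1)[of "unit_vec d i"] by simp
  qed
  have "W k \<omega> = 1 / 2 * ((\<Sum>i<d. RY \<omega> $ i * (\<Sum>j<d. Bm u $$ (i, j) * RY \<omega> $ j)) - trace (Bm u))" for \<omega>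
  proof -
    have "W k \<omega> = ?e \<bullet> W_res m q Z V (stack_vecs m (\<lambda>i. Y i \<omega>)) \<psi>"
      unfolding W_def by (rule scalar_prod_left_unit[OF score(2) k, symmetric])
    also have "\<dots> = 1 / 2 * (RY \<omega> \<bullet> (Bm u *\<^sub>v RY \<omega>) - trace (Bm u))" by (rule u)
    also have "RY \<omega> \<bullet> (Bm u *\<^sub>v RY \<omega>) = (\<Sum>i<d. RY \<omega> $ i * (\<Sum>j<d. Bm u $$ (i, j) * RY \<omega> $ j))"
    proof -
      have d: "dim_vec (RY \<omega>) = d" using Rv_carrier by (rule carrier_vecD)
      show "RY \<omega> \<bullet> (Bm u *\<^sub>v RY \<omega>) = (\<Sum>i<d. RY \<omega> $ i * (\<Sum>j<d. Bm u $$ (i, j) * RY \<omega> $ j))"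
        using Bm_carrier[of u] by (simp add: scalar_prod_def lessThan_atLeast0 d)
    qed
    finally show ?thesis .
  qed
  then have "W k = (\<lambda>\<omega>. 1 / 2 * ((\<Sum>i<d. RY \<omega> $ i * (\<Sum>j<d. Bm u $$ (i, j) * RY \<omega> $ j)) - trace (Bm u)))"
    by (rule ext)
  also have "\<dots> \<in> borel_measurable M"
    by (intro borel_measurable_times borel_measurable_diff borel_measurable_const borel_measurable_sum comp) simp_all
  finally show ?thesis .
qed

text \<open>Membership of \<psi> in the parameter set and invertibility of its information are
  deterministic facts here, so coverage is the event that |W|^2 does not exceed the
  threshold.\<close>

lemma coverage_eq_cdf:
  "measure M {\<omega> \<in> space M. \<psi> \<in> conf_region m q Z V (stack_vecs m (\<lambda>i. Y i \<omega>)) \<alpha>} =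
    cdf (distr M borel (\<lambda>\<omega>. \<Sum>k<npar q. (W k \<omega>)\<^sup>2)) (quantile (chi_square (npar q)) (1 - \<alpha>))"
proof -
  have T: "T_res m q Z V (stack_vecs m (\<lambda>i. Y i \<omega>)) \<psi> = (\<Sum>k<npar q. (W k \<omega>)\<^sup>2)" for \<omega>
    unfolding T_res_def by (subst W_combination) (rule score(2), simp add: W_def power2_eq_square)
  have meas: "(\<lambda>\<omega>. \<Sum>k<npar q. (W k \<omega>)\<^sup>2) \<in> borel_measurable M"
    by (intro borel_measurable_sum borel_measurable_power W_measurable) simp
  have "\<psi> \<in> conf_region m q Z V (stack_vecs m (\<lambda>i. Y i \<omega>)) \<alpha> \<longleftrightarrow>
      (\<Sum>k<npar q. (W k \<omega>)\<^sup>2) \<le> quantile (chi_square (npar q)) (1 - \<alpha>)" for \<omega>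
    unfolding conf_region_def T[symmetric] using \<psi> score(1) by simp
  then have "{\<omega> \<in> space M. \<psi> \<in> conf_region m q Z V (stack_vecs m (\<lambda>i. Y i \<omega>)) \<alpha>} =
      (\<lambda>\<omega>. \<Sum>k<npar q. (W k \<omega>)\<^sup>2) -` {..quantile (chi_square (npar q)) (1 - \<alpha>)} \<inter> space M"
    by (simp only: vimage_def Int_def atMost_iff mem_Collect_eq conj_commute)
  then show ?thesis unfolding cdf_def using meas by (simp add: measure_distr)
qed

text \<open>The coordinates of u are at most h with h^2 = 2 s / \<rho>, and
  \<open>op_bounded_Bm\<close> turns this into the bound \<kappa> h^2 / a^2 for the squared operator
  norm. This is the origin of \<delta>, which shrinks like 1 / sqrt \<rho>, while the squared
  Frobenius norm stays at 2 s.\<close>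

lemma W_char_approx:
  fixes \<theta> :: "nat \<Rightarrow> real"
  assumes C: "\<And>B \<delta>. B \<in> carrier_mat d d \<Longrightarrow> B\<^sup>T = B \<Longrightarrow> op_bounded B (\<delta>\<^sup>2) \<Longrightarrow> 0 \<le> \<delta> \<Longrightarrow> \<delta> \<le> 1 \<Longrightarrow>
      cmod ((CLINT \<omega>|M. iexp (1 / 2 * (RY \<omega> \<bullet> (B *\<^sub>v RY \<omega>) - trace B))) - exp (- fro B / 4)) \<le> C * \<delta> * fro B"
    and s: "s = (\<Sum>k<npar q. (\<theta> k)\<^sup>2)"
    and \<delta>: "\<delta> = sqrt (\<kappa> * (2 * s / \<rho>) / a\<^sup>2)" "\<delta> \<le> 1"
  shows "cmod ((CLINT \<omega>|M. iexp (\<Sum>k<npar q. \<theta> k * W k \<omega>)) - exp (- s / 2)) \<le> C * \<delta> * (2 * s)"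
proof -
  define t where "t = vec (npar q) \<theta>"
  have t: "t \<in> carrier_vec (npar q)" by (simp add: t_def)
  have tt: "t \<bullet> t = s" by (simp add: t_def s scalar_prod_def power2_eq_square lessThan_atLeast0)
  obtain u where u: "\<And>k. npar q \<le> k \<Longrightarrow> u k = 0" "fro (Bm u) = 2 * s" "\<rho> * (\<Sum>j<npar q. (u j)\<^sup>2) \<le> 2 * s"
    "\<And>y. t \<bullet> W_res m q Z V y \<psi> = 1 / 2 * (Rv y \<bullet> (Bm u *\<^sub>v Rv y) - trace (Bm u))"
    using score(3)[OF t] unfolding tt by blast
  have s0: "0 \<le> s" unfolding s by (rule sum_nonneg) simp
  have nn: "0 \<le> \<kappa> * (2 * s / \<rho>) / a\<^sup>2" using s0 \<rho>(1) \<kappa>_pos by simp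
  define h where "h = sqrt (2 * s / \<rho>)"
  have "\<bar>u k\<bar> \<le> h" for k
  proof (cases "k < npar q")
    case True
    then have "(u k)\<^sup>2 \<le> (\<Sum>j<npar q. (u j)\<^sup>2)" by (intro member_le_sum) auto
    also have "\<dots> \<le> 2 * s / \<rho>" using u(3) \<rho>(1) by (simp add: pos_le_divide_eq mult.commute)
    finally have "sqrt ((u k)\<^sup>2) \<le> h" unfolding h_def by (rule real_sqrt_le_mono)
    then show ?thesis by simp
  next
    case False
    then show ?thesis using u(1)[of k] s0 \<rho>(1) by (simp add: h_def)
  qed
  then have "op_bounded (Bm u) (\<kappa> * h\<^sup>2 / a\<^sup>2)" by (rule op_bounded_Bm)
  moreover have "\<kappa> * h\<^sup>2 / a\<^sup>2 = \<delta>\<^sup>2"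
    using nn s0 \<rho>(1) unfolding \<delta>(1) h_def by simp
  ultimately have bd: "op_bounded (Bm u) (\<delta>\<^sup>2)" by simp
  have \<delta>0: "0 \<le> \<delta>" using nn unfolding \<delta>(1) by simp
  have "(\<Sum>k<npar q. \<theta> k * W k \<omega>) = 1 / 2 * (RY \<omega> \<bullet> (Bm u *\<^sub>v RY \<omega>) - trace (Bm u))" for \<omega>
    unfolding u(4)[symmetric] W_combination[OF t] by (intro sum.cong refl) (simp add: t_def)
  then have e: "(CLINT \<omega>|M. iexp (\<Sum>k<npar q. \<theta> k * W k \<omega>)) = (CLINT \<omega>|M. iexp (1 / 2 * (RY \<omega> \<bullet> (Bm u *\<^sub>v RY \<omega>) - trace (Bm u))))"
    by (simp only:)
  have "- fro (Bm u) / 4 = - s / 2" unfolding u(2) by simp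
  then show ?thesis using C[OF Bm_carrier Bm_sym bd \<delta>0 \<delta>(2)] unfolding e u(2) by simp
qed

end

section \<open>Compact parameter sets and uniform limits\<close>

lemma compact_coordinates:
  assumes A: "compactin (Euclidean_space r) A"
  shows "compact ((\<lambda>x. x k) ` A)"
proof -
  have "continuous_map (Euclidean_space r) euclideanreal (\<lambda>x. x k)"
    unfolding Euclidean_space_def
    by (intro continuous_map_from_subtopology continuous_map_product_projection) simp
  from image_compactin[OF A this] show ?thesis by (simp only: compactin_euclidean_iff)
qed

lemma compactin_Euclidean_space_bounds:
  assumes A: "compactin (Euclidean_space r) A"
  obtains b where "\<And>\<psi> k. \<psi> \<in> A \<Longrightarrow> \<bar>\<psi> k\<bar> \<le> b"
proof -
  have sub: "A \<subseteq> topspace (Euclidean_space r)" using A by (rule compactin_subset_topspace)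
  note comp = compact_coordinates[OF A]
  have "\<exists>b. \<forall>\<psi>\<in>A. \<bar>\<psi> k\<bar> \<le> b" for k
    using compact_imp_bounded[OF comp[of k]] by (auto simp: bounded_iff)
  then obtain B where B: "\<And>k \<psi>. \<psi> \<in> A \<Longrightarrow> \<bar>\<psi> k\<bar> \<le> B k" by metis
  show thesis
  proof (rule that)
    fix \<psi> k assume \<psi>: "\<psi> \<in> A"
    \<comment> \<open>Coordinates from r on vanish, so a finite sum of coordinate bounds serves all
      indices at once.\<close>
    show "\<bar>\<psi> k\<bar> \<le> (\<Sum>k<r. \<bar>B k\<bar>)"
    proof (cases "k < r")
      case True
      have "\<bar>\<psi> k\<bar> \<le> \<bar>B k\<bar>" using B[OF \<psi>, of k] by linarith
      also have "\<dots> \<le> (\<Sum>k<r. \<bar>B k\<bar>)" using True by (intro member_le_sum) auto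
      finally show ?thesis .
    next
      case False
      then have "\<psi> k = 0" using \<psi> sub by (auto simp: topspace_Euclidean_space)
      then show ?thesis by (simp add: sum_nonneg)
    qed
  qed
qed

text \<open>A coordinate attains its minimum on a nonempty compact set. For the error variance this
  gives one bound a for the whole set, away from the open end of the parameter set at 0.\<close>

lemma compactin_Euclidean_space_lower_bound:
  assumes A: "compactin (Euclidean_space r) A" and pos: "\<And>\<psi>. \<psi> \<in> A \<Longrightarrow> 0 < \<psi> k"
  obtains a :: real where "0 < a" "\<And>\<psi>. \<psi> \<in> A \<Longrightarrow> a \<le> \<psi> k"
proof (cases "A = {}")
  case True
  then show thesis using that[of 1] by simp
next
  case False
  have "compact ((\<lambda>x. x k) ` A)" by (rule compact_coordinates[OF A])
  then obtain x where "x \<in> (\<lambda>x. x k) ` A" "\<And>y. y \<in> (\<lambda>x. x k) ` A \<Longrightarrow> x \<le> y"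
    using compact_attains_inf[of "(\<lambda>x. x k) ` A"] False by auto
  then show thesis using pos by (intro that[of x]) auto
qed

text \<open>For each m a point is chosen that attains the supremum up to 1 / (m + 1), and the
  hypothesis is applied to the resulting sequence. The bound K keeps the supremum finite, so that
  such a point exists; below m0 any point will do.\<close>

lemma SUP_ennreal_tendsto_0:
  fixes f :: "nat \<Rightarrow> 'b \<Rightarrow> real"
  assumes bd: "\<And>m x. m0 \<le> m \<Longrightarrow> x \<in> A \<Longrightarrow> f m x \<le> K"
    and seq: "\<And>x. (\<And>m. x m \<in> A) \<Longrightarrow> (\<lambda>m. f m (x m)) \<longlonglongrightarrow> 0"
  shows "(\<lambda>m. SUP x\<in>A. ennreal (f m x)) \<longlonglongrightarrow> 0"
proof (cases "A = {}")
  case True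
  then show ?thesis by (simp add: bot_ennreal)
next
  case False
  have "\<exists>x\<in>A. (SUP x\<in>A. ennreal (f m x)) < ennreal (f m x) + ennreal (1 / real (Suc m))" if "m0 \<le> m" for m
  proof (rule SUP_approx_ennreal[OF _ _ refl])
    have "(SUP x\<in>A. ennreal (f m x)) \<le> ennreal K" using bd[OF that] by (intro SUP_least ennreal_leI)
    then have "(SUP x\<in>A. ennreal (f m x)) < \<infinity>" by (rule order.strict_trans1) simp
    then show "(SUP x\<in>A. ennreal (f m x)) \<noteq> \<infinity>" by (rule less_imp_neq)
  qed (use False in simp_all)
  then have "\<exists>x. x \<in> A \<and> (m0 \<le> m \<longrightarrow> (SUP x\<in>A. ennreal (f m x)) < ennreal (f m x) + ennreal (1 / real (Suc m)))" for m
    using False by (cases "m0 \<le> m") auto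
  then obtain x where x: "\<And>m. x m \<in> A" "\<And>m. m0 \<le> m \<Longrightarrow> (SUP x\<in>A. ennreal (f m x)) < ennreal (f m (x m)) + ennreal (1 / real (Suc m))"
    by metis
  have "(\<lambda>m. ennreal (f m (x m)) + ennreal (1 / real (Suc m))) \<longlonglongrightarrow> ennreal 0 + ennreal 0"
    by (intro tendsto_add tendsto_ennrealI seq x(1) lim_1_over_n[THEN LIMSEQ_Suc])
  then have lim: "(\<lambda>m. ennreal (f m (x m)) + ennreal (1 / real (Suc m))) \<longlonglongrightarrow> 0" by simp
  have le: "eventually (\<lambda>m. (SUP x\<in>A. ennreal (f m x)) \<le> ennreal (f m (x m)) + ennreal (1 / real (Suc m))) sequentially"
    by (rule eventually_sequentiallyI[of m0]) (rule less_imp_le[OF x(2)])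
  show ?thesis by (rule tendsto_sandwich[OF _ le tendsto_const lim]) simp
qed

text \<open>The spaces \<open>M m \<psi>\<close> carry the probability for each true parameter. The
  supremum is taken in \<open>ennreal\<close>, where it exists without boundedness conditions and is
  0 over the empty set.\<close>

theorem corollary3:
  fixes q :: nat
    and n :: "nat \<Rightarrow> nat \<Rightarrow> nat"
    and p :: "nat \<Rightarrow> nat"
    and X Z :: "nat \<Rightarrow> nat \<Rightarrow> real mat"
    and \<beta> :: "nat \<Rightarrow> real vec"
    and V :: "nat \<Rightarrow> real mat"
    and M :: "nat \<Rightarrow> (nat \<Rightarrow> real) \<Rightarrow> 'a measure"
    and U E Y :: "nat \<Rightarrow> (nat \<Rightarrow> real) \<Rightarrow> nat \<Rightarrow> 'a \<Rightarrow> real vec"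
    and N :: "nat \<Rightarrow> nat"
    and c1 c2 \<alpha> :: real
    and A :: "(nat \<Rightarrow> real) set"
  defines "N \<equiv> \<lambda>m. \<Sum>i<m. n m i"
  assumes q: "1 \<le> q"
    and X: "\<And>m i. 1 \<le> m \<Longrightarrow> i < m \<Longrightarrow> X m i \<in> carrier_mat (n m i) (p m)"
    and Z: "\<And>m i. 1 \<le> m \<Longrightarrow> i < m \<Longrightarrow> Z m i \<in> carrier_mat (n m i) q"
    and \<beta>: "\<And>m. 1 \<le> m \<Longrightarrow> \<beta> m \<in> carrier_vec (p m)"
    and model: "\<And>m \<psi>. 1 \<le> m \<Longrightarrow> \<psi> \<in> param_set q \<Longrightarrow>
      cluster_model (M m \<psi>) m q (n m) (X m) (Z m) (\<beta> m) \<psi> (U m \<psi>) (E m \<psi>) (Y m \<psi>)"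
    and c1: "1 < c1" and c2: "1 < c2"
    and i: "\<And>m. 1 \<le> m \<Longrightarrow> c1 \<le> (real (N m) / real m) / real q"
    and ii: "\<And>m i. 1 \<le> m \<Longrightarrow> i < m \<Longrightarrow>
      inverse c2 \<le> gamma_min ((Z m i)\<^sup>T * Z m i) \<and>
      gamma_min ((Z m i)\<^sup>T * Z m i) \<le> gamma_max ((Z m i)\<^sup>T * Z m i) \<and>
      gamma_max ((Z m i)\<^sup>T * Z m i) \<le> c2"
    and iii: "(\<lambda>m. real (p m) / real m) \<longlonglongrightarrow> 0"
    and iv: "\<And>m. 1 \<le> m \<Longrightarrow> vec_space.rank (N m) (stack_mats m (p m) (X m)) = p m"
    and V: "\<And>m. 1 \<le> m \<Longrightarrow> V m \<in> carrier_mat (N m) (N m - p m)"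
      "\<And>m. 1 \<le> m \<Longrightarrow> (V m)\<^sup>T * V m = 1\<^sub>m (N m - p m)"
      "\<And>m. 1 \<le> m \<Longrightarrow> (V m)\<^sup>T * stack_mats m (p m) (X m) = 0\<^sub>m (N m - p m) (p m)"
    and \<alpha>: "0 < \<alpha>" "\<alpha> < 1"
    and A: "A \<subseteq> param_set q" "compactin (Euclidean_space (npar q)) A"
  shows "(\<lambda>m. SUP \<psi>\<in>A. ennreal \<bar>measure (M m \<psi>)
      {\<omega> \<in> space (M m \<psi>). \<psi> \<in> conf_region m q (block_diag m (Z m)) (V m)
         (stack_vecs m (\<lambda>i. Y m \<psi> i \<omega>)) \<alpha>} - (1 - \<alpha>)\<bar>) \<longlonglongrightarrow> 0"
proof -
  define r where "r = npar q"
  define cov where "cov m \<psi> = measure (M m \<psi>)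
      {\<omega> \<in> space (M m \<psi>). \<psi> \<in> conf_region m q (block_diag m (Z m)) (V m)
         (stack_vecs m (\<lambda>i. Y m \<psi> i \<omega>)) \<alpha>}" for m \<psi>
  obtain b where b: "\<And>\<psi> k. \<psi> \<in> A \<Longrightarrow> \<bar>\<psi> k\<bar> \<le> b"
    using compactin_Euclidean_space_bounds[OF A(2)] by blast
  have "0 < \<psi> (npar q - 1)" if "\<psi> \<in> A" for \<psi>
    using A(1) that by (auto simp: param_set_def psi_last_def)
  then obtain a where a: "0 < a" "\<And>\<psi>. \<psi> \<in> A \<Longrightarrow> a \<le> \<psi> (npar q - 1)"
    using compactin_Euclidean_space_lower_bound[OF A(2)] by blast
  \<comment> \<open>The relative excess of N over m q that \<open>fro_Sig_ge\<close> asks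
    for.\<close>
  define \<epsilon> where "\<epsilon> = c1 - 1"
  define kap where "kap = cluster_design.\<kappa> q c2"
  define g' where "g' = (min 1 \<epsilon> / 4) * ((inverse c2)\<^sup>2 / real r) / 2"
  have \<epsilon>: "0 < \<epsilon>" using c1 by (simp add: \<epsilon>_def)
  have r: "1 \<le> r" by (simp add: r_def npar_def)
  have g': "0 < g'" using \<epsilon> c2 r by (simp add: g'_def)
  have design: "cluster_design m q (N m) (N m - p m) (block_diag m (Z m)) (V m) c2" if m: "1 \<le> m" for m
  proof
    have Zc: "Z m i \<in> carrier_mat (n m i) q" if "i < m" for i using Z[OF m that] .
    have bounds: "inverse c2 * (x \<bullet> x) \<le> (Z m i *\<^sub>v x) \<bullet> (Z m i *\<^sub>v x)" "(Z m i *\<^sub>v x) \<bullet> (Z m i *\<^sub>v x) \<le> c2 * (x \<bullet> x)"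
      if "i < m" "x \<in> carrier_vec q" for i x
      using gamma_bounds[OF Zc[OF that(1)], of "inverse c2" c2 x] ii[OF m that(1)] that(2) by blast+
    show "1 \<le> q" "1 \<le> c2" using q c2 by simp_all
    show "block_diag m (Z m) \<in> carrier_mat (N m) (m * q)"
      using block_diag_carrier[of m "Z m" "n m" "\<lambda>_. q"] Zc by (simp add: N_def)
    show "op_bounded (block_diag m (Z m)) c2"
    proof (rule op_bounded_block_diag[of m "Z m" "n m" "\<lambda>_. q"])
      fix i assume i: "i < m"
      show "op_bounded (Z m i) c2" using c2 bounds(2)[OF i] Zc[OF i] by (intro op_boundedI) simp_all
    qed (use Zc c2 in simp_all)
    show "inverse c2 * (x \<bullet> x) \<le> (block_diag m (Z m) *\<^sub>v x) \<bullet> (block_diag m (Z m) *\<^sub>v x)"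
      if "x \<in> carrier_vec (m * q)" for x
      using that by (intro block_diag_norm_ge[of m "Z m" "n m" "\<lambda>_. q"] Zc bounds(1)) simp_all
    show "V m \<in> carrier_mat (N m) (N m - p m)" "(V m)\<^sup>T * V m = 1\<^sub>m (N m - p m)"
      using V(1,2)[OF m] .
  qed
  \<comment> \<open>\<open>\<kappa>\<close> depends on q and c2 only, so its positivity may be read
    off from the design with m = 1.\<close>
  have kap: "0 < kap" unfolding kap_def by (rule cluster_design.\<kappa>_pos[OF design[OF order_refl]])
  have "0 < g' / (2 * kap)" using g' kap by simp
  \<comment> \<open>A ratio p / m below 1 keeps p at most m and hence at most N, so that the natural
    subtraction N - p is exact. A ratio below \<open>g' / (2 * kap)\<close> limits the projection
    loss to half of the lower bound for \<open>fro (Sig u)\<close>.\<close>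
  then have "0 < min 1 (g' / (2 * kap))" by simp
  then have "eventually (\<lambda>m. real (p m) / real m < min 1 (g' / (2 * kap))) sequentially"
    by (rule order_tendstoD(2)[OF iii])
  then obtain m1 where m1: "\<And>m. m1 \<le> m \<Longrightarrow> real (p m) / real m < min 1 (g' / (2 * kap))"
    unfolding eventually_sequentially by blast
  define m0 where "m0 = max 1 m1"
  define \<rho> where "\<rho> m = g' * real m / (kap * b\<^sup>2)" for m
  have param: "cluster_param m q (N m) (N m - p m) (block_diag m (Z m)) (V m) c2 \<psi> a b"
    if "m0 \<le> m" "\<psi> \<in> A" for m \<psi>
    unfolding cluster_param_def cluster_param_axioms_def
    using that A(1) a b[OF that(2)] design[of m] by (auto simp: m0_def param_set_def psi_last_def)
  have pmodel: "cluster_param_model m q (N m) (N m - p m) (block_diag m (Z m)) (V m) c2 \<psi> a b (M m \<psi>) (n m) (p m)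
      (X m) (Z m) (\<beta> m) (U m \<psi>) (E m \<psi>) (Y m \<psi>) (\<rho> m)"
    if m: "m0 \<le> m" and \<psi>: "\<psi> \<in> A" for m \<psi>
  proof -
    interpret cluster_param m q "N m" "N m - p m" "block_diag m (Z m)" "V m" c2 \<psi> a b
      by (rule param[OF m \<psi>])
    have m': "1 \<le> m" "m1 \<le> m" using m by (auto simp: m0_def)
    have c1m: "c1 * (real m * real q) \<le> real (N m)"
      using i[OF m'(1)] m'(1) q by (simp add: field_simps)
    have "real m \<le> c1 * (real m * real q)"
      using mult_mono[of 1 c1 "real m" "real m * real q"] mult_left_mono[of 1 "real q" "real m"] c1 q by simp
    moreover have "real (p m) \<le> real m" using m1[OF m'(2)] m'(1) by (simp add: divide_less_eq)
    ultimately have pN: "p m \<le> N m" using c1m by linarith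
    have pg: "real (p m) \<le> g' / (2 * kap) * real m" using m1[OF m'(2)] m'(1) by (simp add: divide_less_eq)
    show ?thesis
    proof
      show "cluster_model (M m \<psi>) m q (n m) (X m) (Z m) (\<beta> m) \<psi> (U m \<psi>) (E m \<psi>) (Y m \<psi>)"
        using model[OF m'(1)] A(1) \<psi> by blast
      show "0 < \<rho> m" using g' kap b_pos m'(1) by (simp add: \<rho>_def)
      fix u :: "nat \<Rightarrow> real" assume u: "\<And>k. npar q \<le> k \<Longrightarrow> u k = 0"
      show "\<rho> m * (\<Sum>j<npar q. (u j)\<^sup>2) \<le> fro (Bm u)"
        unfolding \<rho>_def kap_def
      proof (rule fro_Bm_lower[OF \<epsilon> _ _ _ _ _ u])
        show "(1 + \<epsilon>) * real (m * q) \<le> real (N m)" using c1m by (simp add: \<epsilon>_def)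
        show "real (N m) - real (N m - p m) \<le> g' / (2 * kap) * real m" using pg pN by simp
        show "0 \<le> g' / (2 * kap)" "2 * cluster_design.\<kappa> q c2 * (g' / (2 * kap)) \<le> g'"
          using g' kap by (simp_all add: kap_def[symmetric])
        show "g' = min 1 \<epsilon> / 4 * ((inverse c2)\<^sup>2 / real (npar q)) / 2" by (simp add: g'_def r_def)
      qed
    qed (use X[OF m'(1)] Z[OF m'(1)] \<beta>[OF m'(1)] V(3)[OF m'(1)] A(1) \<psi> in \<open>auto simp: N_def\<close>)
  qed
  have limit: "(\<lambda>m. cov m (\<psi>s m)) \<longlonglongrightarrow> 1 - \<alpha>" if \<psi>s: "\<And>m. \<psi>s m \<in> A" for \<psi>s
  proof -
    \<comment> \<open>Shifted by m0 because the lower bound on the information is available only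
      from there on.\<close>
    define W where "W m = cluster_param_model.W (m + m0) q (block_diag (m + m0) (Z (m + m0))) (V (m + m0))
        (\<psi>s (m + m0)) (Y (m + m0) (\<psi>s (m + m0)))" for m
    define Ms where "Ms m = M (m + m0) (\<psi>s (m + m0))" for m
    note pm = pmodel[OF le_add2 \<psi>s]
    obtain C where C: "0 \<le> C" "\<And>(M :: 'a measure) R B d \<delta>. std_gaussian M d R \<Longrightarrow>
      B \<in> carrier_mat d d \<Longrightarrow> B\<^sup>T = B \<Longrightarrow> op_bounded B (\<delta>\<^sup>2) \<Longrightarrow> 0 \<le> \<delta> \<Longrightarrow> \<delta> \<le> 1 \<Longrightarrow>
      cmod ((CLINT \<omega>|M. iexp (1 / 2 * (R \<omega> \<bullet> (B *\<^sub>v R \<omega>) - trace B))) - exp (- fro B / 4)) \<le> C * \<delta> * fro B"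
      using gaussian_quadratic_form_char by blast
    have conv: "weak_conv_m (\<lambda>m. distr (Ms m) borel (\<lambda>\<omega>. \<Sum>k<r. (W m k \<omega>)\<^sup>2)) (chi_square r)"
    proof (rule norm_tendsto_chi_square)
      show "prob_space (Ms m)" for m
        unfolding Ms_def by (rule cluster_param_model.prob_space_M[OF pm])
      show "W m k \<in> borel_measurable (Ms m)" if "k < r" for m k
        unfolding W_def Ms_def by (rule cluster_param_model.W_measurable[OF pm]) (use that in \<open>simp add: r_def\<close>)
      fix \<theta> :: "nat \<Rightarrow> real"
      define s where "s = (\<Sum>k<r. (\<theta> k)\<^sup>2)"
      \<comment> \<open>Of order 1 / sqrt m, since \<rho> is proportional to m.\<close>
      define \<delta> where "\<delta> m = sqrt (kap * (2 * s / \<rho> (m + m0)) / a\<^sup>2)" for m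
      define z where "z m = (CLINT \<omega>|Ms m. iexp (\<Sum>k<r. \<theta> k * W m k \<omega>))" for m
      have \<delta>0: "\<delta> \<longlonglongrightarrow> 0"
      proof -
        have "kap * (2 * s / \<rho> m) / a\<^sup>2 = (2 * s * kap * kap * b\<^sup>2 / (g' * a\<^sup>2)) / real m" for m
          by (simp add: \<rho>_def mult_ac)
        moreover have "(\<lambda>m. (2 * s * kap * kap * b\<^sup>2 / (g' * a\<^sup>2)) / real m) \<longlonglongrightarrow> 0"
          by (rule lim_const_over_n)
        ultimately have "(\<lambda>m. kap * (2 * s / \<rho> m) / a\<^sup>2) \<longlonglongrightarrow> 0" by simp
        then have "(\<lambda>m. kap * (2 * s / \<rho> (m + m0)) / a\<^sup>2) \<longlonglongrightarrow> 0" by (rule LIMSEQ_ignore_initial_segment)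
        then show ?thesis unfolding \<delta>_def[abs_def] using tendsto_real_sqrt[of _ 0] by fastforce
      qed
      have bound: "cmod (z m - exp (- s / 2)) \<le> C * \<delta> m * (2 * s)" if \<delta>1: "\<delta> m \<le> 1" for m
        unfolding z_def W_def Ms_def r_def
      proof (rule cluster_param_model.W_char_approx[OF pm])
        show "s = (\<Sum>k<npar q. (\<theta> k)\<^sup>2)" by (simp add: s_def r_def)
        show "\<delta> m = sqrt (cluster_design.\<kappa> q c2 * (2 * s / \<rho> (m + m0)) / a\<^sup>2)" by (simp add: \<delta>_def kap_def)
        show "\<delta> m \<le> 1" by (rule \<delta>1)
      qed (rule C(2)[OF cluster_param_model.RY_std_gaussian[OF pm]], assumption+)
      have "(\<lambda>m. z m - exp (- s / 2)) \<longlonglongrightarrow> 0"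
      proof (rule Lim_null_comparison)
        have "eventually (\<lambda>m. \<delta> m < 1) sequentially" using \<delta>0 by (rule order_tendstoD) simp
        then show "eventually (\<lambda>m. norm (z m - exp (- s / 2)) \<le> C * \<delta> m * (2 * s)) sequentially"
          by eventually_elim (rule bound, simp)
        show "(\<lambda>m. C * \<delta> m * (2 * s)) \<longlonglongrightarrow> 0"
          using tendsto_mult_right[OF tendsto_mult_left[OF \<delta>0, of C], of "2 * s"] by simp
      qed
      then show "(\<lambda>m. CLINT \<omega>|Ms m. iexp (\<Sum>k<r. \<theta> k * W m k \<omega>)) \<longlonglongrightarrow> exp (- (\<Sum>k<r. (\<theta> k)\<^sup>2) / 2)"
        unfolding z_def s_def by (simp add: LIM_zero_iff)
    qed
    \<comment> \<open>Weak convergence gives convergence of distribution functions at continuity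
      points, and the chi-square law has no atoms.\<close>
    have "(\<lambda>m. cdf (distr (Ms m) borel (\<lambda>\<omega>. \<Sum>k<r. (W m k \<omega>)\<^sup>2)) (quantile (chi_square r) (1 - \<alpha>)))
        \<longlonglongrightarrow> cdf (chi_square r) (quantile (chi_square r) (1 - \<alpha>))"
      using conv cdf_chi_square_quantile(1)[OF r, of "1 - \<alpha>"] \<alpha> unfolding weak_conv_m_def weak_conv_def by simp
    moreover have "cdf (chi_square r) (quantile (chi_square r) (1 - \<alpha>)) = 1 - \<alpha>"
      using r \<alpha> by (intro cdf_chi_square_quantile(2)) simp_all
    moreover have "cdf (distr (Ms m) borel (\<lambda>\<omega>. \<Sum>k<r. (W m k \<omega>)\<^sup>2)) (quantile (chi_square r) (1 - \<alpha>)) = cov (m + m0) (\<psi>s (m + m0))" for m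
      unfolding cov_def W_def Ms_def r_def by (rule cluster_param_model.coverage_eq_cdf[OF pm, symmetric])
    ultimately have "(\<lambda>m. cov (m + m0) (\<psi>s (m + m0))) \<longlonglongrightarrow> 1 - \<alpha>" by simp
    then show ?thesis by (rule LIMSEQ_offset)
  qed
  have "(\<lambda>m. SUP \<psi>\<in>A. ennreal \<bar>cov m \<psi> - (1 - \<alpha>)\<bar>) \<longlonglongrightarrow> 0"
  proof (rule SUP_ennreal_tendsto_0)
    show "\<bar>cov m \<psi> - (1 - \<alpha>)\<bar> \<le> 1" if "m0 \<le> m" "\<psi> \<in> A" for m \<psi>
    proof -
      interpret prob_space "M m \<psi>" by (rule cluster_param_model.prob_space_M[OF pmodel[OF that]])
      have "0 \<le> cov m \<psi>" "cov m \<psi> \<le> 1" unfolding cov_def by simp_all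
      then show ?thesis using \<alpha> by simp
    qed
    show "(\<lambda>m. \<bar>cov m (\<psi>s m) - (1 - \<alpha>)\<bar>) \<longlonglongrightarrow> 0" if "\<And>m. \<psi>s m \<in> A" for \<psi>s
      using limit[OF that] by (simp add: LIM_zero tendsto_rabs_zero)
  qed
  then show ?thesis unfolding cov_def .
qed

end
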